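(* Let $\mathbb{B}$ be any set of bubbles (connected bipartite $D$-regular properly edge-colored graphs with colors $1,\dots,D$), each bubble $B\in\mathbb{B}$ being equipped with a pairing $\Omega_B$ of its vertices, and let $q\ge 0$. Then the map $\Psi_0:\mathbb{G}^q(\mathbb{B})\to\mathbb{S}^q(\mathbb{B},\Omega_{\mathbb{B}})$ is a bijection. It maps the bubbles of $G$ isomorphic to $B$ to the submaps isomorphic to $\Psi(B,\Omega_B)$, and for each $i\in\{1,\dots,D\}$ it maps the bicolored cycles $0i$ of $G$ to the faces of the bicolored submap $\Gamma^{(i)}$ of colors $0$ and $i$ of $\Gamma=\Psi_0(G)$ (bicolored cycles of $G$ corresponding to the faces that meet no marked corner).
   Context: $\mathbb{G}^q(\mathbb{B})$: connected finite bipartite (black/white) edge-colored graphs (multiple edges allowed) in which each vertex has exactly one incident edge of each color in $\{0,\dots,D\}$, except for $q$ white and $q$ black vertices which have no color-$0$ edge, and such that the connected components left after deleting all color-$0$ edges (the bubbles of $G$) are copies of elements of $\mathbb{B}$. A pairing is a partition of the vertices into black–white pairs. Each bubble of $G$ is identified with the corresponding model $B\in\mathbb{B}$, so that the global choice of pairing $\Omega_B$ for all copies of $B$ gives a pairing $\Omega$ of the vertices of $G$; likewise the relevant submaps of stacked maps are identified with the models $\Psi(B,\Omega_B)$, and isomorphisms respect these identifications. Stacked maps: objects with white vertices, colored vertices and colored edges; an edge of color $c$ joins a white vertex to a vertex of color $c$; each white vertex is incident to exactly one edge of each color, with no ordering; a color-$c$ vertex is incident only to color-$c$ edges, cyclically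 ordered around it. Some corners at color-$0$ vertices may be marked, at most one per vertex. $\Psi(B,\Omega_B)$ (colors $1,\dots,D$): for each color $i$ let $\sigma_i$ be the permutation of the pairs with $\sigma_i(\pi)=\pi'$ if the color-$i$ edge at the black vertex of $\pi$ ends at the white vertex of $\pi'$; there is one white vertex per pair and, for each cycle of $\sigma_i$, a color-$i$ vertex joined to the pairs of the cycle by color-$i$ edges in the counterclockwise order given by $\sigma_i$. $\mathbb{S}^q(\mathbb{B},\Omega_{\mathbb{B}})$: connected stacked maps with colors $0,\dots,D$ and $q$ marked corners on $q$ distinct color-$0$ vertices, such that deleting all color-$0$ vertices and edges leaves a disjoint union of copies of the stacked maps $\Psi(B,\Omega_B)$, $B\in\mathbb{B}$. $\Psi_0(G)$: first add canonically $q$ marked color-$0$ edges to $G$ (each vertex without color-$0$ edge is an endpoint of a unique path alternating pairs of $\Omega$ and color-$0$ edges; join the two endpoints of each such path by a marked color-$0$ edge). Then proceed as for $\Psi$ with colors $1,\dots,D$, while color $0$ uses the opposite orientation: $\sigma_0(\pi)=\pi'$ if the color-$0$ edge at the white vertex of $\pi$ ends at the black vertex of $\pi'$, and each cycle of $\sigma_0$ gives a color-$0$ vertex with this counterclockwise order; marked color-$0$ edges give marked corners. $\Gamma^{(i)}$ is obtained from $\Gamma$ by keeping only the white vertices and the vertices and edges of colors $0$ and $i$; its white vertices have valency two, so it is an ordinary combinatorial map. *)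

theory Defs
  imports "HOL-Combinatorics.Orbits"
begin

subsection \<open>Edge-coloured bipartite graphs\<close>

text \<open>
  An edge of colour \<open>c\<close> joining the black vertex \<open>b\<close> to the white vertex \<open>w\<close> is the triple
  \<open>(c, b, w)\<close>. Parallel edges are allowed; they necessarily have different colours, because a vertex
  has at most one incident edge of each colour.
\<close>

record 'v bgraph =
  blacks :: "'v set"
  gwhites :: "'v set"
  gedges :: "(nat \<times> 'v \<times> 'v) set"

definition gverts :: "'v bgraph \<Rightarrow> 'v set" where
  "gverts G = blacks G \<union> gwhites G"

definition has_edge :: "'v bgraph \<Rightarrow> nat \<Rightarrow> 'v \<Rightarrow> bool" where
  "has_edge G c v \<longleftrightarrow> (\<exists>u. (c, v, u) \<in> gedges G \<or> (c, u, v) \<in> gedges G)"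

definition coloured_graph :: "nat set \<Rightarrow> 'v bgraph \<Rightarrow> bool" where
  "coloured_graph I G \<longleftrightarrow>
     finite (gverts G) \<and> blacks G \<inter> gwhites G = {} \<and>
     gedges G \<subseteq> I \<times> blacks G \<times> gwhites G \<and>
     (\<forall>c b w w'. (c, b, w) \<in> gedges G \<longrightarrow> (c, b, w') \<in> gedges G \<longrightarrow> w = w') \<and>
     (\<forall>c b b' w. (c, b, w) \<in> gedges G \<longrightarrow> (c, b', w) \<in> gedges G \<longrightarrow> b = b')"

definition gadj :: "'v bgraph \<Rightarrow> ('v \<times> 'v) set" where
  "gadj G = {(u, v). \<exists>c. (c, u, v) \<in> gedges G \<or> (c, v, u) \<in> gedges G}"

definition gconnected :: "'v bgraph \<Rightarrow> bool" where
  "gconnected G \<longleftrightarrow> gverts G \<noteq> {} \<and> (\<forall>u\<in>gverts G. \<forall>v\<in>gverts G. (u, v) \<in> (gadj G)\<^sup>*)"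

definition ginduced :: "'v bgraph \<Rightarrow> 'v set \<Rightarrow> 'v bgraph" where
  "ginduced G X = \<lparr>blacks = blacks G \<inter> X, gwhites = gwhites G \<inter> X,
     gedges = {(c, b, w) \<in> gedges G. b \<in> X \<and> w \<in> X}\<rparr>"

definition gcomponents :: "'v bgraph \<Rightarrow> 'v bgraph set" where
  "gcomponents G = ginduced G ` (gverts G // (gadj G)\<^sup>*)"

definition gdelete0 :: "'v bgraph \<Rightarrow> 'v bgraph" where
  "gdelete0 G = G\<lparr>gedges := {(c, b, w) \<in> gedges G. c \<noteq> 0}\<rparr>"

definition bubbles :: "'v bgraph \<Rightarrow> 'v bgraph set" where
  "bubbles G = gcomponents (gdelete0 G)"

definition graph_iso :: "('u \<Rightarrow> 'v) \<Rightarrow> 'u bgraph \<Rightarrow> 'v bgraph \<Rightarrow> bool" where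
  "graph_iso f G H \<longleftrightarrow>
     inj_on f (gverts G) \<and> f ` blacks G = blacks H \<and> f ` gwhites G = gwhites H \<and>
     gedges H = (\<lambda>(c, b, w). (c, f b, f w)) ` gedges G"

definition bubble :: "nat \<Rightarrow> 'v bgraph \<Rightarrow> bool" where
  "bubble D B \<longleftrightarrow> coloured_graph {1..D} B \<and> gconnected B \<and>
     (\<forall>v\<in>gverts B. \<forall>c\<in>{1..D}. has_edge B c v)"

text \<open>A pair of a pairing is written with its black vertex first.\<close>

definition pairing :: "'v bgraph \<Rightarrow> ('v \<times> 'v) set \<Rightarrow> bool" where
  "pairing G P \<longleftrightarrow> P \<subseteq> blacks G \<times> gwhites G \<and>
     (\<forall>v\<in>gverts G. \<exists>!\<pi>. \<pi> \<in> P \<and> v \<in> {fst \<pi>, snd \<pi>})"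


subsection \<open>Graphs whose bubbles are identified with model bubbles\<close>

text \<open>
  The identification of the bubbles of \<open>G\<close> with elements of \<open>\<BB>\<close> is a function \<open>\<iota>\<close> sending a vertex
  \<open>v\<close> to the pair consisting of the model of the bubble containing \<open>v\<close> and of the vertex of that
  model to which \<open>v\<close> corresponds.
\<close>

definition bubble_copy ::
    "('v \<Rightarrow> 'b bgraph \<times> 'b) \<Rightarrow> 'b bgraph \<Rightarrow> 'v bgraph \<Rightarrow> bool" where
  "bubble_copy \<iota> B C \<longleftrightarrow> (\<forall>v\<in>gverts C. fst (\<iota> v) = B) \<and> graph_iso (snd \<circ> \<iota>) C B"

definition GG :: "nat \<Rightarrow> nat \<Rightarrow> 'b bgraph set \<Rightarrow> ('v bgraph \<times> ('v \<Rightarrow> 'b bgraph \<times> 'b)) set" where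
  "GG D q \<BB> = {(G, \<iota>).
     coloured_graph {0..D} G \<and> gconnected G \<and>
     (\<forall>v\<in>gverts G. \<forall>c\<in>{1..D}. has_edge G c v) \<and>
     card {w \<in> gwhites G. \<not> has_edge G 0 w} = q \<and>
     card {b \<in> blacks G. \<not> has_edge G 0 b} = q \<and>
     (\<forall>C\<in>bubbles G. \<exists>B\<in>\<BB>. bubble_copy \<iota> B C)}"

definition ident_graph_iso ::
    "'u bgraph \<times> ('u \<Rightarrow> 'b bgraph \<times> 'b) \<Rightarrow> 'v bgraph \<times> ('v \<Rightarrow> 'b bgraph \<times> 'b) \<Rightarrow> bool" where
  "ident_graph_iso = (\<lambda>(G, \<iota>) (G', \<iota>').
     \<exists>f. graph_iso f G G' \<and> (\<forall>v\<in>gverts G. \<iota>' (f v) = \<iota> v))"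

definition GG_iso_rel ::
    "nat \<Rightarrow> nat \<Rightarrow> 'b bgraph set \<Rightarrow>
     (('v bgraph \<times> ('v \<Rightarrow> 'b bgraph \<times> 'b)) \<times> ('v bgraph \<times> ('v \<Rightarrow> 'b bgraph \<times> 'b))) set" where
  "GG_iso_rel D q \<BB> = {(x, y). x \<in> GG D q \<BB> \<and> y \<in> GG D q \<BB> \<and> ident_graph_iso x y}"

definition global_pairing ::
    "('b bgraph \<Rightarrow> ('b \<times> 'b) set) \<Rightarrow> 'v bgraph \<Rightarrow> ('v \<Rightarrow> 'b bgraph \<times> 'b) \<Rightarrow> ('v \<times> 'v) set" where
  "global_pairing \<Omega> G \<iota> =
     {(b, w). \<exists>C\<in>bubbles G. b \<in> blacks C \<and> w \<in> gwhites C \<and>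
        (snd (\<iota> b), snd (\<iota> w)) \<in> \<Omega> (fst (\<iota> b))}"


subsection \<open>Stacked maps\<close>

text \<open>
  \<open>wend e\<close> and \<open>cend e\<close> are the white and the coloured end of the edge \<open>e\<close>, and \<open>nxt e\<close> is the edge
  following \<open>e\<close> counterclockwise around \<open>cend e\<close>. The corner between \<open>e\<close> and \<open>nxt e\<close> at \<open>cend e\<close> is
  represented by \<open>e\<close>; so \<open>marked\<close> is the set of marked corners.
\<close>

record ('w, 'e, 'c) smap =
  whites :: "'w set"
  cverts :: "'c set"
  sedges :: "'e set"
  vcol :: "'c \<Rightarrow> nat"
  ecol :: "'e \<Rightarrow> nat"
  wend :: "'e \<Rightarrow> 'w"
  cend :: "'e \<Rightarrow> 'c"
  nxt :: "'e \<Rightarrow> 'e"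
  marked :: "'e set"

text \<open>
  The library predicate \<open>cyclic_on f S\<close> says that \<open>S\<close> is a single nonempty finite cycle of \<open>f\<close>; in
  particular every coloured vertex carries at least one edge.
\<close>

definition stacked_map :: "nat set \<Rightarrow> ('w, 'e, 'c) smap \<Rightarrow> bool" where
  "stacked_map I \<Gamma> \<longleftrightarrow>
     finite (whites \<Gamma>) \<and> finite (cverts \<Gamma>) \<and> finite (sedges \<Gamma>) \<and>
     (\<forall>v\<in>cverts \<Gamma>. vcol \<Gamma> v \<in> I) \<and>
     (\<forall>e\<in>sedges \<Gamma>. ecol \<Gamma> e \<in> I \<and> wend \<Gamma> e \<in> whites \<Gamma> \<and>
        cend \<Gamma> e \<in> cverts \<Gamma> \<and> vcol \<Gamma> (cend \<Gamma> e) = ecol \<Gamma> e) \<and>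
     (\<forall>w\<in>whites \<Gamma>. \<forall>c\<in>I. \<exists>!e. e \<in> sedges \<Gamma> \<and> ecol \<Gamma> e = c \<and> wend \<Gamma> e = w) \<and>
     (\<forall>v\<in>cverts \<Gamma>. cyclic_on (nxt \<Gamma>) {e \<in> sedges \<Gamma>. cend \<Gamma> e = v}) \<and>
     marked \<Gamma> \<subseteq> {e \<in> sedges \<Gamma>. ecol \<Gamma> e = 0} \<and> inj_on (cend \<Gamma>) (marked \<Gamma>)"

definition sverts :: "('w, 'e, 'c) smap \<Rightarrow> ('w + 'c) set" where
  "sverts \<Gamma> = Inl ` whites \<Gamma> \<union> Inr ` cverts \<Gamma>"

definition sadj :: "('w, 'e, 'c) smap \<Rightarrow> (('w + 'c) \<times> ('w + 'c)) set" where
  "sadj \<Gamma> = {(u, v). \<exists>e\<in>sedges \<Gamma>. {u, v} = {Inl (wend \<Gamma> e), Inr (cend \<Gamma> e)}}"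

definition sconnected :: "('w, 'e, 'c) smap \<Rightarrow> bool" where
  "sconnected \<Gamma> \<longleftrightarrow> sverts \<Gamma> \<noteq> {} \<and> (\<forall>u\<in>sverts \<Gamma>. \<forall>v\<in>sverts \<Gamma>. (u, v) \<in> (sadj \<Gamma>)\<^sup>*)"

definition sinduced :: "('w, 'e, 'c) smap \<Rightarrow> ('w + 'c) set \<Rightarrow> ('w, 'e, 'c) smap" where
  "sinduced \<Gamma> X =
     (let E = {e \<in> sedges \<Gamma>. Inl (wend \<Gamma> e) \<in> X \<and> Inr (cend \<Gamma> e) \<in> X} in
      \<Gamma>\<lparr>whites := {w \<in> whites \<Gamma>. Inl w \<in> X}, cverts := {v \<in> cverts \<Gamma>. Inr v \<in> X},
        sedges := E, marked := marked \<Gamma> \<inter> E\<rparr>)"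

definition scomponents :: "('w, 'e, 'c) smap \<Rightarrow> ('w, 'e, 'c) smap set" where
  "scomponents \<Gamma> = sinduced \<Gamma> ` (sverts \<Gamma> // (sadj \<Gamma>)\<^sup>*)"

text \<open>
  Keeping only some colours removes a coloured vertex together with all its edges, so the cyclic
  orders at the remaining coloured vertices do not change.
\<close>

definition keep_colours :: "nat set \<Rightarrow> ('w, 'e, 'c) smap \<Rightarrow> ('w, 'e, 'c) smap" where
  "keep_colours K \<Gamma> = \<Gamma>\<lparr>cverts := {v \<in> cverts \<Gamma>. vcol \<Gamma> v \<in> K},
     sedges := {e \<in> sedges \<Gamma>. ecol \<Gamma> e \<in> K}, marked := {e \<in> marked \<Gamma>. ecol \<Gamma> e \<in> K}\<rparr>"

definition bubble_submaps :: "('w, 'e, 'c) smap \<Rightarrow> ('w, 'e, 'c) smap set" where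
  "bubble_submaps \<Gamma> = scomponents (keep_colours (- {0}) \<Gamma>)"

definition smap_iso ::
    "('w1 \<Rightarrow> 'w2) \<Rightarrow> ('e1 \<Rightarrow> 'e2) \<Rightarrow> ('c1 \<Rightarrow> 'c2) \<Rightarrow>
     ('w1, 'e1, 'c1) smap \<Rightarrow> ('w2, 'e2, 'c2) smap \<Rightarrow> bool" where
  "smap_iso f h g \<Gamma> \<Delta> \<longleftrightarrow>
     bij_betw f (whites \<Gamma>) (whites \<Delta>) \<and> bij_betw h (sedges \<Gamma>) (sedges \<Delta>) \<and>
     bij_betw g (cverts \<Gamma>) (cverts \<Delta>) \<and>
     (\<forall>v\<in>cverts \<Gamma>. vcol \<Delta> (g v) = vcol \<Gamma> v) \<and>
     (\<forall>e\<in>sedges \<Gamma>. ecol \<Delta> (h e) = ecol \<Gamma> e \<and> wend \<Delta> (h e) = f (wend \<Gamma> e) \<and>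
        cend \<Delta> (h e) = g (cend \<Gamma> e) \<and> nxt \<Delta> (h e) = h (nxt \<Gamma> e)) \<and>
     h ` marked \<Gamma> = marked \<Delta>"


subsection \<open>The map \<open>\<Psi>\<close>\<close>

text \<open>
  \<open>cycle_map I P \<sigma> M\<close> has the elements of \<open>P\<close> as white vertices and, for \<open>c \<in> I\<close>, the cycles of \<open>\<sigma> c\<close>
  as vertices of colour \<open>c\<close>; the edge of colour \<open>c\<close> at \<open>\<pi>\<close> is \<open>(c, \<pi>)\<close>.
\<close>

definition cycle_map :: "nat set \<Rightarrow> 'p set \<Rightarrow> (nat \<Rightarrow> 'p \<Rightarrow> 'p) \<Rightarrow> (nat \<times> 'p) set \<Rightarrow>
    ('p, nat \<times> 'p, nat \<times> 'p set) smap" where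
  "cycle_map I P \<sigma> M =
     \<lparr>whites = P,
      cverts = (\<lambda>(c, \<pi>). (c, orbit (\<sigma> c) \<pi>)) ` (I \<times> P),
      sedges = I \<times> P,
      vcol = fst,
      ecol = fst,
      wend = snd,
      cend = (\<lambda>(c, \<pi>). (c, orbit (\<sigma> c) \<pi>)),
      nxt = (\<lambda>(c, \<pi>). (c, \<sigma> c \<pi>)),
      marked = M\<rparr>"

text \<open>Colours \<open>1, 2, \<dots>\<close> are followed from black to white, colour \<open>0\<close> from white to black.\<close>

definition pair_perm :: "'v bgraph \<Rightarrow> ('v \<times> 'v) set \<Rightarrow> nat \<Rightarrow> 'v \<times> 'v \<Rightarrow> 'v \<times> 'v" where
  "pair_perm G P c \<pi> =
     (if c = 0 then (THE \<pi>'. \<pi>' \<in> P \<and> (0, fst \<pi>', snd \<pi>) \<in> gedges G)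
      else (THE \<pi>'. \<pi>' \<in> P \<and> (c, fst \<pi>, snd \<pi>') \<in> gedges G))"

definition Psi :: "nat \<Rightarrow> 'b bgraph \<Rightarrow> ('b \<times> 'b) set \<Rightarrow>
    ('b \<times> 'b, nat \<times> 'b \<times> 'b, nat \<times> ('b \<times> 'b) set) smap" where
  "Psi D B P = cycle_map {1..D} P (pair_perm B P) {}"


subsection \<open>Stacked maps whose submaps are identified with models\<close>

text \<open>
  An isomorphism of connected stacked maps is determined by its effect on white vertices. Hence the
  identification of the submaps with the models \<open>\<Psi>(B, \<Omega>\<^sub>B)\<close> is recorded by a function \<open>\<kappa>\<close> sending a
  white vertex to \<open>B\<close> and to the corresponding white vertex of \<open>\<Psi>(B, \<Omega>\<^sub>B)\<close>, which is a pair of \<open>\<Omega>\<^sub>B\<close>.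
\<close>

definition submap_copy ::
    "nat \<Rightarrow> ('b bgraph \<Rightarrow> ('b \<times> 'b) set) \<Rightarrow> ('w \<Rightarrow> 'b bgraph \<times> 'b \<times> 'b) \<Rightarrow>
     'b bgraph \<Rightarrow> ('w, 'e, 'c) smap \<Rightarrow> bool" where
  "submap_copy D \<Omega> \<kappa> B S \<longleftrightarrow>
     (\<forall>w\<in>whites S. fst (\<kappa> w) = B) \<and> (\<exists>h g. smap_iso (snd \<circ> \<kappa>) h g S (Psi D B (\<Omega> B)))"

definition SS ::
    "nat \<Rightarrow> nat \<Rightarrow> 'b bgraph set \<Rightarrow> ('b bgraph \<Rightarrow> ('b \<times> 'b) set) \<Rightarrow>
     (('w, 'e, 'c) smap \<times> ('w \<Rightarrow> 'b bgraph \<times> 'b \<times> 'b)) set" where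
  "SS D q \<BB> \<Omega> = {(\<Gamma>, \<kappa>).
     stacked_map {0..D} \<Gamma> \<and> sconnected \<Gamma> \<and> card (marked \<Gamma>) = q \<and>
     (\<forall>S\<in>bubble_submaps \<Gamma>. \<exists>B\<in>\<BB>. submap_copy D \<Omega> \<kappa> B S)}"

definition ident_smap_iso ::
    "('w1, 'e1, 'c1) smap \<times> ('w1 \<Rightarrow> 'b bgraph \<times> 'b \<times> 'b) \<Rightarrow>
     ('w2, 'e2, 'c2) smap \<times> ('w2 \<Rightarrow> 'b bgraph \<times> 'b \<times> 'b) \<Rightarrow> bool" where
  "ident_smap_iso = (\<lambda>(\<Gamma>, \<kappa>) (\<Gamma>', \<kappa>').
     \<exists>f h g. smap_iso f h g \<Gamma> \<Gamma>' \<and> (\<forall>w\<in>whites \<Gamma>. \<kappa>' (f w) = \<kappa> w))"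

definition SS_iso_rel ::
    "nat \<Rightarrow> nat \<Rightarrow> 'b bgraph set \<Rightarrow> ('b bgraph \<Rightarrow> ('b \<times> 'b) set) \<Rightarrow>
     ((('w, 'e, 'c) smap \<times> ('w \<Rightarrow> 'b bgraph \<times> 'b \<times> 'b)) \<times>
      (('w, 'e, 'c) smap \<times> ('w \<Rightarrow> 'b bgraph \<times> 'b \<times> 'b))) set" where
  "SS_iso_rel D q \<BB> \<Omega> = {(x, y). x \<in> SS D q \<BB> \<Omega> \<and> y \<in> SS D q \<BB> \<Omega> \<and> ident_smap_iso x y}"


subsection \<open>The map \<open>\<Psi>\<^sub>0\<close>\<close>

text \<open>
  \<open>alt_path G P b w\<close>: there is a path from the black vertex \<open>b\<close> to the white vertex \<open>w\<close> that
  alternates pairs of \<open>P\<close> and edges of colour 0, starting and ending with a pair.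
\<close>

inductive alt_path :: "'v bgraph \<Rightarrow> ('v \<times> 'v) set \<Rightarrow> 'v \<Rightarrow> 'v \<Rightarrow> bool" for G P where
  single: "(b, w) \<in> P \<Longrightarrow> alt_path G P b w"
| extend: "alt_path G P b w \<Longrightarrow> (0, b', w) \<in> gedges G \<Longrightarrow> (b', w') \<in> P \<Longrightarrow> alt_path G P b w'"

definition marked_edges :: "'v bgraph \<Rightarrow> ('v \<times> 'v) set \<Rightarrow> (nat \<times> 'v \<times> 'v) set" where
  "marked_edges G P = {(0, b, w) | b w.
     b \<in> blacks G \<and> w \<in> gwhites G \<and> \<not> has_edge G 0 b \<and> \<not> has_edge G 0 w \<and> alt_path G P b w}"

definition complete_graph :: "'v bgraph \<Rightarrow> ('v \<times> 'v) set \<Rightarrow> 'v bgraph" where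
  "complete_graph G P = G\<lparr>gedges := gedges G \<union> marked_edges G P\<rparr>"

text \<open>
  An edge of colour \<open>c\<close> through which \<open>\<sigma>\<^sub>c\<close> sends \<open>\<pi>\<close> to \<open>\<pi>'\<close> becomes the corner between the edges
  \<open>(c, \<pi>)\<close> and \<open>(c, \<pi>')\<close> of the stacked map, which is represented by \<open>(c, \<pi>)\<close>.
\<close>

definition edge_corner :: "('v \<times> 'v) set \<Rightarrow> nat \<times> 'v \<times> 'v \<Rightarrow> nat \<times> 'v \<times> 'v" where
  "edge_corner P = (\<lambda>(c, b, w). (c, THE \<pi>. \<pi> \<in> P \<and> (if c = 0 then snd \<pi> = w else fst \<pi> = b)))"

definition Psi0_map :: "nat \<Rightarrow> 'v bgraph \<Rightarrow> ('v \<times> 'v) set \<Rightarrow>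
    ('v \<times> 'v, nat \<times> 'v \<times> 'v, nat \<times> ('v \<times> 'v) set) smap" where
  "Psi0_map D G P =
     cycle_map {0..D} P (pair_perm (complete_graph G P) P) (edge_corner P ` marked_edges G P)"

definition Psi0 :: "nat \<Rightarrow> ('b bgraph \<Rightarrow> ('b \<times> 'b) set) \<Rightarrow>
    'v bgraph \<times> ('v \<Rightarrow> 'b bgraph \<times> 'b) \<Rightarrow>
    ('v \<times> 'v, nat \<times> 'v \<times> 'v, nat \<times> ('v \<times> 'v) set) smap \<times>
    ('v \<times> 'v \<Rightarrow> 'b bgraph \<times> 'b \<times> 'b)" where
  "Psi0 D \<Omega> = (\<lambda>(G, \<iota>). (Psi0_map D G (global_pairing \<Omega> G \<iota>),
     \<lambda>(b, w). (fst (\<iota> b), snd (\<iota> b), snd (\<iota> w))))"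

text \<open>
  \<open>\<Psi>\<^sub>0\<close> on isomorphism classes. An isomorphism class of stacked maps is a set of maps over freely
  chosen carrier types, which need not be those of the representative \<open>Psi0\<close>.
\<close>

definition Psi0_class :: "nat \<Rightarrow> ('b bgraph \<Rightarrow> ('b \<times> 'b) set) \<Rightarrow>
    ('v bgraph \<times> ('v \<Rightarrow> 'b bgraph \<times> 'b)) set \<Rightarrow>
    (('w, 'e, 'c) smap \<times> ('w \<Rightarrow> 'b bgraph \<times> 'b \<times> 'b)) set" where
  "Psi0_class D \<Omega> X = {y. \<exists>x\<in>X. ident_smap_iso (Psi0 D \<Omega> x) y}"

text \<open>
  The submap of \<open>\<Psi>\<^sub>0(G)\<close> corresponding to a bubble \<open>C\<close>: the pairs of vertices of \<open>C\<close> with their edges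
  of nonzero colours and the other ends of these edges.
\<close>

definition submap_of_bubble ::
    "nat \<Rightarrow> 'v bgraph \<Rightarrow> ('v \<times> 'v) set \<Rightarrow> 'v bgraph \<Rightarrow>
     ('v \<times> 'v, nat \<times> 'v \<times> 'v, nat \<times> ('v \<times> 'v) set) smap" where
  "submap_of_bubble D G P C =
     (let \<Gamma> = keep_colours (- {0}) (Psi0_map D G P);
          Q = {\<pi> \<in> P. fst \<pi> \<in> gverts C \<and> snd \<pi> \<in> gverts C}
      in sinduced \<Gamma> (Inl ` Q \<union> Inr ` cend \<Gamma> ` {e \<in> sedges \<Gamma>. wend \<Gamma> e \<in> Q}))"


subsection \<open>Bicoloured cycles and faces\<close>

text \<open>
  A cycle of colours 0 and \<open>i\<close>, given by its set of edges, visits the pairwise distinct vertices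
  \<open>b 0, w 0, b 1, w 1, \<dots>, b (n - 1), w (n - 1)\<close> in this cyclic order.
\<close>

definition bicoloured_cycles :: "'v bgraph \<Rightarrow> nat \<Rightarrow> (nat \<times> 'v \<times> 'v) set set" where
  "bicoloured_cycles G i = {Z. \<exists>n b w. n > 0 \<and> inj_on b {..<n} \<and> inj_on w {..<n} \<and>
     Z = (\<Union>k<n. {(i, b k, w k), (0, b (Suc k mod n), w k)}) \<and> Z \<subseteq> gedges G}"

definition bicoloured_submap :: "nat \<Rightarrow> ('w, 'e, 'c) smap \<Rightarrow> ('w, 'e, 'c) smap" where
  "bicoloured_submap i \<Gamma> = keep_colours {0, i} \<Gamma>"

text \<open>
  When all white vertices have valency two, the edges are the darts of an ordinary combinatorial map
  with vertex permutation \<open>nxt\<close> and involution \<open>other_edge\<close> exchanging the two edges at a white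
  vertex. Faces are the cycles of the product of the two. A face contains \<open>e\<close> if and only if it
  meets the corner between \<open>e\<close> and \<open>nxt e\<close>.
\<close>

definition other_edge :: "('w, 'e, 'c) smap \<Rightarrow> 'e \<Rightarrow> 'e" where
  "other_edge \<Gamma> e = (THE e'. e' \<in> sedges \<Gamma> \<and> wend \<Gamma> e' = wend \<Gamma> e \<and> e' \<noteq> e)"

definition faces :: "('w, 'e, 'c) smap \<Rightarrow> 'e set set" where
  "faces \<Gamma> = orbit (other_edge \<Gamma> \<circ> nxt \<Gamma>) ` sedges \<Gamma>"

end

theory Submission
  imports Defs
begin

text \<open>
  Both kinds of objects encode the same data: a finite set \<open>P\<close> of pairs, a permutation \<open>\<sigma> c\<close> of \<open>P\<close>
  for each colour, and a set \<open>M\<close> of marked corners, at most one on each cycle of \<open>\<sigma> 0\<close>. A stacked map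
  is determined up to isomorphism by the permutations that the cyclic orders induce on its white
  vertices. In a graph, \<open>\<sigma> c\<close> sends a pair along the edge of colour \<open>c\<close>; the edges of colour 0 give only
  a partial injection of \<open>P\<close>, and closing each of its chains by a marked step makes it a permutation.
  Conversely, from its start a chain runs through its cycle to the mark without meeting another mark,
  so the marked edges are recovered from the graph. In this encoding connectedness,
  components and isomorphisms on the two sides become the same conditions on \<open>(P, \<sigma>, M)\<close>, and a face
  of colours 0 and \<open>i\<close> is a cycle of \<open>\<sigma> 0 \<circ> \<sigma> i\<close>.
\<close>

subsection \<open>Permutations of finite sets\<close>

text \<open>Colour 0 is read against the other colours so that
  \<open>\<sigma> 0 \<circ> \<sigma> i\<close> follows edges only: from the black vertex of
  \<open>p\<close> along colour \<open>i\<close> to the white vertex of \<open>\<sigma> i p\<close>,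
  and from there along colour 0 to the black vertex of the next pair, without ever crossing a pair.
  The delicate point is connectedness. A step of a permutation leads from pair to pair, but an edge
  touches only one vertex of each pair, so classes of pairs are components of the graph only if the
  two vertices of a pair are joined inside the graph. For a graph in \<open>GG\<close> this holds
  because pairs lie inside bubbles. For a graph rebuilt from a stacked map it has to be extracted
  from the connectedness of the models, before the bubbles of that graph are known. A marked step
  has no edge at all; for connectedness it is replaced by the way around the rest of its cycle.
  Finally, \<open>Psi0\<close> changes the carrier types and \<open>pair_perm\<close> is controlled
  only on the pairs, so maps are compared up to isomorphism even where they look equal.\<close>

lemma orbit_subset_of_closed:
  assumes "\<And>y. y \<in> A \<Longrightarrow> f y \<in> A" "x \<in> A"
  shows "orbit f x \<subseteq> A"
proof
  fix y assume "y \<in> orbit f x"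
  then show "y \<in> A" by induction (use assms in auto)
qed

text \<open>Library orbits start at \<open>f x\<close>. Here \<open>f\<close> maps the finite set
  consisting of \<open>x\<close> and its orbit injectively into the orbit, hence onto the whole set,
  so \<open>x\<close> is hit as well.\<close>

lemma in_orbit_of_bij:
  assumes "finite A" "bij_betw f A A" "x \<in> A"
  shows "x \<in> orbit f x"
proof -
  let ?B = "insert x (orbit f x)"
  have sub: "?B \<subseteq> A"
    using orbit_subset_of_closed[of A f x] assms by (auto dest: bij_betwE)
  have "inj_on f A" using assms by (simp add: bij_betw_def)
  then have "inj_on f ?B" using sub by (rule inj_on_subset)
  moreover have "finite ?B" using sub assms(1) by (rule finite_subset)
  moreover have f: "f ` ?B \<subseteq> orbit f x" by (auto intro: orbit.intros)
  ultimately have "f ` ?B = ?B" by (intro endo_inj_surj) auto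
  then show ?thesis using f by blast
qed

lemma orbit_eq_of_bij:
  assumes "finite A" "bij_betw f A A" "x \<in> A" "y \<in> orbit f x"
  shows "orbit f y = orbit f x"
  using assms in_orbit_of_bij orbit_cyclic_eq3 cyclic_on_singleI by metis

subsection \<open>Isomorphisms of stacked maps\<close>

text \<open>The closure properties that transport along an isomorphism relies on. It mentions no
  colour set and passes to \<open>keep_colours\<close> and to components.\<close>

definition wf_smap :: "('w, 'e, 'c) smap \<Rightarrow> bool" where
  "wf_smap S \<longleftrightarrow> (\<forall>e\<in>sedges S. wend S e \<in> whites S \<and> cend S e \<in> cverts S \<and>
     nxt S e \<in> sedges S \<and> cend S (nxt S e) = cend S e \<and> ecol S e = vcol S (cend S e)) \<and>
     marked S \<subseteq> sedges S"

lemma wf_smapD: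
  assumes "wf_smap S" "e \<in> sedges S"
  shows "wend S e \<in> whites S" "cend S e \<in> cverts S" "nxt S e \<in> sedges S"
    "cend S (nxt S e) = cend S e" "ecol S e = vcol S (cend S e)"
  using assms by (auto simp: wf_smap_def)

lemma stacked_map_wf: "stacked_map I S \<Longrightarrow> wf_smap S"
  unfolding wf_smap_def
proof (intro conjI ballI)
  fix e assume st: "stacked_map I S" and e: "e \<in> sedges S"
  show "wend S e \<in> whites S" "cend S e \<in> cverts S" "ecol S e = vcol S (cend S e)"
    using st e by (auto simp: stacked_map_def)
  then have "cyclic_on (nxt S) {e' \<in> sedges S. cend S e' = cend S e}"
    using st by (auto simp: stacked_map_def)
  from cyclic_on_inI[OF this, of e] e
  show "nxt S e \<in> sedges S" "cend S (nxt S e) = cend S e" by auto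
qed (auto simp: stacked_map_def)

lemma smap_isoD:
  assumes "smap_iso f h g S T"
  shows "inj_on f (whites S)" "inj_on h (sedges S)" "inj_on g (cverts S)"
    "whites T = f ` whites S" "sedges T = h ` sedges S" "cverts T = g ` cverts S"
    "v \<in> cverts S \<Longrightarrow> vcol T (g v) = vcol S v"
    "e \<in> sedges S \<Longrightarrow> ecol T (h e) = ecol S e"
    "e \<in> sedges S \<Longrightarrow> wend T (h e) = f (wend S e)"
    "e \<in> sedges S \<Longrightarrow> cend T (h e) = g (cend S e)"
    "e \<in> sedges S \<Longrightarrow> nxt T (h e) = h (nxt S e)"
    "marked T = h ` marked S"
  using assms by (auto simp: smap_iso_def bij_betw_def)

lemma smap_isoI:
  assumes "inj_on f (whites S)" "inj_on h (sedges S)" "inj_on g (cverts S)"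
    "whites T = f ` whites S" "sedges T = h ` sedges S" "cverts T = g ` cverts S"
    "\<And>v. v \<in> cverts S \<Longrightarrow> vcol T (g v) = vcol S v"
    "\<And>e. e \<in> sedges S \<Longrightarrow> ecol T (h e) = ecol S e"
    "\<And>e. e \<in> sedges S \<Longrightarrow> wend T (h e) = f (wend S e)"
    "\<And>e. e \<in> sedges S \<Longrightarrow> cend T (h e) = g (cend S e)"
    "\<And>e. e \<in> sedges S \<Longrightarrow> nxt T (h e) = h (nxt S e)"
    "marked T = h ` marked S"
  shows "smap_iso f h g S T"
  using assms by (auto simp: smap_iso_def bij_betw_def)

lemma smap_iso_comp:
  assumes 1: "smap_iso f h g S T" and 2: "smap_iso f' h' g' T U"
  shows "smap_iso (f' \<circ> f) (h' \<circ> h) (g' \<circ> g) S U"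
proof (rule smap_isoI)
  show "inj_on (f' \<circ> f) (whites S)" "inj_on (h' \<circ> h) (sedges S)" "inj_on (g' \<circ> g) (cverts S)"
    using smap_isoD(1-6)[OF 1] smap_isoD(1-3)[OF 2] by (auto intro!: comp_inj_on)
qed (use smap_isoD(4-12)[OF 1] smap_isoD(4-12)[OF 2] in \<open>auto simp: image_image\<close>)

text \<open>\<open>wf_smap\<close> keeps the ends, the successors and the marks inside the carriers,
  and only there do the inverses cancel.\<close>

lemma smap_iso_inv:
  assumes iso: "smap_iso f h g S T" and wf: "wf_smap S"
  shows "smap_iso (inv_into (whites S) f) (inv_into (sedges S) h) (inv_into (cverts S) g) T S"
proof -
  note d = smap_isoD[OF iso]
  have "marked S \<subseteq> sedges S" using wf by (simp add: wf_smap_def)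
  then have "inv_into (sedges S) h ` marked T = marked S"
    unfolding d(12) using d(2) by (intro inv_into_image_cancel)
  moreover have "bij_betw (inv_into (whites S) f) (whites T) (whites S)"
    "bij_betw (inv_into (sedges S) h) (sedges T) (sedges S)"
    "bij_betw (inv_into (cverts S) g) (cverts T) (cverts S)"
    using d(1-6) by (auto intro!: bij_betw_inv_into inj_on_imp_bij_betw)
  moreover have "\<forall>e\<in>sedges T.
      ecol S (inv_into (sedges S) h e) = ecol T e \<and>
      wend S (inv_into (sedges S) h e) = inv_into (whites S) f (wend T e) \<and>
      cend S (inv_into (sedges S) h e) = inv_into (cverts S) g (cend T e) \<and>
      nxt S (inv_into (sedges S) h e) = inv_into (sedges S) h (nxt T e)"
    by (simp add: d(1-3) d(5) d(8-11) wf_smapD(1-3)[OF wf])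
  moreover have "\<forall>v\<in>cverts T. vcol S (inv_into (cverts S) g v) = vcol T v"
    using d(3) by (auto simp: d(6,7))
  ultimately show ?thesis by (simp only: smap_iso_def conj_assoc simp_thms)
qed

lemma smap_iso_cong:
  assumes "smap_iso f h g S T" "wf_smap S" "\<And>w. w \<in> whites S \<Longrightarrow> f' w = f w"
  shows "smap_iso f' h g S T"
  using assms unfolding smap_iso_def wf_smap_def by (auto cong: bij_betw_cong)

lemma stacked_map_iso:
  assumes iso: "smap_iso f h g S T" and st: "stacked_map I S"
  shows "stacked_map I T"
proof -
  note wf = stacked_map_wf[OF st]
  note inj = smap_isoD(1-3)[OF iso] and im = smap_isoD(4-6)[OF iso] and v = smap_isoD(7)[OF iso]
    and e = smap_isoD(8-11)[OF iso] and m = smap_isoD(12)[OF iso]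
  have ex1: "\<exists>!e'. e' \<in> sedges T \<and> ecol T e' = c \<and> wend T e' = f w"
    if w: "w \<in> whites S" and c: "c \<in> I" for w c
  proof -
    have "\<exists>!e. e \<in> sedges S \<and> ecol S e = c \<and> wend S e = w"
      using st w c by (simp add: stacked_map_def)
    then obtain e where e1: "e \<in> sedges S" "ecol S e = c" "wend S e = w"
      and u: "\<And>e'. e' \<in> sedges S \<Longrightarrow> ecol S e' = c \<Longrightarrow> wend S e' = w \<Longrightarrow> e' = e"
      by blast
    show ?thesis
    proof (rule ex1I[of _ "h e"])
      show "h e \<in> sedges T \<and> ecol T (h e) = c \<and> wend T (h e) = f w"
        using e1 e im by auto
      fix e' assume a: "e' \<in> sedges T \<and> ecol T e' = c \<and> wend T e' = f w"
      then obtain d where d: "d \<in> sedges S" "e' = h d" using im by auto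
      then have "wend S d = w"
        using a w e inj(1) wf_smapD(1)[OF wf] by (metis inj_onD)
      then show "e' = h e" using u[of d] d a e by auto
    qed
  qed
  have cyc: "cyclic_on (nxt T) {e \<in> sedges T. cend T e = g u}" if u: "u \<in> cverts S" for u
  proof -
    have "cend T (h e) = g u \<longleftrightarrow> cend S e = u" if "e \<in> sedges S" for e
      using e(3)[OF that] inj_on_eq_iff[OF inj(3) wf_smapD(2)[OF wf that] u] by simp
    then have "{e \<in> sedges T. cend T e = g u} = h ` {e \<in> sedges S. cend S e = u}"
      unfolding im by blast
    moreover have "cyclic_on (nxt S) {e \<in> sedges S. cend S e = u}"
      using st u by (auto simp: stacked_map_def)
    ultimately show ?thesis
      using cyclic_on_image[of "nxt S" "{e \<in> sedges S. cend S e = u}" "nxt T" h] e(4) by simp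
  qed
  have "inj_on (cend T) (marked T)"
  proof (rule inj_onI)
    fix x y assume "x \<in> marked T" "y \<in> marked T" and eq: "cend T x = cend T y"
    then obtain a b where ab: "a \<in> marked S" "b \<in> marked S" "x = h a" "y = h b"
      using m by auto
    then have s: "a \<in> sedges S" "b \<in> sedges S" using wf by (auto simp: wf_smap_def)
    then have "cend S a = cend S b"
      using eq ab e(3) inj_on_eq_iff[OF inj(3) wf_smapD(2)[OF wf s(1)] wf_smapD(2)[OF wf s(2)]]
      by simp
    then show "x = y" using st ab by (auto simp: stacked_map_def inj_on_def)
  qed
  moreover have "finite (whites T)" "finite (cverts T)" "finite (sedges T)"
    "\<forall>v\<in>cverts T. vcol T v \<in> I"
    using st v by (simp_all add: stacked_map_def im)
  moreover have "\<forall>e\<in>sedges T. ecol T e \<in> I \<and> wend T e \<in> whites T \<and>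
      cend T e \<in> cverts T \<and> vcol T (cend T e) = ecol T e"
    using st e v by (simp add: stacked_map_def im)
  moreover have "\<forall>w\<in>whites T. \<forall>c\<in>I. \<exists>!e. e \<in> sedges T \<and> ecol T e = c \<and> wend T e = w"
    by (simp add: im(1) ex1)
  moreover have "\<forall>v\<in>cverts T. cyclic_on (nxt T) {e \<in> sedges T. cend T e = v}"
    by (simp add: im(3) cyc)
  moreover have "marked S \<subseteq> {e \<in> sedges S. ecol S e = 0}"
    using st by (simp add: stacked_map_def)
  then have "marked T \<subseteq> {e \<in> sedges T. ecol T e = 0}"
    using e(1) by (auto simp: m im)
  ultimately show ?thesis unfolding stacked_map_def by blast
qed

section \<open>Connectedness and components of stacked maps under isomorphism\<close>

lemma sym_sadj: "(u, v) \<in> sadj S \<longleftrightarrow> (v, u) \<in> sadj S"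
  by (simp add: sadj_def insert_commute)

lemma sadj_edge:
  "e \<in> sedges S \<Longrightarrow> (Inl (wend S e), Inr (cend S e)) \<in> sadj S"
  "e \<in> sedges S \<Longrightarrow> (Inr (cend S e), Inl (wend S e)) \<in> sadj S"
  by (auto simp: sadj_def)

lemma sadj_cases:
  assumes "(u, v) \<in> sadj S"
  obtains e where "e \<in> sedges S" "u = Inl (wend S e)" "v = Inr (cend S e)"
  | e where "e \<in> sedges S" "u = Inr (cend S e)" "v = Inl (wend S e)"
  using assms by (auto simp: sadj_def doubleton_eq_iff)

lemma sadj_sverts: "wf_smap S \<Longrightarrow> (u, v) \<in> sadj S \<Longrightarrow> v \<in> sverts S"
  by (erule sadj_cases) (auto simp: sverts_def wf_smap_def)

lemma sadj_rtrancl_sverts: "(u, v) \<in> (sadj S)\<^sup>* \<Longrightarrow> wf_smap S \<Longrightarrow> u \<in> sverts S \<Longrightarrow> v \<in> sverts S"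
  by (induction rule: rtrancl_induct) (auto intro: sadj_sverts)

lemma inj_on_map_sum_sverts:
  assumes "smap_iso f h g S T"
  shows "inj_on (map_sum f g) (sverts S)"
  by (rule inj_onI)
    (auto simp: sverts_def inj_on_eq_iff[OF smap_isoD(1)[OF assms]] inj_on_eq_iff[OF smap_isoD(3)[OF assms]])

lemma map_sum_sverts:
  assumes "smap_iso f h g S T"
  shows "map_sum f g ` sverts S = sverts T"
proof -
  have "map_sum f g ` sverts S = Inl ` f ` whites S \<union> Inr ` g ` cverts S"
    by (auto simp: sverts_def image_Un image_image)
  then show ?thesis using smap_isoD(4,6)[OF assms] by (simp add: sverts_def)
qed

text \<open>One inclusion lifts a path of \<open>T\<close> to \<open>S\<close>: as
  \<open>map_sum f g\<close> is injective on \<open>sverts S\<close>, the end of the path lifted so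
  far is an end of the preimage of the next edge.\<close>

lemma sadj_iso_class:
  assumes iso: "smap_iso f h g S T" and wf: "wf_smap S" and u: "u \<in> sverts S"
  shows "(sadj T)\<^sup>* `` {map_sum f g u} = map_sum f g ` ((sadj S)\<^sup>* `` {u})"
proof -
  let ?m = "map_sum f g"
  note im = smap_isoD(5)[OF iso] and e = smap_isoD(9,10)[OF iso]
  have "(?m u, ?m v) \<in> (sadj T)\<^sup>*" if "(u, v) \<in> (sadj S)\<^sup>*" for v
    using that
  proof (induction rule: rtrancl_induct)
    case (step y z)
    from step(2) have "(?m y, ?m z) \<in> sadj T"
      by (cases rule: sadj_cases) (use e im sadj_edge[of "h _" T] in force)+
    then show ?case using step by auto
  qed simp
  moreover have "\<exists>v. z = ?m v \<and> (u, v) \<in> (sadj S)\<^sup>*" if "(?m u, z) \<in> (sadj T)\<^sup>*" for z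
    using that
  proof (induction rule: rtrancl_induct)
    case (step y z)
    then obtain v where v: "y = ?m v" "(u, v) \<in> (sadj S)\<^sup>*" by auto
    then have vs: "v \<in> sverts S" using sadj_rtrancl_sverts wf u by metis
    have inj: "?m v = ?m x \<Longrightarrow> x \<in> sverts S \<Longrightarrow> v = x" for x
      using inj_on_map_sum_sverts[OF iso] vs by (auto dest: inj_onD)
    from step(2) show ?case
    proof (cases rule: sadj_cases)
      case (1 e')
      then obtain d where d: "d \<in> sedges S" "e' = h d" using im by auto
      then have "v = Inl (wend S d)"
        using inj[of "Inl (wend S d)"] 1 e v wf_smapD[OF wf] by (auto simp: sverts_def)
      then have "(v, Inr (cend S d)) \<in> sadj S" using d sadj_edge by metis
      then show ?thesis using v d 1 e by (intro exI[of _ "Inr (cend S d)"]) auto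
    next
      case (2 e')
      then obtain d where d: "d \<in> sedges S" "e' = h d" using im by auto
      then have "v = Inr (cend S d)"
        using inj[of "Inr (cend S d)"] 2 e v wf_smapD[OF wf] by (auto simp: sverts_def)
      then have "(v, Inl (wend S d)) \<in> sadj S" using d sadj_edge by metis
      then show ?thesis using v d 2 e by (intro exI[of _ "Inl (wend S d)"]) auto
    qed
  qed auto
  ultimately show ?thesis by auto
qed

lemma sconnected_iso:
  assumes iso: "smap_iso f h g S T" and wf: "wf_smap S" and con: "sconnected S"
  shows "sconnected T"
proof -
  have "(map_sum f g u, map_sum f g v) \<in> (sadj T)\<^sup>*" if "u \<in> sverts S" "v \<in> sverts S" for u v
    using sadj_iso_class[OF iso wf that(1)] con that by (auto simp: sconnected_def)
  then show ?thesis
    using con map_sum_sverts[OF iso, symmetric] by (auto simp: sconnected_def)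
qed

text \<open>The component is carried by the same three maps, not merely by some isomorphism, so that
  labels of white vertices can still be compared on it.\<close>

lemma scomponents_iso:
  assumes iso: "smap_iso f h g S T" and wf: "wf_smap S" and C: "C \<in> scomponents S"
  obtains C' where "C' \<in> scomponents T" "smap_iso f h g C C'" "wf_smap C" "whites C \<subseteq> whites S"
proof -
  obtain u where u: "u \<in> sverts S" and C: "C = sinduced S ((sadj S)\<^sup>* `` {u})"
    using C by (auto simp: scomponents_def quotient_def)
  define X where "X = (sadj S)\<^sup>* `` {u}"
  define Y where "Y = map_sum f g ` X"
  have Xs: "X \<subseteq> sverts S" using sadj_rtrancl_sverts u wf by (auto simp: X_def)
  note b = smap_isoD(1-6)[OF iso] and e = smap_isoD(8-11)[OF iso] and m = smap_isoD(12)[OF iso]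
  have msub: "marked S \<subseteq> sedges S" using wf by (simp add: wf_smap_def)
  have XY: "map_sum f g x \<in> Y \<longleftrightarrow> x \<in> X" if "x \<in> sverts S" for x
    using inj_on_map_sum_sverts[OF iso] that Xs
    by (auto simp: Y_def inj_on_image_mem_iff)
  have W: "Inl (f w) \<in> Y \<longleftrightarrow> Inl w \<in> X" if "w \<in> whites S" for w
    using XY[of "Inl w"] that by (auto simp: sverts_def)
  have V: "Inr (g v) \<in> Y \<longleftrightarrow> Inr v \<in> X" if "v \<in> cverts S" for v
    using XY[of "Inr v"] that by (auto simp: sverts_def)
  let ?E = "{e \<in> sedges S. Inl (wend S e) \<in> X \<and> Inr (cend S e) \<in> X}"
  let ?F = "{e \<in> sedges T. Inl (wend T e) \<in> Y \<and> Inr (cend T e) \<in> Y}"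
  have EF: "?F = h ` ?E"
    using e W V wf_smapD[OF wf] by (auto simp: b)
  have "\<And>e. e \<in> sedges S \<Longrightarrow> h e \<in> ?F \<longleftrightarrow> e \<in> ?E"
    using e W V wf_smapD[OF wf] by (auto simp: b)
  then have MM: "h ` (marked S \<inter> ?E) = marked T \<inter> ?F"
    using msub unfolding m by auto
  have "smap_iso f h g (sinduced S X) (sinduced T Y)"
    unfolding smap_iso_def
  proof (intro conjI)
    show "bij_betw f (whites (sinduced S X)) (whites (sinduced T Y))"
      using inj_on_subset[OF b(1), of "{w \<in> whites S. Inl w \<in> X}"] W
      by (auto simp: sinduced_def Let_def bij_betw_def b)
    show "bij_betw g (cverts (sinduced S X)) (cverts (sinduced T Y))"
      using inj_on_subset[OF b(3), of "{v \<in> cverts S. Inr v \<in> X}"] V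
      by (auto simp: sinduced_def Let_def bij_betw_def b)
    show "bij_betw h (sedges (sinduced S X)) (sedges (sinduced T Y))"
      using inj_on_subset[OF b(2), of ?E] EF by (simp add: sinduced_def Let_def bij_betw_def)
    show "h ` marked (sinduced S X) = marked (sinduced T Y)"
      using MM by (simp add: sinduced_def Let_def)
  qed (use iso e in \<open>auto simp: sinduced_def Let_def smap_iso_def\<close>)
  moreover have "map_sum f g u \<in> sverts T"
    using map_sum_sverts[OF iso] u by blast
  then have "sinduced T Y \<in> scomponents T"
    unfolding scomponents_def Y_def X_def sadj_iso_class[OF iso wf u, symmetric]
    by (intro imageI quotientI)
  moreover have "wf_smap (sinduced S X)"
    unfolding wf_smap_def
  proof (intro conjI ballI)
    fix e assume "e \<in> sedges (sinduced S X)"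
    then have e: "e \<in> sedges S" "Inl (wend S e) \<in> X" "Inr (cend S e) \<in> X"
      by (auto simp: sinduced_def Let_def)
    note w = wf_smapD[OF wf e(1)]
    \<comment> \<open>The successor of an edge hangs at the same coloured vertex and therefore stays
      in the component.\<close>
    have "(Inr (cend S e), Inl (wend S (nxt S e))) \<in> sadj S"
      using sadj_edge(2)[OF w(3)] w(4) by simp
    then have "Inl (wend S (nxt S e)) \<in> X"
      using e(3) by (auto simp: X_def)
    then show "wend (sinduced S X) e \<in> whites (sinduced S X)"
      "cend (sinduced S X) e \<in> cverts (sinduced S X)"
      "nxt (sinduced S X) e \<in> sedges (sinduced S X)"
      "cend (sinduced S X) (nxt (sinduced S X) e) = cend (sinduced S X) e"
      "ecol (sinduced S X) e = vcol (sinduced S X) (cend (sinduced S X) e)"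
      using w e by (auto simp: sinduced_def Let_def)
  qed (auto simp: sinduced_def Let_def)
  moreover have "whites (sinduced S X) \<subseteq> whites S" by (auto simp: sinduced_def Let_def)
  ultimately show thesis using that C X_def by blast
qed

lemma keep_colours_iso:
  assumes iso: "smap_iso f h g S T" and wf: "wf_smap S"
  shows "smap_iso f h g (keep_colours K S) (keep_colours K T)"
proof -
  note b = smap_isoD(1-6)[OF iso] and v = smap_isoD(7)[OF iso] and e = smap_isoD(8)[OF iso]
    and m = smap_isoD(12)[OF iso]
  have msub: "marked S \<subseteq> sedges S" using wf by (simp add: wf_smap_def)
  have "h ` {e \<in> marked S. ecol S e \<in> K} = {e \<in> h ` marked S. ecol T e \<in> K}"
    using msub e by auto
  moreover have "bij_betw g {v \<in> cverts S. vcol S v \<in> K} {v \<in> cverts T. vcol T v \<in> K}"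
    using inj_on_subset[OF b(3), of "{v \<in> cverts S. vcol S v \<in> K}"] v
    by (auto simp: bij_betw_def b)
  moreover have "bij_betw h {v \<in> sedges S. ecol S v \<in> K} {v \<in> sedges T. ecol T v \<in> K}"
    using inj_on_subset[OF b(2), of "{v \<in> sedges S. ecol S v \<in> K}"] e
    by (auto simp: bij_betw_def b)
  ultimately show ?thesis
    using iso by (auto simp: smap_iso_def keep_colours_def m)
qed

lemma keep_colours_whites: "whites (keep_colours K S) = whites S"
  by (simp add: keep_colours_def)

lemma keep_colours_wf: "wf_smap S \<Longrightarrow> wf_smap (keep_colours K S)"
  by (auto simp: wf_smap_def keep_colours_def)

section \<open>Isomorphisms that respect the identification with models\<close>

lemma ident_smap_iso_sym:
  assumes "ident_smap_iso (S, \<kappa>) (T, \<kappa>')" "wf_smap S"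
  shows "ident_smap_iso (T, \<kappa>') (S, \<kappa>)"
proof -
  obtain f h g where iso: "smap_iso f h g S T" and k: "\<forall>w\<in>whites S. \<kappa>' (f w) = \<kappa> w"
    using assms by (auto simp: ident_smap_iso_def)
  have im: "whites T = f ` whites S" and inj: "inj_on f (whites S)"
    by (rule smap_isoD[OF iso])+
  have "\<forall>w\<in>whites T. \<kappa> (inv_into (whites S) f w) = \<kappa>' w"
    unfolding im using k inj by auto
  then show ?thesis
    using smap_iso_inv[OF iso assms(2)] unfolding ident_smap_iso_def by blast
qed

lemma ident_smap_iso_trans:
  assumes "ident_smap_iso x y" "ident_smap_iso y z"
  shows "ident_smap_iso x z"
proof -
  obtain S \<kappa> T \<kappa>' U \<mu> where xyz: "x = (S, \<kappa>)" "y = (T, \<kappa>')" "z = (U, \<mu>)"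
    by (metis surj_pair)
  obtain f h g where 1: "smap_iso f h g S T" "\<forall>w\<in>whites S. \<kappa>' (f w) = \<kappa> w"
    using assms xyz by (auto simp: ident_smap_iso_def)
  obtain f' h' g' where 2: "smap_iso f' h' g' T U" "\<forall>w\<in>whites T. \<mu> (f' w) = \<kappa>' w"
    using assms xyz by (auto simp: ident_smap_iso_def)
  have "\<forall>w\<in>whites S. \<mu> ((f' \<circ> f) w) = \<kappa> w"
    using 1(2) 2(2) smap_isoD(4)[OF 1(1)] by simp
  then show ?thesis
    using smap_iso_comp[OF 1(1) 2(1)] unfolding xyz ident_smap_iso_def by blast
qed

lemma ident_smap_iso_refl: "ident_smap_iso x x"
proof -
  have "smap_iso id id id (fst x) (fst x)" by (auto simp: smap_iso_def)
  then show ?thesis by (cases x) (force simp: ident_smap_iso_def)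
qed

lemma SS_wf: "(S, \<kappa>) \<in> SS D q \<BB> \<Omega> \<Longrightarrow> wf_smap S"
  by (auto simp: SS_def intro: stacked_map_wf)

text \<open>A submap of \<open>T\<close> is carried to a submap of \<open>S\<close> by the inverse
  isomorphism and then composed with the isomorphism onto a model that is given for
  \<open>S\<close>.\<close>

lemma SS_iso:
  assumes x: "(S, \<kappa>) \<in> SS D q \<BB> \<Omega>" and xy: "ident_smap_iso (S, \<kappa>) (T, \<kappa>')"
  shows "(T, \<kappa>') \<in> SS D q \<BB> \<Omega>"
proof -
  have st: "stacked_map {0..D} S" "sconnected S" "card (marked S) = q"
    and sub: "\<forall>C\<in>bubble_submaps S. \<exists>B\<in>\<BB>. submap_copy D \<Omega> \<kappa> B C"
    using x by (auto simp: SS_def)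
  note wf = stacked_map_wf[OF st(1)]
  obtain f h g where iso: "smap_iso f h g S T"
    using xy by (auto simp: ident_smap_iso_def)
  have std: "stacked_map {0..D} T" "sconnected T"
    using stacked_map_iso[OF iso st(1)] sconnected_iso[OF iso wf st(2)] by auto
  note wfd = stacked_map_wf[OF std(1)]
  have "inj_on h (marked S)"
    using smap_isoD(2)[OF iso] by (rule inj_on_subset) (use wf in \<open>simp add: wf_smap_def\<close>)
  moreover have "marked T = h ` marked S" by (rule smap_isoD[OF iso])
  ultimately have q: "card (marked T) = q" using st(3) by (simp add: card_image)
  obtain f' h' g' where iso': "smap_iso f' h' g' T S" and k: "\<forall>w\<in>whites T. \<kappa> (f' w) = \<kappa>' w"
    using ident_smap_iso_sym[OF xy wf] by (auto simp: ident_smap_iso_def)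
  have "\<exists>B\<in>\<BB>. submap_copy D \<Omega> \<kappa>' B C" if C: "C \<in> bubble_submaps T" for C
  proof -
    obtain C' where C': "C' \<in> bubble_submaps S" "smap_iso f' h' g' C C'" and wfS: "wf_smap C"
      and wS: "whites C \<subseteq> whites T"
      using scomponents_iso[OF keep_colours_iso[OF iso' wfd] keep_colours_wf[OF wfd]] C
      unfolding bubble_submaps_def by (metis keep_colours_whites)
    obtain B h'' g'' where B: "B \<in> \<BB>" "\<forall>w\<in>whites C'. fst (\<kappa> w) = B"
        "smap_iso (snd \<circ> \<kappa>) h'' g'' C' (Psi D B (\<Omega> B))"
      using sub C'(1) by (auto simp: submap_copy_def)
    \<comment> \<open>The label functions \<open>\<kappa>'\<close> and
      \<open>\<kappa> \<circ> f'\<close> agree only on white vertices, so the composed isomorphism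
      is adjusted by \<open>smap_iso_cong\<close>.\<close>
    have "smap_iso (snd \<circ> \<kappa>') (h'' \<circ> h') (g'' \<circ> g') C (Psi D B (\<Omega> B))"
      by (rule smap_iso_cong[OF smap_iso_comp[OF C'(2) B(3)] wfS]) (use k wS in auto)
    moreover have "fst (\<kappa>' w) = B" if "w \<in> whites C" for w
    proof -
      have "f' w \<in> whites C'" using smap_isoD(4)[OF C'(2)] that by simp
      then show ?thesis using B(2) k that wS by (metis subsetD)
    qed
    ultimately show ?thesis using B(1) unfolding submap_copy_def by blast
  qed
  then show ?thesis using std q by (simp add: SS_def)
qed

subsection \<open>Stacked maps given by permutations\<close>

lemma cverts_cycle_mapE:
  assumes "v \<in> cverts (cycle_map I P \<sigma> M)"
  obtains c p where "c \<in> I" "p \<in> P" "v = (c, orbit (\<sigma> c) p)"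
proof -
  have "v \<in> (\<lambda>(c, p). (c, orbit (\<sigma> c) p)) ` (I \<times> P)"
    using assms by (simp add: cycle_map_def)
  then show thesis using that by (elim imageE SigmaE) simp
qed

text \<open>Marks are stored as corners \<open>(0, p)\<close>, that is, as edges of
  \<open>cycle_map\<close>, so \<open>M\<close> is literally its field \<open>marked\<close>. The
  axiom \<open>marks_unique\<close> expresses at most one mark per coloured vertex through
  orbits.\<close>

locale perm_system =
  fixes I :: "nat set" and P :: "'p set" and \<sigma> :: "nat \<Rightarrow> 'p \<Rightarrow> 'p" and M :: "(nat \<times> 'p) set"
  assumes finite_colours: "finite I" and finite_P: "finite P"
    and bij: "c \<in> I \<Longrightarrow> bij_betw (\<sigma> c) P P"
    and marks_sub: "M \<subseteq> I \<times> P"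
    and marks_colour: "(c, p) \<in> M \<Longrightarrow> c = 0"
    and marks_unique: "(0, p) \<in> M \<Longrightarrow> (0, p') \<in> M \<Longrightarrow> p' \<in> orbit (\<sigma> 0) p \<Longrightarrow> p' = p"
begin

abbreviation "cmap \<equiv> cycle_map I P \<sigma> M"

lemma closed: "c \<in> I \<Longrightarrow> p \<in> P \<Longrightarrow> \<sigma> c p \<in> P"
  using bij by (auto dest: bij_betwE)

lemma sigma_eq_iff: "c \<in> I \<Longrightarrow> p \<in> P \<Longrightarrow> p' \<in> P \<Longrightarrow> \<sigma> c p = \<sigma> c p' \<longleftrightarrow> p = p'"
  using bij by (metis bij_betw_imp_inj_on inj_on_eq_iff)

lemma sigma_surj:
  assumes "c \<in> I" "p \<in> P"
  obtains p' where "p' \<in> P" "\<sigma> c p' = p"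
  using bij[OF assms(1)] assms(2) by (metis bij_betw_imp_surj_on imageE)

lemma orbit_sub: "c \<in> I \<Longrightarrow> p \<in> P \<Longrightarrow> orbit (\<sigma> c) p \<subseteq> P"
  by (rule orbit_subset_of_closed) (auto intro: closed)

lemma self_in_orbit: "c \<in> I \<Longrightarrow> p \<in> P \<Longrightarrow> p \<in> orbit (\<sigma> c) p"
  using in_orbit_of_bij finite_P bij by metis

lemma orbit_eq: "c \<in> I \<Longrightarrow> p \<in> P \<Longrightarrow> p' \<in> orbit (\<sigma> c) p \<Longrightarrow> orbit (\<sigma> c) p' = orbit (\<sigma> c) p"
  using orbit_eq_of_bij finite_P bij by metis

lemma orbit_eq_iff:
  "c \<in> I \<Longrightarrow> p \<in> P \<Longrightarrow> p' \<in> P \<Longrightarrow> orbit (\<sigma> c) p' = orbit (\<sigma> c) p \<longleftrightarrow> p' \<in> orbit (\<sigma> c) p"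
  using orbit_eq self_in_orbit by metis

lemma orbit_step_eq: "c \<in> I \<Longrightarrow> p \<in> P \<Longrightarrow> orbit (\<sigma> c) (\<sigma> c p) = orbit (\<sigma> c) p"
  using orbit_eq orbit.base by metis

lemma stacked_cycle_map: "stacked_map I cmap"
proof -
  let ?C = "cmap"
  have "cyclic_on (nxt ?C) {e \<in> sedges ?C. cend ?C e = v}" if vC: "v \<in> cverts ?C" for v
  proof -
    obtain c p where c: "c \<in> I" "p \<in> P" and v: "v = (c, orbit (\<sigma> c) p)"
      using cverts_cycle_mapE[OF vC] by blast
    have "{e \<in> sedges ?C. cend ?C e = v} = Pair c ` orbit (\<sigma> c) p"
      using c orbit_sub[OF c] orbit_eq_iff[OF c] by (auto simp: cycle_map_def v)
    moreover have "cyclic_on (nxt ?C) (Pair c ` orbit (\<sigma> c) p)"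
      by (rule cyclic_on_image[of "\<sigma> c"])
        (auto simp: cycle_map_def intro: cyclic_on_singleI self_in_orbit[OF c])
    ultimately show ?thesis by simp
  qed
  moreover have "inj_on (cend ?C) (marked ?C)"
  proof (rule inj_onI)
    fix x y assume xy: "x \<in> marked ?C" "y \<in> marked ?C" "cend ?C x = cend ?C y"
    obtain c p d p' where eq: "x = (c, p)" "y = (d, p')" by (cases x, cases y)
    have M: "(c, p) \<in> M" "(d, p') \<in> M" using xy by (auto simp: cycle_map_def eq)
    then have z: "c = 0" "d = 0" using marks_colour by auto
    have p: "0 \<in> I" "p \<in> P" "p' \<in> P" using M marks_sub by (auto simp: z)
    have "orbit (\<sigma> 0) p = orbit (\<sigma> 0) p'" using xy(3) by (simp add: cycle_map_def eq z)
    then have "p' \<in> orbit (\<sigma> 0) p" using self_in_orbit p by blast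
    then have "p' = p" using M unfolding z by (intro marks_unique)
    then show "x = y" by (simp add: eq z)
  qed
  moreover have "\<exists>!e. e \<in> sedges ?C \<and> ecol ?C e = c \<and> wend ?C e = w"
    if "w \<in> whites ?C" "c \<in> I" for w c
    by (rule ex1I[of _ "(c, w)"]) (use that in \<open>auto simp: cycle_map_def\<close>)
  moreover have "marked ?C \<subseteq> {e \<in> sedges ?C. ecol ?C e = 0}"
    using marks_sub marks_colour by (auto simp: cycle_map_def)
  moreover have "\<forall>e\<in>sedges ?C. ecol ?C e \<in> I \<and> wend ?C e \<in> whites ?C \<and>
        cend ?C e \<in> cverts ?C \<and> vcol ?C (cend ?C e) = ecol ?C e"
    by (auto simp: cycle_map_def)
  moreover have "finite (whites ?C)" "finite (cverts ?C)" "finite (sedges ?C)"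
    "\<forall>v\<in>cverts ?C. vcol ?C v \<in> I"
    using finite_P finite_colours by (auto simp: cycle_map_def)
  ultimately show ?thesis unfolding stacked_map_def by blast
qed

lemma restrict_colours:
  assumes "J \<subseteq> I"
  shows "perm_system J P \<sigma> {}"
  using assms finite_colours finite_P bij by unfold_locales (auto intro: finite_subset)

lemma restrict_closed:
  assumes "Q \<subseteq> P" "\<And>c p. c \<in> I \<Longrightarrow> p \<in> Q \<Longrightarrow> \<sigma> c p \<in> Q"
  shows "perm_system I Q \<sigma> {}"
proof
  show fin: "finite Q" using assms(1) finite_P by (rule finite_subset)
  fix c assume c: "c \<in> I"
  have "inj_on (\<sigma> c) Q" using bij[OF c] assms(1) by (meson bij_betw_imp_inj_on inj_on_subset)
  moreover have "\<sigma> c ` Q \<subseteq> Q" using assms(2) c by blast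
  ultimately show "bij_betw (\<sigma> c) Q Q" using fin by (simp add: bij_betw_def endo_inj_surj)
qed (auto simp: finite_colours)

text \<open>Needed because \<open>pair_perm\<close> is defined by \<open>THE\<close>: its values are
  known only for colours in \<open>I\<close> and pairs in \<open>P\<close>.\<close>

lemma cong_sigma:
  assumes "\<And>c p. c \<in> I \<Longrightarrow> p \<in> P \<Longrightarrow> \<tau> c p = \<sigma> c p"
  shows "perm_system I P \<tau> M"
proof
  fix c assume c: "c \<in> I"
  show "bij_betw (\<tau> c) P P"
    using bij[OF c] by (rule bij_betw_cong[THEN iffD1, rotated]) (simp add: assms c)
next
  fix p p' assume m: "(0, p) \<in> M" "(0, p') \<in> M" "p' \<in> orbit (\<tau> 0) p"
  then have "0 \<in> I" "p \<in> P" using marks_sub by auto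
  then have "orbit (\<tau> 0) p = orbit (\<sigma> 0) p"
    using closed by (intro orbit_cong0[of _ P]) (auto simp: assms)
  then show "p' = p" using m by (intro marks_unique) simp_all
qed (use finite_colours finite_P marks_sub marks_colour in auto)

lemma orbit_conj:
  assumes f: "\<And>p. p \<in> P \<Longrightarrow> f (\<sigma> c p) = \<tau> (f p)" and c: "c \<in> I" "p \<in> P"
  shows "f ` orbit (\<sigma> c) p = orbit \<tau> (f p)"
  by (rule orbit_inverse[OF self_in_orbit[OF c]]) (use orbit_sub[OF c] f in auto)

text \<open>A coloured vertex is a set of elements of \<open>P\<close>, so the vertex map takes
  images of sets; it is injective because orbits stay inside \<open>P\<close>, where
  \<open>f\<close> is injective.\<close>

lemma smap_iso_cycle_mapI:
  assumes f: "bij_betw f P P'"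
    and comm: "\<And>c p. c \<in> I \<Longrightarrow> p \<in> P \<Longrightarrow> f (\<sigma> c p) = \<tau> c (f p)"
    and M: "M' = apsnd f ` M"
  shows "smap_iso f (apsnd f) (apsnd (image f)) cmap (cycle_map I P' \<tau> M')"
proof -
  have inj: "inj_on f P" and im: "P' = f ` P" using f by (auto simp: bij_betw_def)
  have orb: "f ` orbit (\<sigma> c) p = orbit (\<tau> c) (f p)" if "c \<in> I" "p \<in> P" for c p
    using orbit_conj[of f c "\<tau> c"] comm that by blast
  have IP: "I \<times> P' = apsnd f ` (I \<times> P)" by (force simp: im)
  show ?thesis
  proof (rule smap_isoI)
    show "inj_on f (whites cmap)" using inj by (simp add: cycle_map_def)
    show "inj_on (apsnd f) (sedges cmap)"
      by (rule inj_onI) (auto simp: cycle_map_def inj_on_eq_iff[OF inj])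
    show "inj_on (apsnd (image f)) (cverts cmap)"
    proof (rule inj_onI)
      fix u v assume "u \<in> cverts cmap" "v \<in> cverts cmap"
        and eq: "apsnd (image f) u = apsnd (image f) v"
      then obtain c p d p' where u: "c \<in> I" "p \<in> P" "u = (c, orbit (\<sigma> c) p)"
        and v: "d \<in> I" "p' \<in> P" "v = (d, orbit (\<sigma> d) p')"
        by (metis cverts_cycle_mapE)
      have cd: "c = d" and im_eq: "f ` orbit (\<sigma> c) p = f ` orbit (\<sigma> d) p'"
        using eq unfolding u v by auto
      have "orbit (\<sigma> c) p = orbit (\<sigma> d) p'"
        using im_eq inj_on_image_eq_iff[OF inj orbit_sub[OF u(1,2)] orbit_sub[OF v(1,2)]] by blast
      then show "u = v" unfolding u v using cd by blast
    qed
    show "cverts (cycle_map I P' \<tau> M') = apsnd (image f) ` cverts cmap"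
    proof -
      have "(\<lambda>(c, p). (c, orbit (\<tau> c) p)) ` (I \<times> P') =
          apsnd (image f) ` (\<lambda>(c, p). (c, orbit (\<sigma> c) p)) ` (I \<times> P)"
        unfolding IP image_image by (rule image_cong) (auto simp: orb)
      then show ?thesis by (simp add: cycle_map_def)
    qed
    show "sedges (cycle_map I P' \<tau> M') = apsnd f ` sedges cmap"
      by (simp add: cycle_map_def IP)
  qed (auto simp: cycle_map_def im M orb comm)
qed

text \<open>An edge of \<open>cycle_map\<close> is its colour together with its white end, so
  \<open>f\<close> forces \<open>h\<close>. Compatibility with \<open>nxt\<close> is then
  commutation with the permutations.\<close>

lemma smap_iso_cycle_mapD:
  assumes iso: "smap_iso f h g cmap (cycle_map I P' \<tau> M')"
  shows "bij_betw f P P'" "\<And>c p. c \<in> I \<Longrightarrow> p \<in> P \<Longrightarrow> f (\<sigma> c p) = \<tau> c (f p)" "M' = apsnd f ` M"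
proof -
  show "bij_betw f P P'"
    using smap_isoD(1,4)[OF iso] by (simp add: bij_betw_def cycle_map_def)
  have h: "h (c, p) = (c, f p)" if "c \<in> I" "p \<in> P" for c p
  proof -
    have e: "(c, p) \<in> sedges cmap" using that by (simp add: cycle_map_def)
    show ?thesis
      using smap_isoD(8,9)[OF iso e] by (simp add: cycle_map_def prod_eq_iff)
  qed
  show "f (\<sigma> c p) = \<tau> c (f p)" if c: "c \<in> I" "p \<in> P" for c p
  proof -
    have "nxt (cycle_map I P' \<tau> M') (h (c, p)) = h (nxt cmap (c, p))"
      using c by (intro smap_isoD(11)[OF iso]) (simp add: cycle_map_def)
    then show ?thesis using c closed[OF c] by (simp add: cycle_map_def h)
  qed
  have "M' = h ` M" using smap_isoD(12)[OF iso] by (simp add: cycle_map_def)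
  also have "\<dots> = apsnd f ` M" using marks_sub h by (intro image_cong) auto
  finally show "M' = apsnd f ` M" .
qed

end

lemma keep_colours_cycle_map:
  "keep_colours K (cycle_map I P \<sigma> M) = cycle_map (I \<inter> K) P \<sigma> {e \<in> M. fst e \<in> K}"
  by (auto simp: keep_colours_def cycle_map_def)

section \<open>Classes of pairs as components of stacked maps\<close>

text \<open>The classes of its closure in \<open>P\<close> are the orbits of the group generated by
  the permutations with colours in \<open>I\<close>. Both notions of connectedness are translated
  into this relation.\<close>

definition steps :: "nat set \<Rightarrow> 'p set \<Rightarrow> (nat \<Rightarrow> 'p \<Rightarrow> 'p) \<Rightarrow> ('p \<times> 'p) set" where
  "steps I P \<sigma> = {(p, p'). \<exists>c\<in>I. p \<in> P \<and> p' = \<sigma> c p \<or> p' \<in> P \<and> p = \<sigma> c p'}"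

lemma sym_steps: "sym (steps I P \<sigma>)"
  by (auto simp: steps_def sym_def)

lemma sym_rtrancl_steps: "(p, p') \<in> (steps I P \<sigma>)\<^sup>* \<Longrightarrow> (p', p) \<in> (steps I P \<sigma>)\<^sup>*"
  using sym_steps sym_rtrancl by (metis symD)

abbreviation step_classes :: "nat set \<Rightarrow> 'p set \<Rightarrow> (nat \<Rightarrow> 'p \<Rightarrow> 'p) \<Rightarrow> 'p set set" where
  "step_classes I P \<sigma> \<equiv> P // (steps I P \<sigma>)\<^sup>*"

text \<open>For a class \<open>Q\<close> this is the vertex set of one component of
  \<open>cycle_map\<close>, as \<open>sadj_class\<close> shows.\<close>

definition class_verts ::
    "nat set \<Rightarrow> (nat \<Rightarrow> 'p \<Rightarrow> 'p) \<Rightarrow> 'p set \<Rightarrow> ('p + nat \<times> 'p set) set" where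
  "class_verts I \<sigma> Q = Inl ` Q \<union> Inr ` (\<lambda>(c, p). (c, orbit (\<sigma> c) p)) ` (I \<times> Q)"

lemma class_verts_Inl: "Inl p \<in> class_verts I \<sigma> Q \<longleftrightarrow> p \<in> Q"
  by (auto simp: class_verts_def)

lemma class_verts_Inr: "c \<in> I \<Longrightarrow> p \<in> Q \<Longrightarrow> Inr (c, orbit (\<sigma> c) p) \<in> class_verts I \<sigma> Q"
  by (force simp: class_verts_def)

context perm_system
begin

abbreviation "reach \<equiv> (steps I P \<sigma>)\<^sup>*"

abbreviation "classes \<equiv> step_classes I P \<sigma>"

lemma steps_in: "(p, p') \<in> steps I P \<sigma> \<Longrightarrow> p \<in> P \<and> p' \<in> P"
  by (auto simp: steps_def intro: closed)

lemma rtrancl_steps_in: "(p, p') \<in> reach \<Longrightarrow> p \<in> P \<Longrightarrow> p' \<in> P"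
  by (induction rule: rtrancl_induct) (auto dest: steps_in)

lemma step_class_sub: "Q \<in> classes \<Longrightarrow> Q \<subseteq> P"
  by (auto simp: quotient_def intro: rtrancl_steps_in)

lemma step_class_nonempty: "Q \<in> classes \<Longrightarrow> Q \<noteq> {}"
  by (auto simp: quotient_def)

lemma step_class_closed:
  assumes "Q \<in> classes" "c \<in> I" "p \<in> Q"
  shows "\<sigma> c p \<in> Q"
proof -
  have "(p, \<sigma> c p) \<in> steps I P \<sigma>" using assms step_class_sub by (auto simp: steps_def)
  then show ?thesis using assms by (auto simp: quotient_def)
qed

lemma step_class_orbit:
  assumes "Q \<in> classes" "c \<in> I" "p \<in> Q"
  shows "orbit (\<sigma> c) p \<subseteq> Q"
  by (rule orbit_subset_of_closed) (use step_class_closed assms in auto)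

lemma perm_system_class: "Q \<in> classes \<Longrightarrow> perm_system I Q \<sigma> {}"
  by (rule restrict_closed) (auto dest: step_class_sub step_class_closed)

lemma step_class_eqI:
  assumes "Q \<in> classes" "p \<in> Q"
  shows "Q = reach `` {p}"
proof -
  obtain p0 where Q: "Q = reach `` {p0}" using assms(1) by (auto simp: quotient_def)
  then have "(p0, p) \<in> reach" using assms(2) by simp
  then have "(p0, p') \<in> reach \<longleftrightarrow> (p, p') \<in> reach" for p'
    using sym_rtrancl_steps rtrancl_trans by metis
  then show ?thesis unfolding Q by blast
qed

lemma step_class_of: "p \<in> P \<Longrightarrow> reach `` {p} \<in> classes"
  by (rule quotientI)

text \<open>A step of colour \<open>c\<close> is a path of length two through the coloured vertex of
  the common cycle. Conversely, the white neighbours of a coloured vertex lie on one cycle and hence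
  in one class.\<close>

lemma sadj_class:
  assumes Q: "Q \<in> classes" and u: "u \<in> class_verts I \<sigma> Q"
  shows "(sadj cmap)\<^sup>* `` {u} = class_verts I \<sigma> Q"
proof -
  let ?C = "cmap" and ?V = "class_verts I \<sigma> Q"
  note QP = subsetD[OF step_class_sub[OF Q]]
  have adj: "(Inl p, Inr (c, orbit (\<sigma> c) p)) \<in> sadj ?C" if "c \<in> I" "p \<in> P" for c p
    using sadj_edge(1)[of "(c, p)" ?C] that by (simp add: cycle_map_def)
  have reach: "(Inl p, Inl p') \<in> (sadj ?C)\<^sup>*" if "(p, p') \<in> reach" for p p'
    using that
  proof (induction rule: rtrancl_induct)
    case (step y z)
    then have yz: "y \<in> P" "z \<in> P" using steps_in by blast+
    obtain c where c: "c \<in> I" "orbit (\<sigma> c) y = orbit (\<sigma> c) z"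
      using step(2) orbit_step_eq by (auto simp: steps_def)
    have "(Inl y, Inr (c, orbit (\<sigma> c) y)) \<in> sadj ?C" "(Inr (c, orbit (\<sigma> c) y), Inl z) \<in> sadj ?C"
      using adj[OF c(1) yz(1)] adj[OF c(1) yz(2)] sym_sadj by (auto simp: c)
    then show ?case using step(3) by (meson rtrancl.rtrancl_into_rtrancl)
  qed simp
  have reachQ: "(Inl p, Inl p') \<in> (sadj ?C)\<^sup>*" if "p \<in> Q" "p' \<in> Q" for p p'
    using step_class_eqI[OF Q that(1)] that(2) reach by blast
  have white: "\<exists>p\<in>Q. (v, Inl p) \<in> (sadj ?C)\<^sup>* \<and> (Inl p, v) \<in> (sadj ?C)\<^sup>*"
    if v: "v \<in> ?V" for v
  proof (cases v)
    case (Inl p)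
    then show ?thesis using v by (auto simp: class_verts_def)
  next
    case (Inr x)
    then obtain c p where "c \<in> I" "p \<in> Q" and vv: "v = Inr (c, orbit (\<sigma> c) p)"
      using v by (auto simp: class_verts_def)
    then have "(Inl p, v) \<in> sadj ?C" using adj QP by blast
    then show ?thesis using sym_sadj \<open>p \<in> Q\<close> by blast
  qed
  have clos: "w \<in> ?V" if vw: "(v, w) \<in> sadj ?C" and vQ: "v \<in> ?V" for v w
    using vw
  proof (cases rule: sadj_cases)
    case (1 e)
    obtain c p where e: "e = (c, p)" by (cases e)
    then have "c \<in> I" "p \<in> Q" "w = Inr (c, orbit (\<sigma> c) p)"
      using 1 vQ by (simp_all add: cycle_map_def class_verts_Inl)
    then show ?thesis by (simp add: class_verts_Inr)
  next
    case (2 e)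
    obtain c p where e: "e = (c, p)" "c \<in> I" "p \<in> P" using 2(1) by (auto simp: cycle_map_def)
    then obtain p' where p: "p' \<in> Q" "orbit (\<sigma> c) p = orbit (\<sigma> c) p'"
      using vQ 2(2) by (auto simp: class_verts_def cycle_map_def)
    then have "p \<in> Q" using self_in_orbit[OF e(2,3)] step_class_orbit[OF Q e(2) p(1)] by auto
    then show ?thesis using 2(3) e by (simp add: class_verts_Inl cycle_map_def)
  qed
  have "w \<in> ?V" if "(u, w) \<in> (sadj ?C)\<^sup>*" for w
    using that by (induction rule: rtrancl_induct) (use u clos in auto)
  moreover have "(u, w) \<in> (sadj ?C)\<^sup>*" if "w \<in> ?V" for w
    using white[OF u] white[OF that] reachQ by (meson rtrancl_trans)
  ultimately show ?thesis by blast
qed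

lemma sverts_cycle_map: "sverts cmap = class_verts I \<sigma> P"
  by (simp add: sverts_def class_verts_def cycle_map_def)

lemma class_verts_cover:
  assumes "u \<in> class_verts I \<sigma> P"
  obtains Q where "Q \<in> classes" "u \<in> class_verts I \<sigma> Q"
proof -
  obtain p where p: "p \<in> P" "u = Inl p \<or> (\<exists>c\<in>I. u = Inr (c, orbit (\<sigma> c) p))"
    using assms by (auto simp: class_verts_def)
  then have "u \<in> class_verts I \<sigma> (reach `` {p})"
    by (auto simp: class_verts_Inl intro: class_verts_Inr)
  then show thesis using that step_class_of[OF p(1)] by blast
qed

lemma sadj_classes:
  "sverts cmap // (sadj cmap)\<^sup>* = class_verts I \<sigma> ` classes"
proof (intro equalityI subsetI)
  fix X assume "X \<in> sverts cmap // (sadj cmap)\<^sup>*"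
  then obtain u where u: "u \<in> class_verts I \<sigma> P" "X = (sadj cmap)\<^sup>* `` {u}"
    by (auto simp: quotient_def sverts_cycle_map)
  then show "X \<in> class_verts I \<sigma> ` classes"
    using class_verts_cover sadj_class by (metis imageI)
next
  fix X assume "X \<in> class_verts I \<sigma> ` classes"
  then obtain Q where Q: "Q \<in> classes" "X = class_verts I \<sigma> Q" by blast
  then obtain p where p: "p \<in> Q" using step_class_nonempty by blast
  then have "Inl p \<in> class_verts I \<sigma> Q" "Inl p \<in> class_verts I \<sigma> P"
    using step_class_sub[OF Q(1)] by (auto simp: class_verts_def)
  then show "X \<in> sverts cmap // (sadj cmap)\<^sup>*"
    unfolding sverts_cycle_map Q(2) using sadj_class[OF Q(1)] by (metis quotientI)
qed

lemma sinduced_class_verts: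
  assumes Q: "Q \<in> classes"
  shows "sinduced cmap (class_verts I \<sigma> Q) = cycle_map I Q \<sigma> (M \<inter> I \<times> Q)"
proof -
  note QP = step_class_sub[OF Q]
  have L: "Inl p \<in> class_verts I \<sigma> Q \<longleftrightarrow> p \<in> Q" for p by (auto simp: class_verts_def)
  have R: "Inr (c, orbit (\<sigma> c) p) \<in> class_verts I \<sigma> Q \<longleftrightarrow> p \<in> Q" if "c \<in> I" "p \<in> P" for c p
    using that step_class_orbit[OF Q that(1)] self_in_orbit[OF that]
    by (auto simp: class_verts_def)
  have E: "{e \<in> I \<times> P. snd e \<in> Q \<and>
      Inr (case e of (c, p) \<Rightarrow> (c, orbit (\<sigma> c) p)) \<in> class_verts I \<sigma> Q} = I \<times> Q"
    using QP by (auto simp: L R)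
  have V: "{v \<in> (\<lambda>(c, p). (c, orbit (\<sigma> c) p)) ` (I \<times> P). Inr v \<in> class_verts I \<sigma> Q} =
      (\<lambda>(c, p). (c, orbit (\<sigma> c) p)) ` (I \<times> Q)"
    using QP R by (auto simp: image_iff)
  have W: "{w \<in> P. w \<in> Q} = Q" using QP by auto
  show ?thesis
    unfolding sinduced_def cycle_map_def Let_def by (simp add: L W V E)
qed

lemma scomponents_cycle_map:
  "scomponents cmap = (\<lambda>Q. cycle_map I Q \<sigma> (M \<inter> I \<times> Q)) ` classes"
  unfolding scomponents_def sadj_classes image_image
  by (intro image_cong refl sinduced_class_verts)

lemma sconnected_cycle_map:
  "sconnected cmap \<longleftrightarrow> P \<noteq> {} \<and> (\<forall>p\<in>P. \<forall>p'\<in>P. (p, p') \<in> reach)"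
    (is "?L \<longleftrightarrow> ?R")
proof
  assume con: ?L
  have "(p, p') \<in> reach" if p: "p \<in> P" "p' \<in> P" for p p'
  proof -
    let ?Q = "reach `` {p}"
    have "Inl p \<in> class_verts I \<sigma> ?Q" by (auto simp: class_verts_def)
    moreover have "(Inl p, Inl p') \<in> (sadj cmap)\<^sup>*"
      using con p by (auto simp: sconnected_def sverts_cycle_map class_verts_def)
    ultimately have "Inl p' \<in> class_verts I \<sigma> ?Q"
      using sadj_class[OF step_class_of[OF p(1)]] by blast
    then show ?thesis by (auto simp: class_verts_def)
  qed
  moreover have "P \<noteq> {}"
    using con by (auto simp: sconnected_def sverts_cycle_map class_verts_def)
  ultimately show ?R by blast
next
  assume R: ?R
  then obtain p where p: "p \<in> P" by blast
  have "reach `` {p} = P" using R p rtrancl_steps_in by blast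
  then have "P \<in> classes" using step_class_of[OF p] by simp
  then have "(u, v) \<in> (sadj cmap)\<^sup>*"
    if "u \<in> class_verts I \<sigma> P" "v \<in> class_verts I \<sigma> P" for u v
    using sadj_class that by blast
  then show ?L using p by (auto simp: sconnected_def sverts_cycle_map class_verts_def)
qed

end

subsection \<open>Every stacked map is given by permutations\<close>

text \<open>Each white vertex has one edge per colour, so colour and white end name an edge
  faithfully, and the cyclic order around a coloured vertex becomes a cycle on white vertices. The
  map on white vertices is \<open>id\<close>, so an identification \<open>\<kappa>\<close> survives
  unchanged.\<close>

lemma stacked_map_normal_form:
  assumes st: "stacked_map I S" and fin: "finite I"
  obtains \<sigma> M h g where "perm_system I (whites S) \<sigma> M"
    "smap_iso id h g S (cycle_map I (whites S) \<sigma> M)"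
proof -
  note wf = wf_smapD[OF stacked_map_wf[OF st]]
  define W where "W = whites S"
  define E where "E = sedges S"
  define ed where "ed c w = (THE e. e \<in> E \<and> ecol S e = c \<and> wend S e = w)" for c w
  define \<sigma> where "\<sigma> c w = wend S (nxt S (ed c w))" for c w
  define h where "h e = (ecol S e, wend S e)" for e
  \<comment> \<open>By \<open>orb\<close> below, the white ends at a coloured vertex form one orbit
    of the induced permutation, which makes \<open>g v\<close> a coloured vertex of the
    \<open>cycle_map\<close>.\<close>
  define g where "g v = (vcol S v, wend S ` {e \<in> E. cend S e = v})" for v
  have fins: "finite W" "finite E" and col: "\<And>e. e \<in> E \<Longrightarrow> ecol S e \<in> I"
    using st by (auto simp: stacked_map_def W_def E_def)
  have ex1: "\<exists>!e. e \<in> E \<and> ecol S e = c \<and> wend S e = w" if "w \<in> W" "c \<in> I" for c w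
    using st that by (simp add: stacked_map_def W_def E_def)
  have ed: "ed c w \<in> E" "ecol S (ed c w) = c" "wend S (ed c w) = w" if "w \<in> W" "c \<in> I" for c w
    using theI'[OF ex1[OF that]] by (auto simp: ed_def)
  have wE: "wend S e \<in> W" "cend S e \<in> cverts S" "nxt S e \<in> E" if "e \<in> E" for e
    using wf that by (auto simp: E_def W_def)
  have ed_eq: "ed (ecol S e) (wend S e) = e" if "e \<in> E" for e
    using ex1[OF wE(1)[OF that] col[OF that]] ed[OF wE(1)[OF that] col[OF that]] that by blast
  have hinj: "inj_on h E"
    by (rule inj_onI) (metis ed_eq h_def prod.inject)
  have him: "h ` E = I \<times> W"
  proof
    show "h ` E \<subseteq> I \<times> W" using wE col by (auto simp: h_def)
    show "I \<times> W \<subseteq> h ` E"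
    proof clarify
      fix c w assume "c \<in> I" "w \<in> W"
      then have "h (ed c w) = (c, w)" "ed c w \<in> E" using ed by (auto simp: h_def)
      then show "(c, w) \<in> h ` E" by (metis imageI)
    qed
  qed
  have nxtcol: "ecol S (nxt S e) = ecol S e" if "e \<in> E" for e
    using wf(3-5)[of e] wf(5)[of "nxt S e"] that by (simp add: E_def)
  have cyc: "cyclic_on (nxt S) {e \<in> E. cend S e = v}" if "v \<in> cverts S" for v
    using st that by (simp add: stacked_map_def E_def)
  have orbE: "orbit (nxt S) e = {e' \<in> E. cend S e' = cend S e}" if "e \<in> E" for e
    using orbit_cyclic_eq3[OF cyc[OF wE(2)[OF that]], of e] that by simp
  have sig: "\<sigma> (ecol S e) (wend S e) = wend S (nxt S e)" if "e \<in> E" for e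
    by (simp add: \<sigma>_def ed_eq that)
  have colo: "ecol S e' = ecol S e" if "e \<in> E" "e' \<in> orbit (nxt S) e" for e e'
    using that wf(5) by (simp add: orbE E_def)
  have orb: "wend S ` {e' \<in> E. cend S e' = cend S e} = orbit (\<sigma> (ecol S e)) (wend S e)"
    if "e \<in> E" for e
    unfolding orbE[OF that, symmetric]
  proof (rule orbit_inverse)
    show "e \<in> orbit (nxt S) e" using that by (simp add: orbE)
    fix x assume x: "x \<in> orbit (nxt S) e"
    then have "x \<in> E" using orbE[OF that] by simp
    then show "\<sigma> (ecol S e) (wend S x) = wend S (nxt S x)"
      using sig[of x] colo[OF that x] by simp
  qed
  \<comment> \<open>Since \<open>nxt\<close> keeps the coloured end, two edges with the same
    successor lie on one cycle, and a finite set mapped onto itself is mapped injectively.\<close>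
  have nxtinj: "e = e'" if "e \<in> E" "e' \<in> E" "nxt S e = nxt S e'" for e e'
  proof -
    let ?S = "{d \<in> E. cend S d = cend S e}"
    have "cend S e = cend S e'" using wf(4)[of e] wf(4)[of e'] that by (simp add: E_def)
    then have ee: "e \<in> ?S" "e' \<in> ?S" using that by auto
    have "finite ?S" using fins by simp
    moreover have "?S \<subseteq> nxt S ` ?S"
    proof
      fix d assume dS: "d \<in> ?S"
      then have "d \<in> orbit (nxt S) d" "orbit (nxt S) d = ?S" using orbE[of d] by auto
      then have *: "d \<in> orbit (nxt S) d" "orbit (nxt S) d \<subseteq> ?S" by simp_all
      from *(1) show "d \<in> nxt S ` ?S"
      proof cases
        case base
        then show ?thesis using dS by blast
      next
        case (step y)
        then show ?thesis using *(2) by blast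
      qed
    qed
    ultimately have "inj_on (nxt S) ?S" by (rule finite_surj_inj)
    then show ?thesis using ee that(3) by (auto dest: inj_onD)
  qed
  have "perm_system I W \<sigma> (h ` marked S)"
  proof
    fix c assume c: "c \<in> I"
    have "inj_on (\<sigma> c) W"
    proof (rule inj_onI)
      fix w w' assume w: "w \<in> W" "w' \<in> W" and eq: "\<sigma> c w = \<sigma> c w'"
      let ?e = "ed c w" and ?e' = "ed c w'"
      note e = ed[OF w(1) c] ed[OF w(2) c]
      have "h (nxt S ?e) = h (nxt S ?e')"
        using eq nxtcol[OF e(1)] nxtcol[OF e(4)] by (simp add: h_def \<sigma>_def e)
      then have "?e = ?e'"
        using nxtinj[OF e(1,4)] inj_on_eq_iff[OF hinj wE(3)[OF e(1)] wE(3)[OF e(4)]] by simp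
      then show "w = w'" using e(3,6) by metis
    qed
    moreover have "\<sigma> c ` W \<subseteq> W"
      using wE(1)[OF wE(3)[OF ed(1)[OF _ c]]] by (auto simp: \<sigma>_def)
    ultimately show "bij_betw (\<sigma> c) W W" using fins by (simp add: bij_betw_def endo_inj_surj)
  next
    show "h ` marked S \<subseteq> I \<times> W"
      using st him[symmetric] by (auto simp: stacked_map_def E_def)
    show "c = 0" if "(c, w) \<in> h ` marked S" for c w
      using that st by (auto simp: stacked_map_def h_def)
    fix w w' assume "(0, w) \<in> h ` marked S" "(0, w') \<in> h ` marked S"
      and o: "w' \<in> orbit (\<sigma> 0) w"
    then obtain e e' where e: "e \<in> marked S" "e' \<in> marked S" "h e = (0, w)" "h e' = (0, w')"
      by (metis imageE)
    then have ee: "e \<in> E" "e' \<in> E" using st by (auto simp: stacked_map_def E_def)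
    have "w' \<in> wend S ` {d \<in> E. cend S d = cend S e}"
      using o orb[OF ee(1)] e by (simp add: h_def)
    \<comment> \<open>The edge of colour 0 at \<open>w'\<close> is unique, so \<open>d\<close> is
      the marked edge \<open>e'\<close>; two marks at one coloured vertex coincide.\<close>
    then obtain d where d: "d \<in> E" "cend S d = cend S e" "wend S d = w'" by blast
    then have "ecol S d = ecol S e" using wf(5) ee by (simp add: E_def)
    then have "d = e'" using ed_eq[OF d(1)] ed_eq[OF ee(2)] d e by (simp add: h_def)
    then have "e' = e" using st e d(2) by (auto simp: stacked_map_def dest: inj_onD)
    then show "w' = w" using e by simp
  qed (use fins fin in auto)
  moreover have "smap_iso id h g S (cycle_map I W \<sigma> (h ` marked S))"
  proof (rule smap_isoI)
    have gv: "g (cend S e) = (ecol S e, orbit (\<sigma> (ecol S e)) (wend S e))" if "e \<in> E" for e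
      using orb[OF that] wf(5)[of e] that by (simp add: g_def E_def)
    have surj: "\<exists>e\<in>E. cend S e = v" if "v \<in> cverts S" for v
      using cyc[OF that] by (auto simp: cyclic_on_def)
    then have cv: "cverts S = cend S ` E" using wE(2) by blast
    show "inj_on h (sedges S)" using hinj by (simp add: E_def)
    show "inj_on g (cverts S)"
    proof (rule inj_onI)
      fix v v' assume v: "v \<in> cverts S" "v' \<in> cverts S" "g v = g v'"
      then obtain e where e: "e \<in> E" "cend S e = v" using surj by blast
      then have "wend S e \<in> wend S ` {d \<in> E. cend S d = v'}"
        using v(3) by (auto simp: g_def)
      then obtain d where d: "d \<in> E" "cend S d = v'" "wend S d = wend S e" by force
      moreover have "ecol S d = ecol S e"
        using v(3) wf(5) e d by (simp add: g_def E_def)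
      ultimately have "d = e" using ed_eq e by metis
      then show "v = v'" using e d by simp
    qed
    show "cverts (cycle_map I W \<sigma> (h ` marked S)) = g ` cverts S"
    proof -
      have "g ` cverts S = (\<lambda>(c, w). (c, orbit (\<sigma> c) w)) ` h ` E"
        unfolding cv image_image by (rule image_cong) (simp_all add: gv h_def)
      then show ?thesis by (simp add: him cycle_map_def)
    qed
    show "vcol (cycle_map I W \<sigma> (h ` marked S)) (g v) = vcol S v" for v
      by (simp add: cycle_map_def g_def)
    fix e assume "e \<in> sedges S"
    then have e: "e \<in> E" by (simp add: E_def)
    show "cend (cycle_map I W \<sigma> (h ` marked S)) (h e) = g (cend S e)"
      by (simp add: cycle_map_def gv e h_def)
    show "nxt (cycle_map I W \<sigma> (h ` marked S)) (h e) = h (nxt S e)"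
      by (simp add: cycle_map_def h_def sig e nxtcol)
  qed (auto simp: cycle_map_def h_def him[unfolded E_def h_def] W_def)
  ultimately show thesis using that unfolding W_def by blast
qed

subsection \<open>Graphs given by pairs and permutations\<close>

text \<open>
  The edge of a graph that \<open>\<Psi>\<^sub>0\<close> turns into the corner \<open>(c, p)\<close>; this inverts \<open>edge_corner\<close>.
\<close>

definition corner_edge :: "(nat \<Rightarrow> 'v \<times> 'v \<Rightarrow> 'v \<times> 'v) \<Rightarrow> nat \<times> 'v \<times> 'v \<Rightarrow> nat \<times> 'v \<times> 'v" where
  "corner_edge \<sigma> = (\<lambda>(c, p). if c = 0 then (0, fst (\<sigma> 0 p), snd p) else (c, fst p, snd (\<sigma> c p)))"

text \<open>A marked corner contributes no edge, because it stands for a missing edge of colour 0.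
  With \<open>M = {}\<close> the same formula gives the completed graph.\<close>

definition pgraph ::
    "nat set \<Rightarrow> ('v \<times> 'v) set \<Rightarrow> (nat \<Rightarrow> 'v \<times> 'v \<Rightarrow> 'v \<times> 'v) \<Rightarrow> (nat \<times> 'v \<times> 'v) set \<Rightarrow> 'v bgraph" where
  "pgraph I P \<sigma> M =
     \<lparr>blacks = fst ` P, gwhites = snd ` P, gedges = corner_edge \<sigma> ` (I \<times> P - M)\<rparr>"

abbreviation pverts :: "('v \<times> 'v) set \<Rightarrow> 'v set" where
  "pverts P \<equiv> fst ` P \<union> snd ` P"

lemma pgraph_simps [simp]:
  "blacks (pgraph I P \<sigma> M) = fst ` P" "gwhites (pgraph I P \<sigma> M) = snd ` P"
  "gverts (pgraph I P \<sigma> M) = pverts P"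
  by (auto simp: pgraph_def gverts_def)

lemma gedges_pgraph: "gedges (pgraph I P \<sigma> M) = corner_edge \<sigma> ` (I \<times> P - M)"
  by (simp add: pgraph_def)

lemma mem_gedgesI:
  "c \<in> I \<Longrightarrow> p \<in> P \<Longrightarrow> (c, p) \<notin> M \<Longrightarrow> corner_edge \<sigma> (c, p) \<in> gedges (pgraph I P \<sigma> M)"
  unfolding gedges_pgraph by blast

lemma mem_gedgesE:
  assumes "e \<in> gedges (pgraph I P \<sigma> M)"
  obtains c p where "c \<in> I" "p \<in> P" "(c, p) \<notin> M" "e = corner_edge \<sigma> (c, p)"
  using assms unfolding gedges_pgraph by blast

lemma fst_corner_edge [simp]: "fst (corner_edge \<sigma> x) = fst x"
  by (cases x) (simp add: corner_edge_def)

lemma pgraph_cong: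
  assumes "\<And>c p. c \<in> I \<Longrightarrow> p \<in> P \<Longrightarrow> \<tau> c p = \<sigma> c p"
  shows "pgraph I P \<tau> M = pgraph I P \<sigma> M"
proof -
  have "corner_edge \<tau> ` (I \<times> P - M) = corner_edge \<sigma> ` (I \<times> P - M)"
    by (rule image_cong) (auto simp: corner_edge_def assms)
  then show ?thesis by (simp add: pgraph_def)
qed

section \<open>Disjoint pairs of vertices\<close>

text \<open>A pairing detached from its graph: distinct pairs are disjoint and no vertex is both
  black and white, so a vertex determines its pair and its side.\<close>

locale pair_set =
  fixes P :: "('v \<times> 'v) set"
  assumes fst_eq: "p \<in> P \<Longrightarrow> p' \<in> P \<Longrightarrow> fst p = fst p' \<Longrightarrow> p = p'"
    and snd_eq: "p \<in> P \<Longrightarrow> p' \<in> P \<Longrightarrow> snd p = snd p' \<Longrightarrow> p = p'"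
    and fst_neq_snd: "p \<in> P \<Longrightarrow> p' \<in> P \<Longrightarrow> fst p \<noteq> snd p'"
begin

lemma common_vertex:
  "p \<in> P \<Longrightarrow> p' \<in> P \<Longrightarrow> u \<in> {fst p, snd p} \<Longrightarrow> u \<in> {fst p', snd p'} \<Longrightarrow> p = p'"
  using fst_eq snd_eq fst_neq_snd by (metis insertE singletonD)

lemma fst_in: "Q \<subseteq> P \<Longrightarrow> p \<in> P \<Longrightarrow> fst p \<in> fst ` Q \<longleftrightarrow> p \<in> Q"
  using fst_eq by blast

lemma snd_in: "Q \<subseteq> P \<Longrightarrow> p \<in> P \<Longrightarrow> snd p \<in> snd ` Q \<longleftrightarrow> p \<in> Q"
  using snd_eq by blast

lemma fst_not_in: "Q \<subseteq> P \<Longrightarrow> p \<in> P \<Longrightarrow> fst p \<notin> snd ` Q"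
  using fst_neq_snd by blast

lemma snd_not_in: "Q \<subseteq> P \<Longrightarrow> p \<in> P \<Longrightarrow> snd p \<notin> fst ` Q"
  using fst_neq_snd by (metis imageE subsetD)

lemma pair_set_subset: "Q \<subseteq> P \<Longrightarrow> pair_set Q"
  by unfold_locales (meson fst_eq snd_eq fst_neq_snd subsetD)+

end

lemma pair_set_pairing:
  assumes P: "pairing G P" and disj: "blacks G \<inter> gwhites G = {}"
  shows "pair_set P"
proof
  have sub: "fst p \<in> blacks G" "snd p \<in> gwhites G" if "p \<in> P" for p
    using P that by (auto simp: pairing_def)
  have uniq: "p = p'" if "p \<in> P" "p' \<in> P" "v \<in> {fst p, snd p}" "v \<in> {fst p', snd p'}" for p p' v
  proof -
    have "v \<in> gverts G"
      using sub(1)[OF that(1)] sub(2)[OF that(1)] that(3) by (auto simp: gverts_def)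
    then have "\<exists>!p. p \<in> P \<and> v \<in> {fst p, snd p}" using P by (simp add: pairing_def)
    then show ?thesis using that by blast
  qed
  fix p p' assume p: "p \<in> P" "p' \<in> P"
  show "p = p'" if "fst p = fst p'" using uniq[OF p, of "fst p"] that by simp
  show "p = p'" if "snd p = snd p'" using uniq[OF p, of "snd p"] that by simp
  show "fst p \<noteq> snd p'" using sub[OF p(1)] sub[OF p(2)] disj by auto
qed

lemma pairing_vertex:
  assumes "pairing G P" "v \<in> gverts G"
  obtains p where "p \<in> P" "fst p \<in> blacks G" "snd p \<in> gwhites G" "v = fst p \<or> v = snd p"
proof -
  have "\<exists>!p. p \<in> P \<and> v \<in> {fst p, snd p}" and sub: "P \<subseteq> blacks G \<times> gwhites G"
    using assms by (simp_all add: pairing_def)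
  then obtain p where p: "p \<in> P" "v = fst p \<or> v = snd p" by blast
  moreover have "fst p \<in> blacks G" "snd p \<in> gwhites G"
    using subsetD[OF sub p(1)] by (simp_all add: mem_Times_iff)
  ultimately show thesis using that by blast
qed

lemma pairing_blacks: "pairing G P \<Longrightarrow> blacks G \<inter> gwhites G = {} \<Longrightarrow> blacks G = fst ` P"
proof (intro equalityI subsetI)
  fix v assume "pairing G P" "blacks G \<inter> gwhites G = {}" "v \<in> blacks G"
  then show "v \<in> fst ` P"
    using pairing_vertex[of G P v] by (metis UnI1 disjoint_iff gverts_def imageI)
qed (auto simp: pairing_def)

lemma pairing_whites: "pairing G P \<Longrightarrow> blacks G \<inter> gwhites G = {} \<Longrightarrow> gwhites G = snd ` P"
proof (intro equalityI subsetI)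
  fix v assume "pairing G P" "blacks G \<inter> gwhites G = {}" "v \<in> gwhites G"
  then show "v \<in> snd ` P"
    using pairing_vertex[of G P v] by (metis UnI2 disjoint_iff gverts_def imageI)
qed (auto simp: pairing_def)

section \<open>Edges and unmatched vertices of the graph of a pair system\<close>

locale pair_system = perm_system I P \<sigma> M + pair_set P
  for I and P :: "('v \<times> 'v) set" and \<sigma> and M
begin

abbreviation "graph \<equiv> pgraph I P \<sigma> M"

lemma mem_gedges:
  assumes "c \<noteq> 0"
  shows "(c, b, w) \<in> gedges graph \<longleftrightarrow> c \<in> I \<and> (\<exists>p\<in>P. b = fst p \<and> w = snd (\<sigma> c p))"
proof
  assume "(c, b, w) \<in> gedges graph"
  then obtain d p where "d \<in> I" "p \<in> P" "(c, b, w) = corner_edge \<sigma> (d, p)"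
    by (elim mem_gedgesE)
  then show "c \<in> I \<and> (\<exists>p\<in>P. b = fst p \<and> w = snd (\<sigma> c p))"
    using assms by (cases "d = 0") (auto simp: corner_edge_def)
next
  assume "c \<in> I \<and> (\<exists>p\<in>P. b = fst p \<and> w = snd (\<sigma> c p))"
  then obtain p where p: "c \<in> I" "p \<in> P" "b = fst p" "w = snd (\<sigma> c p)" by blast
  then have "(c, b, w) = corner_edge \<sigma> (c, p)" using assms by (simp add: corner_edge_def)
  moreover have "(c, p) \<notin> M" using assms marks_colour by blast
  ultimately show "(c, b, w) \<in> gedges graph" using p mem_gedgesI by metis
qed

lemma mem_gedges0:
  "(0, b, w) \<in> gedges graph \<longleftrightarrow>
     0 \<in> I \<and> (\<exists>p\<in>P. (0, p) \<notin> M \<and> b = fst (\<sigma> 0 p) \<and> w = snd p)"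
proof
  assume "(0, b, w) \<in> gedges graph"
  then obtain d p where p: "d \<in> I" "p \<in> P" "(d, p) \<notin> M" "(0, b, w) = corner_edge \<sigma> (d, p)"
    by (elim mem_gedgesE)
  moreover have "d = 0" using p(4) by (cases "d = 0") (auto simp: corner_edge_def)
  ultimately show "0 \<in> I \<and> (\<exists>p\<in>P. (0, p) \<notin> M \<and> b = fst (\<sigma> 0 p) \<and> w = snd p)"
    by (auto simp: corner_edge_def)
next
  assume "0 \<in> I \<and> (\<exists>p\<in>P. (0, p) \<notin> M \<and> b = fst (\<sigma> 0 p) \<and> w = snd p)"
  then obtain p where p: "0 \<in> I" "p \<in> P" "(0, p) \<notin> M" "b = fst (\<sigma> 0 p)" "w = snd p" by blast
  then have "(0, b, w) = corner_edge \<sigma> (0, p)" by (simp add: corner_edge_def)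
  then show "(0, b, w) \<in> gedges graph" using p mem_gedgesI by metis
qed

lemma edge_corner_corner_edge:
  assumes "c \<in> I" "p \<in> P"
  shows "edge_corner P (corner_edge \<sigma> (c, p)) = (c, p)"
proof -
  have "(THE p'. p' \<in> P \<and> fst p' = fst p) = p" "(THE p'. p' \<in> P \<and> snd p' = snd p) = p"
    by (rule the_equality; use assms(2) fst_eq snd_eq in blast)+
  then show ?thesis by (simp add: edge_corner_def corner_edge_def)
qed

lemma edge_corner_image: "X \<subseteq> I \<times> P \<Longrightarrow> edge_corner P ` corner_edge \<sigma> ` X = X"
  using edge_corner_corner_edge by (force simp: image_image image_iff)

lemma inj_on_corner_edge: "inj_on (corner_edge \<sigma>) (I \<times> P)"
  by (rule inj_on_inverseI[of _ "edge_corner P"]) (auto simp: edge_corner_corner_edge)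

lemma coloured_pgraph: "coloured_graph I graph"
  unfolding coloured_graph_def
proof (intro conjI allI impI)
  show "blacks graph \<inter> gwhites graph = {}"
    using fst_neq_snd by auto
  show "gedges graph \<subseteq> I \<times> blacks graph \<times> gwhites graph"
  proof
    fix e assume "e \<in> gedges graph"
    then obtain c p where "c \<in> I" "p \<in> P" "e = corner_edge \<sigma> (c, p)"
      by (elim mem_gedgesE)
    then show "e \<in> I \<times> blacks graph \<times> gwhites graph"
      using closed[of c p] by (cases "c = 0") (simp_all add: corner_edge_def)
  qed
  fix c b w
  show "w = w'" if e: "(c, b, w) \<in> gedges graph" "(c, b, w') \<in> gedges graph" for w'
  proof (cases "c = 0")
    case True
    then show ?thesis using e unfolding True mem_gedges0
      by (metis closed fst_eq sigma_eq_iff)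
  next
    case False
    then show ?thesis using e unfolding mem_gedges[OF False] by (metis fst_eq)
  qed
  show "b = b'" if e: "(c, b, w) \<in> gedges graph" "(c, b', w) \<in> gedges graph" for b'
  proof (cases "c = 0")
    case True
    then show ?thesis using e unfolding True mem_gedges0 by (metis snd_eq)
  next
    case False
    then show ?thesis using e unfolding mem_gedges[OF False] by (metis closed snd_eq sigma_eq_iff)
  qed
qed (simp add: finite_P)

lemma has_edge_pgraph:
  assumes "c \<noteq> 0" "c \<in> I" "v \<in> pverts P"
  shows "has_edge graph c v"
proof -
  consider p where "p \<in> P" "v = fst p" | p where "p \<in> P" "v = snd p" using assms(3) by auto
  then show ?thesis
  proof cases
    case 1
    then show ?thesis using assms unfolding has_edge_def mem_gedges[OF assms(1)] by blast
  next
    case (2 p)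
    then obtain p' where "p' \<in> P" "\<sigma> c p' = p" using sigma_surj[OF assms(2)] by metis
    then show ?thesis using assms 2 unfolding has_edge_def mem_gedges[OF assms(1)] by blast
  qed
qed

lemma has_edge0_white:
  assumes "0 \<in> I" "p \<in> P"
  shows "has_edge graph 0 (snd p) \<longleftrightarrow> (0, p) \<notin> M"
  unfolding has_edge_def mem_gedges0
  using assms snd_eq fst_neq_snd closed by metis

lemma has_edge0_black:
  assumes "0 \<in> I" "p \<in> P"
  shows "has_edge graph 0 (fst (\<sigma> 0 p)) \<longleftrightarrow> (0, p) \<notin> M"
  unfolding has_edge_def mem_gedges0
  using assms fst_eq fst_neq_snd closed sigma_eq_iff by metis

text \<open>A mark \<open>(0, p)\<close> leaves exactly two vertices without an edge of colour 0:
  the white vertex of \<open>p\<close> and the black vertex of \<open>\<sigma> 0 p\<close>. Distinct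
  marks give distinct vertices on each side.\<close>

lemma card_unmatched:
  assumes 0: "0 \<in> I"
  shows "card {w \<in> gwhites graph. \<not> has_edge graph 0 w} = card M"
    and "card {b \<in> blacks graph. \<not> has_edge graph 0 b} = card M"
proof -
  let ?G = "graph" and ?m = "{p \<in> P. (0, p) \<in> M}"
  have "M = {0} \<times> ?m" using marks_sub marks_colour by fastforce
  then have M: "card M = card ?m" by (metis card_cartesian_product_singleton)
  have "{w \<in> gwhites ?G. \<not> has_edge ?G 0 w} = snd ` ?m"
    using has_edge0_white[OF 0] by auto
  moreover have "inj_on snd ?m" by (rule inj_onI) (use snd_eq in blast)
  ultimately show "card {w \<in> gwhites ?G. \<not> has_edge ?G 0 w} = card M"
    using M by (simp add: card_image)
  have "b \<in> blacks ?G \<and> \<not> has_edge ?G 0 b \<longleftrightarrow> b \<in> (\<lambda>p. fst (\<sigma> 0 p)) ` ?m" for b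
  proof
    assume "b \<in> blacks ?G \<and> \<not> has_edge ?G 0 b"
    then obtain p where p: "p \<in> P" "b = fst p" "\<not> has_edge ?G 0 (fst p)" by auto
    obtain r where "r \<in> P" "\<sigma> 0 r = p" using sigma_surj[OF 0 p(1)] by blast
    then show "b \<in> (\<lambda>p. fst (\<sigma> 0 p)) ` ?m" using has_edge0_black[OF 0, of r] p by blast
  next
    assume "b \<in> (\<lambda>p. fst (\<sigma> 0 p)) ` ?m"
    then obtain r where "r \<in> P" "(0, r) \<in> M" "b = fst (\<sigma> 0 r)" by blast
    then show "b \<in> blacks ?G \<and> \<not> has_edge ?G 0 b"
      using has_edge0_black[OF 0, of r] closed[OF 0, of r] by simp
  qed
  then have "{b \<in> blacks ?G. \<not> has_edge ?G 0 b} = (\<lambda>p. fst (\<sigma> 0 p)) ` ?m" by blast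
  moreover have "inj_on (\<lambda>p. fst (\<sigma> 0 p)) ?m"
  proof (rule inj_onI)
    fix p r assume "p \<in> ?m" "r \<in> ?m" and eq: "fst (\<sigma> 0 p) = fst (\<sigma> 0 r)"
    then have p: "p \<in> P" "r \<in> P" by simp_all
    then show "p = r"
      using fst_eq[OF closed[OF 0 p(1)] closed[OF 0 p(2)] eq] sigma_eq_iff[OF 0 p] by simp
  qed
  ultimately show "card {b \<in> blacks ?G. \<not> has_edge ?G 0 b} = card M"
    using M by (simp add: card_image)
qed

lemma gdelete0_pgraph: "gdelete0 graph = pgraph (I - {0}) P \<sigma> {}"
proof -
  have "gedges (gdelete0 graph) = {e \<in> gedges graph. fst e \<noteq> 0}"
    by (auto simp: gdelete0_def)
  also have "\<dots> = corner_edge \<sigma> ` {x \<in> I \<times> P - M. fst x \<noteq> 0}"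
    unfolding gedges_pgraph Compr_image_eq by simp
  also have "{x \<in> I \<times> P - M. fst x \<noteq> 0} = (I - {0}) \<times> P - {}"
    using marks_colour by auto
  finally show ?thesis
    by (intro bgraph.equality) (simp_all add: gedges_pgraph, simp_all add: gdelete0_def)
qed

lemma without_marks: "pair_system I P \<sigma> {}"
  using restrict_colours[of I] by (intro pair_system.intro) (auto intro: pair_set_axioms)

lemma without_colour_0: "pair_system (I - {0}) P \<sigma> {}"
  using restrict_colours[of "I - {0}"] by (intro pair_system.intro) (auto intro: pair_set_axioms)

lemma pair_perm_pgraph:
  assumes "c \<in> I" "p \<in> P"
  shows "pair_perm (pgraph I P \<sigma> {}) P c p = \<sigma> c p"
proof -
  interpret u: pair_system I P \<sigma> "{}" by (rule without_marks)
  show ?thesis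
  proof (cases "c = 0")
    case True
    have "(THE p'. p' \<in> P \<and> (0, fst p', snd p) \<in> gedges (pgraph I P \<sigma> {})) = \<sigma> 0 p"
    proof (rule the_equality)
      show "\<sigma> 0 p \<in> P \<and> (0, fst (\<sigma> 0 p), snd p) \<in> gedges (pgraph I P \<sigma> {})"
        unfolding u.mem_gedges0 using assms closed[OF assms] by (simp add: True) blast
      show "p' = \<sigma> 0 p"
        if "p' \<in> P \<and> (0, fst p', snd p) \<in> gedges (pgraph I P \<sigma> {})" for p'
        using that assms unfolding u.mem_gedges0 by (metis True closed fst_eq snd_eq)
    qed
    then show ?thesis by (simp add: pair_perm_def True)
  next
    case False
    have "(THE p'. p' \<in> P \<and> (c, fst p, snd p') \<in> gedges (pgraph I P \<sigma> {})) = \<sigma> c p"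
    proof (rule the_equality)
      show "\<sigma> c p \<in> P \<and> (c, fst p, snd (\<sigma> c p)) \<in> gedges (pgraph I P \<sigma> {})"
        unfolding u.mem_gedges[OF False] using assms closed[OF assms] by blast
      show "p' = \<sigma> c p"
        if "p' \<in> P \<and> (c, fst p, snd p') \<in> gedges (pgraph I P \<sigma> {})" for p'
        using that assms unfolding u.mem_gedges[OF False] by (metis closed fst_eq snd_eq)
    qed
    then show ?thesis by (simp add: pair_perm_def False)
  qed
qed

section \<open>Alternating paths and marked edges\<close>

text \<open>The steps of \<open>\<sigma> 0\<close> that are realised by edges of colour 0; an
  alternating path of \<open>\<Psi>\<^sub>0\<close> is a chain of such steps.\<close>

definition unmarked :: "(('v \<times> 'v) \<times> ('v \<times> 'v)) set" where
  "unmarked = {(p, \<sigma> 0 p) | p. p \<in> P \<and> (0, p) \<notin> M}"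

lemma unmarked_in: "(p, p') \<in> unmarked\<^sup>* \<Longrightarrow> 0 \<in> I \<Longrightarrow> p \<in> P \<Longrightarrow> p' \<in> P"
  by (induction rule: rtrancl_induct) (auto simp: unmarked_def closed)

lemma alt_path_pgraph:
  assumes "0 \<in> I"
  shows "alt_path graph P b w \<longleftrightarrow>
    (\<exists>p\<in>P. \<exists>p'. (p, p') \<in> unmarked\<^sup>* \<and> b = fst p \<and> w = snd p')"
proof
  assume "alt_path graph P b w"
  then show "\<exists>p\<in>P. \<exists>p'. (p, p') \<in> unmarked\<^sup>* \<and> b = fst p \<and> w = snd p'"
  proof induction
    case (single b w)
    then show ?case by force
  next
    case (extend b w b' w')
    then obtain p p' where p: "p \<in> P" "(p, p') \<in> unmarked\<^sup>*" "b = fst p" "w = snd p'" by blast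
    obtain r where r: "r \<in> P" "(0, r) \<notin> M" "b' = fst (\<sigma> 0 r)" "w = snd r"
      using extend(2) by (auto simp: mem_gedges0)
    have "r = p'" using snd_eq[OF r(1) unmarked_in[OF p(2) assms p(1)]] r p by simp
    moreover have "(b', w') = \<sigma> 0 r"
      using fst_eq[OF extend(3) closed[OF assms r(1)]] r(3) by simp
    ultimately have "(p', (b', w')) \<in> unmarked" using r unfolding unmarked_def by blast
    then have "(p, (b', w')) \<in> unmarked\<^sup>*" using p(2) by auto
    then show ?case using p by force
  qed
next
  assume "\<exists>p\<in>P. \<exists>p'. (p, p') \<in> unmarked\<^sup>* \<and> b = fst p \<and> w = snd p'"
  then obtain p p' where p: "p \<in> P" "(p, p') \<in> unmarked\<^sup>*" "b = fst p" "w = snd p'" by blast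
  have "alt_path graph P (fst p) (snd p')"
    using p(2)
  proof (induction rule: rtrancl_induct)
    case base
    then show ?case using p(1) by (auto intro: alt_path.single)
  next
    case (step y z)
    then have "(0, fst z, snd y) \<in> gedges graph"
      using assms by (auto simp: mem_gedges0 unmarked_def)
    moreover have "z \<in> P" using step closed assms by (auto simp: unmarked_def)
    then have "(fst z, snd z) \<in> P" by simp
    ultimately show ?case using step(3) alt_path.extend by metis
  qed
  then show "alt_path graph P b w" using p by simp
qed

lemma unmarked_orbit:
  assumes "(\<sigma> 0 p, p') \<in> unmarked\<^sup>*"
  shows "p' \<in> orbit (\<sigma> 0) p"
  using assms by (induction rule: rtrancl_induct) (auto simp: unmarked_def intro: orbit.intros)

text \<open>If \<open>p\<close> were not reached, no element reached from
  \<open>\<sigma> 0 p\<close> could be marked, since the only mark of the cycle is at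
  \<open>p\<close>. The chain would run through the whole orbit, but the orbit contains
  \<open>p\<close>.\<close>

lemma unmarked_path_to_mark:
  assumes m: "(0, p) \<in> M"
  shows "(\<sigma> 0 p, p) \<in> unmarked\<^sup>*"
proof (rule ccontr)
  assume contr: "(\<sigma> 0 p, p) \<notin> unmarked\<^sup>*"
  have P: "0 \<in> I" "p \<in> P" using m marks_sub by auto
  have "(\<sigma> 0 p, r) \<in> unmarked\<^sup>*" if "r \<in> orbit (\<sigma> 0) p" for r
    using that
  proof induction
    case (step y)
    then have "(0, y) \<notin> M" using marks_unique[OF m, of y] contr by auto
    moreover have "y \<in> P" using step orbit_sub[OF P] by blast
    ultimately have "(y, \<sigma> 0 y) \<in> unmarked" unfolding unmarked_def by blast
    then show ?case using step by auto
  qed simp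
  then show False using self_in_orbit[OF P] contr by blast
qed

text \<open>An alternating path that joins two unmatched vertices begins just after some mark
  \<open>\<mu>\<close> and ends at a mark \<open>p'\<close> of the same cycle, so
  \<open>p' = \<mu>\<close>. Conversely, \<open>unmarked_path_to_mark\<close> supplies the path
  belonging to a mark.\<close>

lemma marked_edges_pgraph:
  assumes I: "0 \<in> I"
  shows "marked_edges graph P = corner_edge \<sigma> ` M"
proof (intro equalityI subsetI)
  fix e assume "e \<in> marked_edges graph P"
  then obtain b w where e: "e = (0, b, w)" and ne: "\<not> has_edge graph 0 b"
      "\<not> has_edge graph 0 w" and ap: "alt_path graph P b w"
    unfolding marked_edges_def by blast
  obtain p p' where p: "p \<in> P" "(p, p') \<in> unmarked\<^sup>*" "b = fst p" "w = snd p'"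
    using ap alt_path_pgraph[OF I] by blast
  obtain \<mu> where mu: "\<mu> \<in> P" "\<sigma> 0 \<mu> = p" using sigma_surj[OF I p(1)] by blast
  have "(0, \<mu>) \<in> M" using ne(1) has_edge0_black[OF I mu(1)] p mu by simp
  moreover have "(0, p') \<in> M"
    using ne(2) has_edge0_white[OF I unmarked_in[OF p(2) I p(1)]] p by simp
  moreover have "p' \<in> orbit (\<sigma> 0) \<mu>" using unmarked_orbit p(2) mu(2) by blast
  ultimately have "p' = \<mu>" "(0, \<mu>) \<in> M" using marks_unique by blast+
  then show "e \<in> corner_edge \<sigma> ` M"
    using e p mu by (intro image_eqI[of _ _ "(0, \<mu>)"]) (auto simp: corner_edge_def)
next
  fix e assume "e \<in> corner_edge \<sigma> ` M"
  then obtain \<mu> where mu: "(0, \<mu>) \<in> M" "e = (0, fst (\<sigma> 0 \<mu>), snd \<mu>)"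
    using marks_colour by (force simp: corner_edge_def)
  then have "\<mu> \<in> P" using marks_sub by auto
  then have "alt_path graph P (fst (\<sigma> 0 \<mu>)) (snd \<mu>)"
    unfolding alt_path_pgraph[OF I] using closed I unmarked_path_to_mark[OF mu(1)] by blast
  then show "e \<in> marked_edges graph P"
    using mu \<open>\<mu> \<in> P\<close> has_edge0_white[OF I, of \<mu>] has_edge0_black[OF I, of \<mu>] closed[OF I, of \<mu>]
    by (simp add: marked_edges_def)
qed

lemma complete_pgraph:
  assumes I: "0 \<in> I"
  shows "complete_graph graph P = pgraph I P \<sigma> {}"
proof -
  have "corner_edge \<sigma> ` (I \<times> P - M) \<union> corner_edge \<sigma> ` M = corner_edge \<sigma> ` (I \<times> P - {})"
    using marks_sub by blast
  then show ?thesis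
    by (simp add: complete_graph_def marked_edges_pgraph[OF I]) (simp add: pgraph_def)
qed

lemma edge_corner_marked_edges:
  "0 \<in> I \<Longrightarrow> edge_corner P ` marked_edges graph P = M"
  by (simp add: marked_edges_pgraph edge_corner_image marks_sub)

end

section \<open>Graphs in which every colour is a perfect matching\<close>

text \<open>Applied to the models and to graphs with the edges of colour 0 deleted. Regularity gives
  a unique witness for each \<open>THE\<close> in \<open>pair_perm\<close>, and properness makes it
  injective on the finite set of pairs, hence a permutation.\<close>

lemma regular_graph_eq_pgraph:
  assumes G: "coloured_graph I G" and I: "0 \<notin> I" "finite I" and P: "pairing G P"
    and reg: "\<And>v c. v \<in> gverts G \<Longrightarrow> c \<in> I \<Longrightarrow> has_edge G c v"
  shows "pair_system I P (pair_perm G P) {}" "G = pgraph I P (pair_perm G P) {}"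
proof -
  have disj: "blacks G \<inter> gwhites G = {}" and fin: "finite (gverts G)"
    and sub: "gedges G \<subseteq> I \<times> blacks G \<times> gwhites G"
    and det1: "\<And>c b w w'. (c, b, w) \<in> gedges G \<Longrightarrow> (c, b, w') \<in> gedges G \<Longrightarrow> w = w'"
    and det2: "\<And>c b b' w. (c, b, w) \<in> gedges G \<Longrightarrow> (c, b', w) \<in> gedges G \<Longrightarrow> b = b'"
    using G unfolding coloured_graph_def by blast+
  interpret pair_set P by (rule pair_set_pairing[OF P disj])
  note bl = pairing_blacks[OF P disj] and wh = pairing_whites[OF P disj]
  let ?p = "pair_perm G P"
  have edge: "?p c p \<in> P \<and> (c, fst p, snd (?p c p)) \<in> gedges G"
    and uniq: "\<And>p'. p' \<in> P \<Longrightarrow> (c, fst p, snd p') \<in> gedges G \<Longrightarrow> ?p c p = p'"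
    if c: "c \<in> I" "p \<in> P" for c p
  proof -
    have "fst p \<in> gverts G" using bl c(2) by (simp add: gverts_def)
    then obtain u where u: "(c, fst p, u) \<in> gedges G \<or> (c, u, fst p) \<in> gedges G"
      using reg c(1) unfolding has_edge_def by blast
    have "fst p \<notin> gwhites G" using bl disj c(2) by blast
    then have u: "(c, fst p, u) \<in> gedges G" using u sub by blast
    then obtain r where r: "r \<in> P" "u = snd r" using sub wh by blast
    have c0: "c \<noteq> 0" using c I by metis
    have ex1: "\<exists>!p'. p' \<in> P \<and> (c, fst p, snd p') \<in> gedges G"
      using r u det1 snd_eq by (intro ex1I[of _ r]) blast+
    have p: "?p c p = (THE p'. p' \<in> P \<and> (c, fst p, snd p') \<in> gedges G)"
      using c0 by (simp add: pair_perm_def)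
    show "?p c p \<in> P \<and> (c, fst p, snd (?p c p)) \<in> gedges G"
      unfolding p by (rule theI'[OF ex1])
    show "?p c p = p'" if "p' \<in> P" "(c, fst p, snd p') \<in> gedges G" for p'
      unfolding p using that by (intro the1_equality[OF ex1]) simp
  qed
  have finP: "finite P"
  proof (rule finite_imageD)
    show "finite (fst ` P)" using fin bl by (simp add: gverts_def)
    show "inj_on fst P" by (rule inj_onI) (rule fst_eq)
  qed
  show sys: "pair_system I P ?p {}"
  proof
    fix c assume c: "c \<in> I"
    have "inj_on (?p c) P"
      by (rule inj_onI) (metis c edge det2 fst_eq)
    moreover have "?p c ` P \<subseteq> P" using edge c by blast
    ultimately show "bij_betw (?p c) P P" using finP by (simp add: bij_betw_def endo_inj_surj)
  qed (use I finP in auto)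
  interpret s: pair_system I P ?p "{}" by (rule sys)
  have "gedges G = gedges (pgraph I P ?p {})"
  proof (intro equalityI subrelI subsetI)
    fix e assume e: "e \<in> gedges G"
    then obtain c b w where cbw: "e = (c, b, w)" "c \<in> I" "b \<in> blacks G" "w \<in> gwhites G"
      using sub by blast
    then obtain p r where pr: "p \<in> P" "b = fst p" "r \<in> P" "w = snd r" using bl wh by blast
    have c0: "c \<noteq> 0" using cbw I by metis
    have "?p c p = r" using uniq[OF cbw(2) pr(1,3)] e cbw pr by simp
    then show "e \<in> gedges (pgraph I P ?p {})"
      using s.mem_gedges[OF c0] pr cbw by blast
  next
    fix e assume e: "e \<in> gedges (pgraph I P ?p {})"
    then obtain c p where "c \<in> I" "p \<in> P" "e = corner_edge ?p (c, p)"
      by (auto simp: gedges_pgraph)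
    moreover have "c \<noteq> 0" using calculation I by metis
    ultimately show "e \<in> gedges G" using edge[of c p] by (simp add: corner_edge_def)
  qed
  then show "G = pgraph I P ?p {}"
    using bl wh by (intro bgraph.equality) simp_all
qed

subsection \<open>Connectedness and isomorphisms of graphs\<close>

lemma gadj_sym: "(u, v) \<in> gadj G \<Longrightarrow> (v, u) \<in> gadj G"
  by (auto simp: gadj_def)

lemma gadj_rtrancl_sym: "(u, v) \<in> (gadj G)\<^sup>* \<Longrightarrow> (v, u) \<in> (gadj G)\<^sup>*"
  by (induction rule: rtrancl_induct) (auto intro: gadj_sym converse_rtrancl_into_rtrancl)

lemma gverts_gdelete0 [simp]:
  "gverts (gdelete0 G) = gverts G" "blacks (gdelete0 G) = blacks G" "gwhites (gdelete0 G) = gwhites G"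
  by (simp_all add: gdelete0_def gverts_def)

lemma gedges_gdelete0: "(c, b, w) \<in> gedges (gdelete0 G) \<longleftrightarrow> (c, b, w) \<in> gedges G \<and> c \<noteq> 0"
  by (auto simp: gdelete0_def)

lemma gedges_gdelete0_eq: "gedges (gdelete0 G) = {e \<in> gedges G. fst e \<noteq> 0}"
  by (auto simp: gdelete0_def)

lemma gedges_ginduced: "gedges (ginduced G X) = {e \<in> gedges G. fst (snd e) \<in> X \<and> snd (snd e) \<in> X}"
  by (auto simp: ginduced_def)

lemma inj_on_apsnd: "inj_on f A \<Longrightarrow> inj_on (apsnd f) (I \<times> A)"
  by (auto simp: inj_on_def)

lemma ginduced_simps [simp]:
  "blacks (ginduced G X) = blacks G \<inter> X" "gwhites (ginduced G X) = gwhites G \<inter> X"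
  by (simp_all add: ginduced_def)

lemma graph_iso_gadj:
  assumes "graph_iso f G H" "(u, v) \<in> gadj G"
  shows "(f u, f v) \<in> gadj H"
proof -
  obtain c where "(c, u, v) \<in> gedges G \<or> (c, v, u) \<in> gedges G" using assms(2) by (auto simp: gadj_def)
  moreover have "(c, f x, f y) \<in> gedges H" if "(c, x, y) \<in> gedges G" for x y
    using assms(1) that by (force simp: graph_iso_def)
  ultimately show ?thesis unfolding gadj_def by blast
qed

lemma graph_iso_gadj_rtrancl:
  "(u, v) \<in> (gadj G)\<^sup>* \<Longrightarrow> graph_iso f G H \<Longrightarrow> (f u, f v) \<in> (gadj H)\<^sup>*"
  by (induction rule: rtrancl_induct) (auto dest: graph_iso_gadj)

lemma graph_iso_gverts: "graph_iso f G H \<Longrightarrow> gverts H = f ` gverts G"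
  by (auto simp: graph_iso_def gverts_def)

text \<open>The assumption \<open>coloured_graph\<close> ensures that edges end in vertices of
  \<open>G\<close>, where the inverse of \<open>f\<close> cancels.\<close>

lemma graph_iso_inv:
  assumes iso: "graph_iso f G H" and col: "coloured_graph I G"
  shows "graph_iso (inv_into (gverts G) f) H G"
proof -
  let ?g = "inv_into (gverts G) f"
  have inj: "inj_on f (gverts G)" using iso by (simp add: graph_iso_def)
  have gf: "?g (f v) = v" if "v \<in> gverts G" for v using inj that by simp
  have "?g ` f ` blacks G = blacks G" "?g ` f ` gwhites G = gwhites G"
    by (rule inv_into_image_cancel[OF inj], simp add: gverts_def)+
  then have "?g ` blacks H = blacks G" "?g ` gwhites H = gwhites G"
    using iso by (simp_all add: graph_iso_def)
  moreover have "(\<lambda>(c, b, w). (c, ?g b, ?g w)) ` gedges H = gedges G"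
  proof -
    have "gedges H = (\<lambda>(c, b, w). (c, f b, f w)) ` gedges G"
      using iso by (simp add: graph_iso_def)
    then have "(\<lambda>(c, b, w). (c, ?g b, ?g w)) ` gedges H =
        (\<lambda>x. (\<lambda>(c, b, w). (c, ?g b, ?g w)) ((\<lambda>(c, b, w). (c, f b, f w)) x)) ` gedges G"
      by (simp only: image_image)
    also have "\<dots> = (\<lambda>e. e) ` gedges G"
    proof (rule image_cong[OF refl])
      fix e assume "e \<in> gedges G"
      then obtain c b w where "e = (c, b, w)" "b \<in> blacks G" "w \<in> gwhites G"
        using col unfolding coloured_graph_def by blast
      then show "(\<lambda>(c, b, w). (c, ?g b, ?g w)) ((\<lambda>(c, b, w). (c, f b, f w)) e) = e"
        using gf by (simp add: gverts_def)
    qed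
    finally show ?thesis by simp
  qed
  moreover have "inj_on ?g (gverts H)"
    unfolding graph_iso_gverts[OF iso] by (rule inj_on_inv_into) simp
  ultimately show ?thesis by (simp add: graph_iso_def)
qed

lemma graph_iso_comp:
  assumes "graph_iso f G H" "graph_iso g H K"
  shows "graph_iso (g \<circ> f) G K"
proof -
  have "gedges K = (\<lambda>(c, b, w). (c, g b, g w)) ` (\<lambda>(c, b, w). (c, f b, f w)) ` gedges G"
    using assms by (simp add: graph_iso_def)
  also have "\<dots> = (\<lambda>(c, b, w). (c, (g \<circ> f) b, (g \<circ> f) w)) ` gedges G"
    unfolding image_image by (intro image_cong) auto
  finally have "gedges K = (\<lambda>(c, b, w). (c, (g \<circ> f) b, (g \<circ> f) w)) ` gedges G" .
  moreover have "(g \<circ> f) ` blacks G = blacks K" "(g \<circ> f) ` gwhites G = gwhites K"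
    using assms unfolding graph_iso_def by (metis image_comp)+
  moreover have "inj_on (g \<circ> f) (gverts G)"
    using assms comp_inj_on[of f "gverts G" g] graph_iso_gverts[OF assms(1)]
    by (simp add: graph_iso_def)
  ultimately show ?thesis by (simp only: graph_iso_def simp_thms)
qed

text \<open>Serves in \<open>Psi0_cong\<close> to recognise a given graph as one built from
  transported permutations.\<close>

lemma graph_iso_unique: "graph_iso f G H \<Longrightarrow> graph_iso f G H' \<Longrightarrow> H = H'"
  by (intro bgraph.equality) (simp_all add: graph_iso_def)

lemma graph_iso_gdelete0:
  assumes "graph_iso f G H"
  shows "graph_iso f (gdelete0 G) (gdelete0 H)"
proof -
  have "{e \<in> (\<lambda>(c, b, w). (c, f b, f w)) ` gedges G. fst e \<noteq> 0} =
      (\<lambda>(c, b, w). (c, f b, f w)) ` {e \<in> gedges G. fst e \<noteq> 0}"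
    unfolding Compr_image_eq by (simp add: case_prod_beta)
  then show ?thesis
    using assms unfolding graph_iso_def gverts_gdelete0 gedges_gdelete0_eq by simp
qed

lemma gconnected_iso:
  assumes iso: "graph_iso f G H" and con: "gconnected G"
  shows "gconnected H"
  using con graph_iso_gverts[OF iso] graph_iso_gadj_rtrancl[OF _ iso]
  by (simp add: gconnected_def)

text \<open>Lying in a common bubble is reachability along edges of nonzero colours, a form that
  graph isomorphisms visibly preserve.\<close>

lemma global_pairing_eq:
  "global_pairing \<Omega> G \<iota> = {(b, w). b \<in> blacks G \<and> w \<in> gwhites G \<and> (b, w) \<in> (gadj (gdelete0 G))\<^sup>* \<and>
     (snd (\<iota> b), snd (\<iota> w)) \<in> \<Omega> (fst (\<iota> b))}"
proof -
  let ?R = "(gadj (gdelete0 G))\<^sup>*"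
  have "(\<exists>C\<in>bubbles G. b \<in> blacks C \<and> w \<in> gwhites C) \<longleftrightarrow>
      b \<in> blacks G \<and> w \<in> gwhites G \<and> (b, w) \<in> ?R" for b w
  proof
    assume "\<exists>C\<in>bubbles G. b \<in> blacks C \<and> w \<in> gwhites C"
    then obtain u where "b \<in> blacks G" "w \<in> gwhites G" "(u, b) \<in> ?R" "(u, w) \<in> ?R"
      by (auto simp: bubbles_def gcomponents_def quotient_def)
    then show "b \<in> blacks G \<and> w \<in> gwhites G \<and> (b, w) \<in> ?R"
      using gadj_rtrancl_sym rtrancl_trans by metis
  next
    assume bw: "b \<in> blacks G \<and> w \<in> gwhites G \<and> (b, w) \<in> ?R"
    then have "?R `` {b} \<in> gverts G // ?R" by (intro quotientI) (simp add: gverts_def)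
    then have "ginduced (gdelete0 G) (?R `` {b}) \<in> bubbles G"
      by (simp add: bubbles_def gcomponents_def)
    moreover have "b \<in> blacks (ginduced (gdelete0 G) (?R `` {b}))"
      "w \<in> gwhites (ginduced (gdelete0 G) (?R `` {b}))"
      using bw by auto
    ultimately show "\<exists>C\<in>bubbles G. b \<in> blacks C \<and> w \<in> gwhites C" by blast
  qed
  then show ?thesis unfolding global_pairing_def by blast
qed

context pair_system
begin

lemma gadj_pgraphE:
  assumes "(u, v) \<in> gadj graph"
  obtains c p where "c \<in> I" "p \<in> P" "u \<in> {fst p, snd p}" "v \<in> {fst (\<sigma> c p), snd (\<sigma> c p)}"
  | c p where "c \<in> I" "p \<in> P" "v \<in> {fst p, snd p}" "u \<in> {fst (\<sigma> c p), snd (\<sigma> c p)}"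
proof -
  obtain c where "(c, u, v) \<in> gedges graph \<or> (c, v, u) \<in> gedges graph"
    using assms by (auto simp: gadj_def)
  then consider "(c, u, v) \<in> gedges graph" | "(c, v, u) \<in> gedges graph"
    by blast
  then show thesis
  proof cases
    case 1
    then show thesis using that by (cases "c = 0") (auto simp: mem_gedges0 mem_gedges)
  next
    case 2
    then show thesis using that by (cases "c = 0") (auto simp: mem_gedges0 mem_gedges)
  qed
qed

lemma gadj_corner:
  assumes "c \<in> I" "p \<in> P" "(c, p) \<notin> M"
  shows "\<exists>u\<in>{fst p, snd p}. \<exists>v\<in>{fst (\<sigma> c p), snd (\<sigma> c p)}. (u, v) \<in> gadj graph"
  using mem_gedgesI[OF assms, of \<sigma>]
  by (cases "c = 0") (auto simp: corner_edge_def gadj_def)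

end

section \<open>Components of the graph of a pair system\<close>

text \<open>Linking allows a walk to cross between the two vertices of a pair, so that steps between
  pairs lift to walks of vertices. It is instantiated with colours \<open>{1..D}\<close> and no
  marks for the bubbles, and with colours \<open>{0..D}\<close> for the whole graph.\<close>

locale linked_pair_system = pair_system +
  assumes linked: "p \<in> P \<Longrightarrow> (fst p, snd p) \<in> (gadj graph)\<^sup>*"
begin

abbreviation "adj \<equiv> (gadj graph)\<^sup>*"

lemma linked_pair:
  "p \<in> P \<Longrightarrow> u \<in> {fst p, snd p} \<Longrightarrow> v \<in> {fst p, snd p} \<Longrightarrow> (u, v) \<in> adj"
  using linked[of p] gadj_rtrancl_sym[OF linked[of p]] by auto

lemma adj_unmarked_step:
  assumes "c \<in> I" "p \<in> P" "(c, p) \<notin> M"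
  shows "(fst p, fst (\<sigma> c p)) \<in> adj"
proof -
  obtain u v where uv: "u \<in> {fst p, snd p}" "v \<in> {fst (\<sigma> c p), snd (\<sigma> c p)}"
      "(u, v) \<in> gadj graph"
    using gadj_corner[OF assms] by blast
  have "(fst p, u) \<in> adj" by (rule linked_pair[OF assms(2) _ uv(1)]) simp
  moreover have "(v, fst (\<sigma> c p)) \<in> adj" by (rule linked_pair[OF closed[OF assms(1,2)] uv(2)]) simp
  ultimately show ?thesis using uv(3) by (meson r_into_rtrancl rtrancl_trans)
qed

text \<open>A marked step has no edge, but its two pairs are the ends of the unmarked chain given by
  \<open>unmarked_path_to_mark\<close>, which is walked backwards.\<close>

lemma adj_step:
  assumes "c \<in> I" "p \<in> P"
  shows "(fst p, fst (\<sigma> c p)) \<in> adj"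
proof (cases "(c, p) \<in> M")
  case True
  then have c: "c = 0" by (rule marks_colour)
  then have m: "(0, p) \<in> M" using True by simp
  have 0: "0 \<in> I" using assms c by simp
  have "(fst (\<sigma> 0 p), fst r) \<in> adj" if "(\<sigma> 0 p, r) \<in> unmarked\<^sup>*" for r
    using that
  proof (induction rule: rtrancl_induct)
    case (step y z)
    then have "y \<in> P" "(0, y) \<notin> M" "z = \<sigma> 0 y" unfolding unmarked_def by blast+
    then have "(fst y, fst z) \<in> adj" using adj_unmarked_step[OF 0] by blast
    then show ?case using step(3) by (rule rtrancl_trans[rotated])
  qed simp
  from gadj_rtrancl_sym[OF this[OF unmarked_path_to_mark[OF m]]]
  show ?thesis by (simp add: c)
next
  case False
  then show ?thesis using adj_unmarked_step assms by blast
qed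

lemma adj_steps:
  assumes "(p, p') \<in> reach"
  shows "(fst p, fst p') \<in> adj"
  using assms
proof (induction rule: rtrancl_induct)
  case (step y z)
  obtain c where "c \<in> I" "y \<in> P \<and> z = \<sigma> c y \<or> z \<in> P \<and> y = \<sigma> c z"
    using step(2) unfolding steps_def by blast
  then have "(fst y, fst z) \<in> adj"
    using adj_step[of c y] gadj_rtrancl_sym[OF adj_step[of c z]] by auto
  then show ?case using step(3) by (rule rtrancl_trans[rotated])
qed simp

text \<open>An edge is a step between the pairs of its ends, and \<open>common_vertex\<close> makes
  these pairs unambiguous, so consecutive edges give consecutive steps. The converse crosses the
  first and the last pair by linking.\<close>

lemma adj_iff:
  assumes p0: "p \<in> P" "u \<in> {fst p, snd p}"
  shows "(u, v) \<in> adj \<longleftrightarrow> (\<exists>p'\<in>P. v \<in> {fst p', snd p'} \<and> (p, p') \<in> reach)"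
proof
  assume "(u, v) \<in> adj"
  then show "\<exists>p'\<in>P. v \<in> {fst p', snd p'} \<and> (p, p') \<in> reach"
  proof (induction rule: rtrancl_induct)
    case base
    then show ?case using p0 by blast
  next
    case (step y z)
    then obtain p' where p: "p' \<in> P" "y \<in> {fst p', snd p'}" "(p, p') \<in> reach" by blast
    from step(2) obtain r where r: "r \<in> P" "z \<in> {fst r, snd r}" "(p', r) \<in> steps I P \<sigma>"
    proof (cases rule: gadj_pgraphE)
      case (1 c \<mu>)
      then have "\<mu> = p'" using common_vertex p by blast
      then have "(p', \<sigma> c \<mu>) \<in> steps I P \<sigma>" using 1 unfolding steps_def by blast
      then show thesis using that[of "\<sigma> c \<mu>"] 1 closed by blast
    next
      case (2 c \<mu>)
      then have "\<sigma> c \<mu> = p'" using common_vertex p closed by blast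
      then have "(p', \<mu>) \<in> steps I P \<sigma>" using 2 unfolding steps_def by blast
      then show thesis using that[of \<mu>] 2 by blast
    qed
    then have "(p, r) \<in> reach" using p(3) by (meson rtrancl.rtrancl_into_rtrancl)
    then show ?case using r by blast
  qed
next
  assume "\<exists>p'\<in>P. v \<in> {fst p', snd p'} \<and> (p, p') \<in> reach"
  then obtain p' where p: "p' \<in> P" "v \<in> {fst p', snd p'}" "(p, p') \<in> reach" by blast
  have "(u, fst p) \<in> adj" by (rule linked_pair[OF p0]) simp
  moreover have "(fst p', v) \<in> adj" by (rule linked_pair[OF p(1) _ p(2)]) simp
  ultimately show "(u, v) \<in> adj" using adj_steps[OF p(3)] by (meson rtrancl_trans)
qed

lemma gconnected_pgraph:
  "gconnected graph \<longleftrightarrow> P \<noteq> {} \<and> (\<forall>p\<in>P. \<forall>p'\<in>P. (p, p') \<in> reach)"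
proof
  assume con: "gconnected graph"
  have "(p, p') \<in> reach" if p: "p \<in> P" "p' \<in> P" for p p'
  proof -
    have "(fst p, fst p') \<in> adj" using con p unfolding gconnected_def pgraph_simps by blast
    then obtain r where r: "r \<in> P" "fst p' \<in> {fst r, snd r}" "(p, r) \<in> reach"
      using adj_iff[OF p(1)] by blast
    then have "r = p'" using common_vertex[OF r(1) p(2) r(2)] by blast
    then show ?thesis using r by simp
  qed
  then show "P \<noteq> {} \<and> (\<forall>p\<in>P. \<forall>p'\<in>P. (p, p') \<in> reach)"
    using con by (auto simp: gconnected_def)
next
  assume R: "P \<noteq> {} \<and> (\<forall>p\<in>P. \<forall>p'\<in>P. (p, p') \<in> reach)"
  have "(u, v) \<in> adj" if uv: "u \<in> pverts P" "v \<in> pverts P" for u v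
  proof -
    obtain p p' where "p \<in> P" "u \<in> {fst p, snd p}" "p' \<in> P" "v \<in> {fst p', snd p'}"
      using uv by blast
    then show ?thesis using adj_iff[of p u v] R by blast
  qed
  then show "gconnected graph"
    using R by (simp add: gconnected_def)
qed

lemma adj_class:
  assumes Q: "Q \<in> classes" and u: "u \<in> pverts Q"
  shows "adj `` {u} = pverts Q"
proof -
  obtain p where p: "p \<in> Q" "u \<in> {fst p, snd p}" using u by blast
  have P: "p \<in> P" using step_class_sub[OF Q] p(1) by blast
  have mem: "p' \<in> Q \<longleftrightarrow> (p, p') \<in> reach" for p'
    using step_class_eqI[OF Q p(1)] by blast
  have "v \<in> adj `` {u} \<longleftrightarrow> (\<exists>p'\<in>Q. v \<in> {fst p', snd p'})" for v
    unfolding Image_singleton_iff adj_iff[OF P p(2)] mem[symmetric]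
    using step_class_sub[OF Q] by blast
  then show ?thesis by blast
qed

lemma adj_classes: "pverts P // adj = pverts ` classes"
proof (intro equalityI subsetI)
  fix X assume "X \<in> pverts P // adj"
  then obtain u where u: "u \<in> pverts P" "X = adj `` {u}" by (rule quotientE)
  then obtain p where p: "p \<in> P" "u \<in> {fst p, snd p}" by blast
  let ?Q = "reach `` {p}"
  have "u \<in> pverts ?Q" using p by blast
  then have "X = pverts ?Q" using adj_class[OF step_class_of[OF p(1)]] u by blast
  then show "X \<in> pverts ` classes" using step_class_of[OF p(1)] by blast
next
  fix X assume "X \<in> pverts ` classes"
  then obtain Q where Q: "Q \<in> classes" "X = pverts Q" by blast
  then obtain p where p: "p \<in> Q" using step_class_nonempty by blast
  have "fst p \<in> pverts Q" using p by blast
  moreover have "fst p \<in> pverts P" using p step_class_sub[OF Q(1)] by blast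
  ultimately show "X \<in> pverts P // adj"
    using adj_class[OF Q(1)] Q(2) by (metis quotientI)
qed

lemma ginduced_pgraph:
  assumes Q: "Q \<in> classes"
  shows "ginduced graph (pverts Q) = pgraph I Q \<sigma> M"
proof -
  note QP = step_class_sub[OF Q]
  \<comment> \<open>One end of the edge is a vertex of \<open>p\<close> itself and decides the
    matter; the other is a vertex of \<open>\<sigma> c p\<close>, which follows \<open>p\<close>
    into the closed class \<open>Q\<close>.\<close>
  have ends: "fst (snd (corner_edge \<sigma> (c, p))) \<in> pverts Q \<and> snd (snd (corner_edge \<sigma> (c, p))) \<in> pverts Q
      \<longleftrightarrow> p \<in> Q" if "c \<in> I" "p \<in> P" for c p
    using that closed[OF that] step_class_closed[OF Q that(1), of p]
    by (cases "c = 0")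
      (simp_all add: corner_edge_def fst_in[OF QP] snd_in[OF QP] fst_not_in[OF QP] snd_not_in[OF QP], blast+)
  have "gedges (ginduced graph (pverts Q)) =
      {e \<in> corner_edge \<sigma> ` (I \<times> P - M). fst (snd e) \<in> pverts Q \<and> snd (snd e) \<in> pverts Q}"
    by (simp add: gedges_ginduced gedges_pgraph)
  also have "\<dots> = corner_edge \<sigma> ` {x \<in> I \<times> P - M. fst (snd (corner_edge \<sigma> x)) \<in> pverts Q \<and>
      snd (snd (corner_edge \<sigma> x)) \<in> pverts Q}"
    by (rule Compr_image_eq)
  also have "{x \<in> I \<times> P - M. fst (snd (corner_edge \<sigma> x)) \<in> pverts Q \<and>
      snd (snd (corner_edge \<sigma> x)) \<in> pverts Q} = {x \<in> I \<times> P - M. snd x \<in> Q}"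
  proof (rule Collect_cong, rule conj_cong[OF refl])
    fix x assume "x \<in> I \<times> P - M"
    then obtain c p where "x = (c, p)" "c \<in> I" "p \<in> P" by blast
    then show "fst (snd (corner_edge \<sigma> x)) \<in> pverts Q \<and> snd (snd (corner_edge \<sigma> x)) \<in> pverts Q
        \<longleftrightarrow> snd x \<in> Q"
      using ends by simp
  qed
  also have "{x \<in> I \<times> P - M. snd x \<in> Q} = I \<times> Q - M" using QP by auto
  finally have "gedges (ginduced graph (pverts Q)) = gedges (pgraph I Q \<sigma> M)"
    by (simp add: gedges_pgraph)
  moreover have "fst ` P \<inter> pverts Q = fst ` Q"
    using QP fst_neq_snd by blast
  moreover have "snd ` P \<inter> pverts Q = snd ` Q"
    using QP fst_neq_snd by (auto simp: image_iff) blast+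
  ultimately show ?thesis by (intro bgraph.equality) simp_all
qed

lemma gcomponents_pgraph:
  "gcomponents graph = (\<lambda>Q. pgraph I Q \<sigma> M) ` classes"
  unfolding gcomponents_def pgraph_simps adj_classes image_image
  by (intro image_cong refl ginduced_pgraph)

end

section \<open>Transport of permutations and isomorphisms of the graphs they define\<close>

text \<open>Conjugation by \<open>f\<close>. It moves the data of a graph to the pairs of an
  isomorphic one in \<open>Psi0_cong\<close>, and turns white vertices into pairs of vertices in
  \<open>Psi0_surj\<close>.\<close>

lemma (in perm_system) transport:
  assumes f: "bij_betw f P P'"
  shows "perm_system I P' (\<lambda>c. f \<circ> \<sigma> c \<circ> inv_into P f) (apsnd f ` M)"
proof
  let ?t = "\<lambda>c. f \<circ> \<sigma> c \<circ> inv_into P f"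
  have inj: "inj_on f P" and P': "P' = f ` P" using f by (simp_all add: bij_betw_def)
  show "finite P'" using finite_P by (simp add: P')
  show "bij_betw (?t c) P' P'" if "c \<in> I" for c
    using bij_betw_inv_into[OF f] bij[OF that] f by (meson bij_betw_trans)
  show "apsnd f ` M \<subseteq> I \<times> P'" using marks_sub by (auto simp: P')
  show "c = 0" if "(c, p) \<in> apsnd f ` M" for c p using that marks_colour by auto
  fix p p' assume "(0, p) \<in> apsnd f ` M" "(0, p') \<in> apsnd f ` M" and o: "p' \<in> orbit (?t 0) p"
  then obtain r r' where r: "(0, r) \<in> M" "(0, r') \<in> M" "p = f r" "p' = f r'" by auto
  then have P: "0 \<in> I" "r \<in> P" "r' \<in> P" using marks_sub by auto
  have "f ` orbit (\<sigma> 0) r = orbit (?t 0) (f r)"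
    by (rule orbit_conj[OF _ P(1,2)]) (simp add: inv_into_f_f[OF inj])
  then have "f r' \<in> f ` orbit (\<sigma> 0) r" using o r by simp
  then have "r' \<in> orbit (\<sigma> 0) r"
    using inj_on_image_mem_iff[OF inj P(3) orbit_sub[OF P(1,2)]] by simp
  then have "r' = r" by (rule marks_unique[OF r(1,2)])
  then show "p' = p" using r by simp
qed (rule finite_colours)

lemma (in perm_system) transport_comm:
  "bij_betw f P P' \<Longrightarrow> p \<in> P \<Longrightarrow> f (\<sigma> c p) = (f \<circ> \<sigma> c \<circ> inv_into P f) (f p)"
  by (simp add: bij_betw_def)

lemma corner_edge_map:
  assumes "map_prod s s (\<sigma> c p) = \<tau> c (map_prod s s p)"
  shows "corner_edge \<tau> (c, map_prod s s p) = (\<lambda>(c, b, w). (c, s b, s w)) (corner_edge \<sigma> (c, p))"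
proof -
  have "fst (\<tau> c (map_prod s s p)) = s (fst (\<sigma> c p))" "snd (\<tau> c (map_prod s s p)) = s (snd (\<sigma> c p))"
    by (simp_all add: assms[symmetric])
  then show ?thesis by (auto simp: corner_edge_def)
qed

lemma graph_iso_pgraphI:
  assumes P: "pair_set P" and P': "pair_set P'" and f: "bij_betw (map_prod s s) P P'"
    and comm: "\<And>c p. c \<in> I \<Longrightarrow> p \<in> P \<Longrightarrow> map_prod s s (\<sigma> c p) = \<tau> c (map_prod s s p)"
    and sub: "M \<subseteq> I \<times> P" and M: "M' = apsnd (map_prod s s) ` M"
  shows "graph_iso s (pgraph I P \<sigma> M) (pgraph I P' \<tau> M')"
proof -
  interpret p: pair_set P by (rule P)
  interpret p': pair_set P' by (rule P')
  let ?f = "map_prod s s"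
  have inj: "inj_on ?f P" and im: "P' = ?f ` P" using f by (simp_all add: bij_betw_def)
  have fin: "?f p \<in> P'" if "p \<in> P" for p using that by (simp add: im)
  have ff: "fst (?f p) = s (fst p)" "snd (?f p) = s (snd p)" for p by simp_all
  \<comment> \<open>If two vertices have the same image, their pairs have images that meet and hence
    coincide, so both vertices lie in one pair; and the image of a pair has two distinct
    vertices.\<close>
  have inj_s: "inj_on s (pverts P)"
  proof (rule inj_onI)
    fix u v assume u: "u \<in> pverts P" and v: "v \<in> pverts P" and eq: "s u = s v"
    obtain p where p: "p \<in> P" "u = fst p \<or> u = snd p" using u by blast
    obtain r where r: "r \<in> P" "v = fst r \<or> v = snd r" using v by blast
    have "?f p = ?f r"
      by (rule p'.common_vertex[OF fin[OF p(1)] fin[OF r(1)], of "s u"])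
        (use p(2) r(2) eq in \<open>auto simp: ff\<close>)
    then have "p = r" using inj_on_eq_iff[OF inj p(1) r(1)] by simp
    moreover have "s (fst p) \<noteq> s (snd p)" using p'.fst_neq_snd[OF fin[OF p(1)] fin[OF p(1)]] by simp
    ultimately show "u = v" using p r eq by metis
  qed
  have "I \<times> P' - M' = apsnd ?f ` (I \<times> P - M)"
  proof -
    have "inj_on (apsnd ?f) (I \<times> P)" using inj by (rule inj_on_apsnd)
    then have "apsnd ?f ` (I \<times> P - M) = apsnd ?f ` (I \<times> P) - apsnd ?f ` M"
      using sub by (intro inj_on_image_set_diff) auto
    moreover have "apsnd ?f ` (I \<times> P) = I \<times> P'" unfolding im by (force simp: image_iff)
    ultimately show ?thesis by (simp add: M)
  qed
  then have "corner_edge \<tau> ` (I \<times> P' - M') = (\<lambda>x. corner_edge \<tau> (apsnd ?f x)) ` (I \<times> P - M)"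
    by (simp add: image_image)
  also have "\<dots> = (\<lambda>x. (\<lambda>(c, b, w). (c, s b, s w)) (corner_edge \<sigma> x)) ` (I \<times> P - M)"
  proof (rule image_cong[OF refl])
    fix x assume "x \<in> I \<times> P - M"
    then obtain c p where x: "x = (c, p)" "c \<in> I" "p \<in> P" by blast
    show "corner_edge \<tau> (apsnd ?f x) = (\<lambda>(c, b, w). (c, s b, s w)) (corner_edge \<sigma> x)"
      using corner_edge_map[of s \<sigma> c p \<tau>, OF comm[OF x(2,3)]] by (simp add: x(1))
  qed
  finally show ?thesis
    using inj_s by (simp add: graph_iso_def gedges_pgraph image_image im)
qed

text \<open>A graph isomorphism need not send pairs to pairs, so \<open>im\<close> demands it. The
  image of the edge from the black vertex of \<open>p\<close> to the white vertex of
  \<open>\<sigma> c p\<close> then determines the value of \<open>\<tau> c\<close>.\<close>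

lemma graph_iso_pgraphD:
  assumes P: "pair_system I P \<sigma> {}" and P': "pair_system I P' \<tau> {}" and I: "0 \<notin> I"
    and iso: "graph_iso s (pgraph I P \<sigma> {}) (pgraph I P' \<tau> {})" and im: "map_prod s s ` P = P'"
  shows "bij_betw (map_prod s s) P P'"
    "\<And>c p. c \<in> I \<Longrightarrow> p \<in> P \<Longrightarrow> map_prod s s (\<sigma> c p) = \<tau> c (map_prod s s p)"
proof -
  interpret p: pair_system I P \<sigma> "{}" by (rule P)
  interpret p': pair_system I P' \<tau> "{}" by (rule P')
  let ?f = "map_prod s s"
  have inj: "inj_on s (pverts P)" using iso by (simp add: graph_iso_def)
  have "inj_on ?f P"
  proof (rule inj_onI)
    fix p r assume p: "p \<in> P" "r \<in> P" "?f p = ?f r"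
    then have "s (fst p) = s (fst r)" by (metis fst_map_prod)
    then have "fst p = fst r" using inj p by (auto dest: inj_onD)
    then show "p = r" using p.fst_eq p by blast
  qed
  then show "bij_betw ?f P P'" using im by (simp add: bij_betw_def)
  fix c p assume c: "c \<in> I" "p \<in> P"
  have c0: "c \<noteq> 0" using c(1) I by metis
  have "(c, fst p, snd (\<sigma> c p)) \<in> gedges (pgraph I P \<sigma> {})"
    using c unfolding p.mem_gedges[OF c0] by blast
  then have "(\<lambda>(c, b, w). (c, s b, s w)) (c, fst p, snd (\<sigma> c p)) \<in> gedges (pgraph I P' \<tau> {})"
    using iso unfolding graph_iso_def by blast
  then obtain p' where p': "p' \<in> P'" "s (fst p) = fst p'" "s (snd (\<sigma> c p)) = snd (\<tau> c p')"
    by (auto simp: p'.mem_gedges[OF c0])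
  have "?f p = p'" using p'.fst_eq[of "?f p" p'] im c p' by auto
  moreover have "?f (\<sigma> c p) = \<tau> c p'"
    using p'.snd_eq[of "?f (\<sigma> c p)" "\<tau> c p'"] im p.closed[OF c] p'.closed[OF c(1) p'(1)] p'(3) by auto
  ultimately show "?f (\<sigma> c p) = \<tau> c (?f p)" by simp
qed

text \<open>Pairs are disjoint, so the images of both vertices can be prescribed independently on
  every pair. This splits a map of white vertices of a stacked map into a map of graph
  vertices.\<close>

lemma (in pair_set) vertex_map_exists:
  obtains s where "\<And>p. p \<in> P \<Longrightarrow> map_prod s s p = f p"
proof -
  define s where "s v = (if v \<in> fst ` P then fst (f (inv_into P fst v)) else snd (f (inv_into P snd v)))" for v
  have inj: "inj_on fst P" "inj_on snd P" by (auto intro!: inj_onI dest: fst_eq snd_eq)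
  have "map_prod s s p = f p" if "p \<in> P" for p
    using that snd_not_in[of P p] inj by (intro prod_eqI) (simp_all add: s_def)
  then show thesis by (rule that)
qed

subsection \<open>Closing chains to cycles\<close>

text \<open>The partial injection decomposes \<open>P\<close> into cycles and chains. The end of a
  chain lies outside \<open>A\<close> and is sent to the start of its chain, so a cycle of the
  resulting permutation contains at most one added step.\<close>

lemma close_chains:
  assumes fin: "finite P" and A: "A \<subseteq> P" and inj: "inj_on \<tau> A" and \<tau>: "\<tau> ` A \<subseteq> P"
  obtains \<sigma> where "bij_betw \<sigma> P P" "\<And>x. x \<in> A \<Longrightarrow> \<sigma> x = \<tau> x"
    "\<And>x y. x \<in> P - A \<Longrightarrow> y \<in> P - A \<Longrightarrow> y \<in> orbit \<sigma> x \<Longrightarrow> y = x"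
proof -
  define R where "R = {(x, \<tau> x) | x. x \<in> A}"
  have sv: "single_valued R" by (auto simp: R_def single_valued_def)
  \<comment> \<open>Following \<open>\<tau>\<close> is deterministic, so of two points reached from
    \<open>s\<close> one is reached from the other; outside \<open>A\<close> there is nowhere to
    go.\<close>
  have ends: "x = y" if "(s, x) \<in> R\<^sup>*" "(s, y) \<in> R\<^sup>*" "x \<notin> A" "y \<notin> A" for s x y
  proof -
    have "(x, y) \<in> R\<^sup>* \<or> (y, x) \<in> R\<^sup>*" using single_valued_confluent[OF sv that(1,2)] .
    then show ?thesis using that(3,4) by (auto simp: R_def elim: converse_rtranclE)
  qed
  \<comment> \<open>Without a start, the set \<open>Y\<close> of points leading to \<open>x\<close>
    would be covered by the image of \<open>Y \<inter> A\<close>, which is strictly smaller because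
    \<open>x\<close> itself is in \<open>Y\<close> but not in \<open>A\<close>.\<close>
  have "\<exists>s\<in>P - \<tau> ` A. (s, x) \<in> R\<^sup>*" if x: "x \<in> P - A" for x
  proof (rule ccontr)
    assume contr: "\<not> (\<exists>s\<in>P - \<tau> ` A. (s, x) \<in> R\<^sup>*)"
    define Y where "Y = {y \<in> P. (y, x) \<in> R\<^sup>*}"
    have finY: "finite Y" using fin by (simp add: Y_def)
    have "Y \<subseteq> \<tau> ` (Y \<inter> A)"
    proof
      fix y assume y: "y \<in> Y"
      then obtain z where z: "z \<in> A" "y = \<tau> z" using contr by (auto simp: Y_def)
      then have "(z, y) \<in> R" by (auto simp: R_def)
      then have "z \<in> Y" using y z A by (auto simp: Y_def intro: converse_rtrancl_into_rtrancl)
      then show "y \<in> \<tau> ` (Y \<inter> A)" using z by blast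
    qed
    then have "card Y \<le> card (\<tau> ` (Y \<inter> A))" using finY by (intro card_mono) auto
    also have "\<dots> \<le> card (Y \<inter> A)" using finY by (intro card_image_le) auto
    also have "\<dots> < card Y"
      using finY x by (intro psubset_card_mono) (auto simp: Y_def)
    finally show False by simp
  qed
  then obtain s where s: "\<And>x. x \<in> P - A \<Longrightarrow> s x \<in> P - \<tau> ` A \<and> (s x, x) \<in> R\<^sup>*" by metis
  define \<sigma> where "\<sigma> x = (if x \<in> A then \<tau> x else s x)" for x
  have "inj_on \<sigma> P"
  proof (rule inj_onI)
    fix x y assume xy: "x \<in> P" "y \<in> P" "\<sigma> x = \<sigma> y"
    consider "x \<in> A" "y \<in> A" | "x \<in> A" "y \<notin> A" | "x \<notin> A" "y \<in> A" | "x \<notin> A" "y \<notin> A" by blast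
    then show "x = y"
    proof cases
      case 1
      then show ?thesis using xy inj by (simp add: \<sigma>_def inj_on_eq_iff)
    next
      case 2
      then show ?thesis using xy s[of y] by (simp add: \<sigma>_def) (metis imageI)
    next
      case 3
      then show ?thesis using xy s[of x] by (simp add: \<sigma>_def)
    next
      case 4
      then show ?thesis using xy s[of x] s[of y] ends[of "s x" x y] by (simp add: \<sigma>_def)
    qed
  qed
  moreover have "\<sigma> ` P \<subseteq> P" using \<tau> s by (auto simp: \<sigma>_def)
  ultimately have "bij_betw \<sigma> P P" using fin by (simp add: bij_betw_def endo_inj_surj)
  moreover have "y = x" if x: "x \<in> P - A" and y: "y \<in> P - A" "y \<in> orbit \<sigma> x" for x y
  proof -
    \<comment> \<open>The orbit never leaves the chain of \<open>x\<close>: the only added step it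
      can take is the one at \<open>x\<close>, back to the start.\<close>
    have "(s x, z) \<in> R\<^sup>*" if "z \<in> orbit \<sigma> x" for z
      using that
    proof induction
      case base
      then show ?case using x by (simp add: \<sigma>_def)
    next
      case (step z)
      show ?case
      proof (cases "z \<in> A")
        case True
        then have "(z, \<sigma> z) \<in> R" by (auto simp: R_def \<sigma>_def)
        then show ?thesis using step by simp
      next
        case False
        then have "z = x" using ends[OF step(2), of x] s[OF x] x by blast
        then show ?thesis using x by (simp add: \<sigma>_def)
      qed
    qed
    then show ?thesis using ends[of "s x" y x] y x s[OF x] by blast
  qed
  ultimately show thesis using that[of \<sigma>] by (simp add: \<sigma>_def)
qed

text \<open>Only the existence of a suitable closing is claimed here. \<open>GG_structure\<close>
  shows that it agrees on \<open>P\<close> with the permutations and marks that \<open>Psi0\<close>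
  reads off the completed graph.\<close>

lemma graph_eq_pgraph:
  assumes G: "coloured_graph {0..D} G" and P: "pairing G P"
    and reg: "\<And>v c. v \<in> gverts G \<Longrightarrow> c \<in> {1..D} \<Longrightarrow> has_edge G c v"
  obtains \<sigma> M where "pair_system {0..D} P \<sigma> M" "G = pgraph {0..D} P \<sigma> M"
proof -
  have disj: "blacks G \<inter> gwhites G = {}" and fin: "finite (gverts G)"
    and sub: "gedges G \<subseteq> {0..D} \<times> blacks G \<times> gwhites G"
    and det1: "\<And>c b w w'. (c, b, w) \<in> gedges G \<Longrightarrow> (c, b, w') \<in> gedges G \<Longrightarrow> w = w'"
    and det2: "\<And>c b b' w. (c, b, w) \<in> gedges G \<Longrightarrow> (c, b', w) \<in> gedges G \<Longrightarrow> b = b'"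
    using G unfolding coloured_graph_def by blast+
  let ?G = "gdelete0 G"
  define r where "r = pair_perm ?G P"
  have "coloured_graph {1..D} ?G"
    unfolding coloured_graph_def
  proof (intro conjI subsetI)
    fix e assume "e \<in> gedges ?G"
    then have "e \<in> gedges G" "fst e \<noteq> 0" by (auto simp: gdelete0_def)
    then show "e \<in> {1..D} \<times> blacks ?G \<times> gwhites ?G" using sub by fastforce
  qed (use fin disj det1 det2 in \<open>simp_all add: gedges_gdelete0, blast+\<close>)
  moreover have "pairing ?G P" using P by (simp add: pairing_def)
  moreover have "has_edge ?G c v" if "v \<in> gverts ?G" "c \<in> {1..D}" for v c
    using reg[of v c] that by (simp add: has_edge_def gedges_gdelete0)
  ultimately have r: "pair_system {1..D} P r {}" "?G = pgraph {1..D} P r {}"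
    using regular_graph_eq_pgraph[of "{1..D}" ?G P] unfolding r_def by simp_all
  interpret r: pair_system "{1..D}" P r "{}" by (rule r(1))
  note bl = pairing_blacks[OF P disj] and wh = pairing_whites[OF P disj]
  \<comment> \<open>These pairs have a colour 0 edge at their white vertex, so \<open>\<tau>\<close>
    below is defined on them; all other pairs become marks.\<close>
  define A where "A = {p \<in> P. \<exists>b. (0, b, snd p) \<in> gedges G}"
  have "\<exists>p'. p' \<in> P \<and> (0, fst p', snd p) \<in> gedges G" if pA: "p \<in> A" for p
  proof -
    obtain b where e: "(0, b, snd p) \<in> gedges G" using pA unfolding A_def by blast
    then have "b \<in> fst ` P" using sub bl by blast
    then show ?thesis using e by blast
  qed
  then obtain \<tau> where t: "\<And>p. p \<in> A \<Longrightarrow> \<tau> p \<in> P \<and> (0, fst (\<tau> p), snd p) \<in> gedges G" by metis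
  have "inj_on \<tau> A"
  proof (rule inj_onI)
    fix p p' assume p: "p \<in> A" "p' \<in> A" "\<tau> p = \<tau> p'"
    then have "snd p = snd p'" using t det1 by metis
    then show "p = p'" using r.snd_eq p unfolding A_def by blast
  qed
  then obtain \<sigma>0 where s0: "bij_betw \<sigma>0 P P" "\<And>x. x \<in> A \<Longrightarrow> \<sigma>0 x = \<tau> x"
      "\<And>x y. x \<in> P - A \<Longrightarrow> y \<in> P - A \<Longrightarrow> y \<in> orbit \<sigma>0 x \<Longrightarrow> y = x"
    using close_chains[of P A \<tau>] r.finite_P t unfolding A_def by blast
  define \<sigma> where "\<sigma> c = (if c = 0 then \<sigma>0 else r c)" for c :: nat
  define M where "M = {0 :: nat} \<times> (P - A)"
  have sys: "pair_system {0..D} P \<sigma> M"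
  proof
    show "bij_betw (\<sigma> c) P P" if "c \<in> {0..D}" for c
      using s0(1) r.bij[of c] that by (cases "c = 0") (simp_all add: \<sigma>_def)
    fix p p' assume "(0, p) \<in> M" "(0, p') \<in> M" "p' \<in> orbit (\<sigma> 0) p"
    then show "p' = p" using s0(3)[of p p'] by (simp add: M_def \<sigma>_def)
  qed (use r.finite_P in \<open>auto simp: M_def\<close>)
  interpret s: pair_system "{0..D}" P \<sigma> M by (rule sys)
  have "(c, b, w) \<in> gedges G \<longleftrightarrow> (c, b, w) \<in> gedges (pgraph {0..D} P \<sigma> M)" for c b w
  proof (cases "c = 0")
    case True
    show ?thesis
    proof
      assume e: "(c, b, w) \<in> gedges G"
      then obtain p where p: "p \<in> P" "w = snd p" using sub wh by blast
      then have "p \<in> A" using e True unfolding A_def by blast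
      then have "b = fst (\<tau> p)" "\<sigma> 0 p = \<tau> p" using t det2 e True p s0(2) by (auto simp: \<sigma>_def)
      then show "(c, b, w) \<in> gedges (pgraph {0..D} P \<sigma> M)"
        unfolding True s.mem_gedges0 using p \<open>p \<in> A\<close> by (intro conjI bexI[of _ p]) (auto simp: M_def)
    next
      assume "(c, b, w) \<in> gedges (pgraph {0..D} P \<sigma> M)"
      then obtain p where p: "p \<in> P" "(0, p) \<notin> M" "b = fst (\<sigma> 0 p)" "w = snd p"
        unfolding True s.mem_gedges0 by blast
      then have "p \<in> A" by (simp add: M_def)
      then show "(c, b, w) \<in> gedges G" using t[of p] s0(2) p True by (simp add: \<sigma>_def)
    qed
  next
    case False
    have "(c, b, w) \<in> gedges G \<longleftrightarrow> (c, b, w) \<in> gedges ?G"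
      using False by (simp add: gedges_gdelete0)
    also have "\<dots> \<longleftrightarrow> c \<in> {1..D} \<and> (\<exists>p\<in>P. b = fst p \<and> w = snd (r c p))"
      unfolding r(2) by (rule r.mem_gedges[OF False])
    also have "\<dots> \<longleftrightarrow> (c, b, w) \<in> gedges (pgraph {0..D} P \<sigma> M)"
      unfolding s.mem_gedges[OF False] using False by (simp add: \<sigma>_def Suc_le_eq)
    finally show ?thesis .
  qed
  then have "gedges G = gedges (pgraph {0..D} P \<sigma> M)" by auto
  then have "G = pgraph {0..D} P \<sigma> M" using bl wh by (intro bgraph.equality) simp_all
  then show thesis using that sys by blast
qed

subsection \<open>Correspondence of the two structures\<close>

definition pair_label :: "('v \<Rightarrow> 'b bgraph \<times> 'b) \<Rightarrow> 'v \<times> 'v \<Rightarrow> 'b bgraph \<times> 'b \<times> 'b" where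
  "pair_label \<iota> = (\<lambda>(b, w). (fst (\<iota> b), snd (\<iota> b), snd (\<iota> w)))"

lemma fst_pair_label [simp]: "fst (pair_label \<iota> p) = fst (\<iota> (fst p))"
  by (simp add: pair_label_def case_prod_beta)

lemma snd_pair_label: "snd \<circ> pair_label \<iota> = map_prod (snd \<circ> \<iota>) (snd \<circ> \<iota>)"
  by (auto simp: pair_label_def)

lemma Psi0_eq:
  "Psi0 D \<Omega> (G, \<iota>) = (Psi0_map D G (global_pairing \<Omega> G \<iota>), pair_label \<iota>)"
  by (simp add: Psi0_def pair_label_def)

text \<open>The maps on edges and coloured vertices are determined by the one on white vertices, so
  being a copy is a condition on the labels alone.\<close>

lemma submap_copy_cycle_map:
  assumes "perm_system {1..D} Q \<sigma> {}"
  shows "submap_copy D \<Omega> \<kappa> B (cycle_map {1..D} Q \<sigma> {}) \<longleftrightarrow>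
    (\<forall>p\<in>Q. fst (\<kappa> p) = B) \<and> bij_betw (snd \<circ> \<kappa>) Q (\<Omega> B) \<and>
    (\<forall>c\<in>{1..D}. \<forall>p\<in>Q. (snd \<circ> \<kappa>) (\<sigma> c p) = pair_perm B (\<Omega> B) c ((snd \<circ> \<kappa>) p))"
    (is "?L \<longleftrightarrow> ?R")
proof -
  interpret perm_system "{1..D}" Q \<sigma> "{}" by (rule assms)
  have w: "whites (cycle_map {1..D} Q \<sigma> {}) = Q" by (simp add: cycle_map_def)
  show ?thesis
  proof
    assume ?L
    then obtain h g where "smap_iso (snd \<circ> \<kappa>) h g (cycle_map {1..D} Q \<sigma> {}) (Psi D B (\<Omega> B))"
        "\<forall>p\<in>Q. fst (\<kappa> p) = B"
      unfolding submap_copy_def w by blast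
    then show ?R unfolding Psi_def using smap_iso_cycle_mapD(1,2) by blast
  next
    assume R: ?R
    have "smap_iso (snd \<circ> \<kappa>) (apsnd (snd \<circ> \<kappa>)) (apsnd (image (snd \<circ> \<kappa>)))
        (cycle_map {1..D} Q \<sigma> {}) (Psi D B (\<Omega> B))"
      unfolding Psi_def by (rule smap_iso_cycle_mapI) (use R in blast, use R in blast, simp)
    then show ?L using R unfolding submap_copy_def w by blast
  qed
qed

lemma bubble_submaps_cycle_map:
  assumes "perm_system {0..D} P \<sigma> M"
  shows "bubble_submaps (cycle_map {0..D} P \<sigma> M) =
    (\<lambda>Q. cycle_map {1..D} Q \<sigma> {}) ` step_classes {1..D} P \<sigma>"
proof -
  interpret perm_system "{0..D}" P \<sigma> M by (rule assms)
  interpret r: perm_system "{1..D}" P \<sigma> "{}" by (rule restrict_colours) auto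
  have "{0..D} \<inter> - {0} = {1..D}" "{e \<in> M. fst e \<in> - {0}} = {}"
    using marks_colour by auto
  then have "keep_colours (- {0}) (cycle_map {0..D} P \<sigma> M) = cycle_map {1..D} P \<sigma> {}"
    by (simp only: keep_colours_cycle_map)
  then show ?thesis
    unfolding bubble_submaps_def using r.scomponents_cycle_map by simp
qed

lemma SS_cycle_map:
  assumes "perm_system {0..D} P \<sigma> M"
  shows "(cycle_map {0..D} P \<sigma> M, \<kappa>) \<in> SS D q \<BB> \<Omega> \<longleftrightarrow>
    P \<noteq> {} \<and> (\<forall>p\<in>P. \<forall>p'\<in>P. (p, p') \<in> (steps {0..D} P \<sigma>)\<^sup>*) \<and> card M = q \<and>
    (\<forall>Q\<in>step_classes {1..D} P \<sigma>. \<exists>B\<in>\<BB>. submap_copy D \<Omega> \<kappa> B (cycle_map {1..D} Q \<sigma> {}))"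
proof -
  interpret perm_system "{0..D}" P \<sigma> M by (rule assms)
  have "marked (cycle_map {0..D} P \<sigma> M) = M" by (simp add: cycle_map_def)
  then show ?thesis
    unfolding SS_def
    by (simp add: stacked_cycle_map sconnected_cycle_map bubble_submaps_cycle_map[OF assms] conj_assoc)
qed

section \<open>Copies of a model: bubbles against submaps\<close>

locale bubble_models =
  fixes D :: nat and \<BB> :: "'b bgraph set" and \<Omega> :: "'b bgraph \<Rightarrow> ('b \<times> 'b) set"
  assumes bubbles: "B \<in> \<BB> \<Longrightarrow> bubble D B" and pairings: "B \<in> \<BB> \<Longrightarrow> pairing B (\<Omega> B)"
begin

lemma model_pgraph:
  assumes "B \<in> \<BB>"
  shows "pair_system {1..D} (\<Omega> B) (pair_perm B (\<Omega> B)) {}"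
    "B = pgraph {1..D} (\<Omega> B) (pair_perm B (\<Omega> B)) {}"
  using bubbles[OF assms] pairings[OF assms]
  by (auto simp: bubble_def intro!: regular_graph_eq_pgraph)

lemma graph_iso_model:
  assumes B: "B \<in> \<BB>" and Q: "pair_set Q" and s: "bij_betw (map_prod s s) Q (\<Omega> B)"
    and comm: "\<And>c p. c \<in> {1..D} \<Longrightarrow> p \<in> Q \<Longrightarrow> map_prod s s (\<sigma> c p) = pair_perm B (\<Omega> B) c (map_prod s s p)"
  shows "graph_iso s (pgraph {1..D} Q \<sigma> {}) B"
proof -
  interpret b: pair_system "{1..D}" "\<Omega> B" "pair_perm B (\<Omega> B)" "{}" by (rule model_pgraph[OF B])
  have "graph_iso s (pgraph {1..D} Q \<sigma> {}) (pgraph {1..D} (\<Omega> B) (pair_perm B (\<Omega> B)) {})"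
    by (rule graph_iso_pgraphI[OF Q b.pair_set_axioms s]) (simp_all only: comm, simp_all)
  then show ?thesis using model_pgraph(2)[OF B] by simp
qed

text \<open>Here the isomorphism is unrelated to any labels. It is a map of pairs, which
  \<open>vertex_map_exists\<close> splits into a map of vertices.\<close>

lemma graph_iso_of_smap_iso:
  assumes B: "B \<in> \<BB>" and Q: "pair_system {1..D} Q \<sigma> {}"
    and iso: "smap_iso f h g (cycle_map {1..D} Q \<sigma> {}) (Psi D B (\<Omega> B))"
  shows "\<exists>s. graph_iso s (pgraph {1..D} Q \<sigma> {}) B"
proof -
  interpret q: pair_system "{1..D}" Q \<sigma> "{}" by (rule Q)
  note f = q.smap_iso_cycle_mapD[OF iso[unfolded Psi_def]]
  obtain s where s: "\<And>p. p \<in> Q \<Longrightarrow> map_prod s s p = f p" using q.vertex_map_exists by blast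
  have "bij_betw (map_prod s s) Q (\<Omega> B)"
    using f(1) by (rule bij_betw_cong[THEN iffD2, rotated]) (rule s)
  then have "graph_iso s (pgraph {1..D} Q \<sigma> {}) B"
    by (rule graph_iso_model[OF B q.pair_set_axioms]) (simp only: s q.closed f(2))
  then show ?thesis by blast
qed

text \<open>\<open>pair_label\<close> takes the model from the black vertex only; the assumption
  \<open>lab\<close> carries it over to the white one.\<close>

lemma bubble_copyI:
  assumes B: "B \<in> \<BB>" and Q: "pair_system {1..D} Q \<sigma> {}"
    and lab: "\<And>p. p \<in> Q \<Longrightarrow> fst (\<iota> (snd p)) = fst (\<iota> (fst p))"
    and cp: "submap_copy D \<Omega> (pair_label \<iota>) B (cycle_map {1..D} Q \<sigma> {})"
  shows "bubble_copy \<iota> B (pgraph {1..D} Q \<sigma> {})"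
proof -
  interpret q: pair_system "{1..D}" Q \<sigma> "{}" by (rule Q)
  have c: "\<forall>p\<in>Q. fst (\<iota> (fst p)) = B" "bij_betw (map_prod (snd \<circ> \<iota>) (snd \<circ> \<iota>)) Q (\<Omega> B)"
    "\<forall>c\<in>{1..D}. \<forall>p\<in>Q. map_prod (snd \<circ> \<iota>) (snd \<circ> \<iota>) (\<sigma> c p) =
      pair_perm B (\<Omega> B) c (map_prod (snd \<circ> \<iota>) (snd \<circ> \<iota>) p)"
    using cp unfolding submap_copy_cycle_map[OF q.perm_system_axioms] snd_pair_label fst_pair_label
    by blast+
  have "graph_iso (snd \<circ> \<iota>) (pgraph {1..D} Q \<sigma> {}) B"
    by (rule graph_iso_model[OF B q.pair_set_axioms c(2)]) (use c(3) in blast)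
  moreover have "\<forall>v\<in>pverts Q. fst (\<iota> v) = B" using c(1) lab by fastforce
  ultimately show ?thesis by (simp add: bubble_copy_def)
qed

lemma submap_copyI:
  assumes B: "B \<in> \<BB>" and Q: "pair_system {1..D} Q \<sigma> {}"
    and cp: "bubble_copy \<iota> B (pgraph {1..D} Q \<sigma> {})"
    and im: "map_prod (snd \<circ> \<iota>) (snd \<circ> \<iota>) ` Q = \<Omega> B"
  shows "submap_copy D \<Omega> (pair_label \<iota>) B (cycle_map {1..D} Q \<sigma> {})"
proof -
  interpret q: pair_system "{1..D}" Q \<sigma> "{}" by (rule Q)
  have iso: "graph_iso (snd \<circ> \<iota>) (pgraph {1..D} Q \<sigma> {}) (pgraph {1..D} (\<Omega> B) (pair_perm B (\<Omega> B)) {})"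
    using cp model_pgraph(2)[OF B] by (simp add: bubble_copy_def)
  note d = graph_iso_pgraphD[OF Q model_pgraph(1)[OF B] _ iso im]
  have "\<forall>p\<in>Q. fst (\<iota> (fst p)) = B" using cp unfolding bubble_copy_def pgraph_simps by blast
  then show ?thesis
    unfolding submap_copy_cycle_map[OF q.perm_system_axioms] snd_pair_label fst_pair_label
    using d by simp
qed

lemma Psi0_map_pgraph:
  assumes sys: "pair_system {0..D} P \<sigma> M"
  defines "G \<equiv> pgraph {0..D} P \<sigma> M"
  shows "Psi0_map D G P = cycle_map {0..D} P (pair_perm (complete_graph G P) P) M"
    and "c \<in> {0..D} \<Longrightarrow> p \<in> P \<Longrightarrow> pair_perm (complete_graph G P) P c p = \<sigma> c p"
proof -
  interpret pair_system "{0..D}" P \<sigma> M by (rule sys)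
  show "Psi0_map D G P = cycle_map {0..D} P (pair_perm (complete_graph G P) P) M"
    by (simp add: Psi0_map_def G_def edge_corner_marked_edges)
  show "c \<in> {0..D} \<Longrightarrow> p \<in> P \<Longrightarrow> pair_perm (complete_graph G P) P c p = \<sigma> c p"
    by (simp add: G_def complete_pgraph pair_perm_pgraph)
qed

text \<open>Computes \<open>Psi0\<close> of a graph from any permutations and marks presenting it.
  Outside \<open>P\<close> the permutations may differ from \<open>pair_perm\<close>, so the two
  maps are isomorphic by the identity but need not be equal.\<close>

lemma Psi0_pgraph:
  assumes sys: "pair_system {0..D} P \<sigma> M"
    and gp: "global_pairing \<Omega> (pgraph {0..D} P \<sigma> M) \<iota> = P"
  shows "ident_smap_iso (cycle_map {0..D} P \<sigma> M, pair_label \<iota>) (Psi0 D \<Omega> (pgraph {0..D} P \<sigma> M, \<iota>))"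
proof -
  interpret pair_system "{0..D}" P \<sigma> M by (rule sys)
  note m = Psi0_map_pgraph[OF sys]
  have "smap_iso id (apsnd id) (apsnd (image id)) (cycle_map {0..D} P \<sigma> M)
      (Psi0_map D (pgraph {0..D} P \<sigma> M) P)"
    unfolding m(1) by (rule smap_iso_cycle_mapI) (simp_all add: m(2) apsnd_def map_prod.id)
  then show ?thesis
    unfolding Psi0_eq gp ident_smap_iso_def prod.case by (metis id_apply)
qed

text \<open>Each class of pairs is a copy of a connected model, so its own graph is connected and
  its pairs are linked. Only with this knowledge can the bubbles of the rebuilt graph be computed as
  the graphs of the classes.\<close>

lemma GG_of_SS:
  assumes sys: "pair_system {0..D} P \<sigma> M"
    and lab: "\<And>p. p \<in> P \<Longrightarrow> fst (\<iota> (snd p)) = fst (\<iota> (fst p))"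
    and SS: "(cycle_map {0..D} P \<sigma> M, pair_label \<iota>) \<in> SS D q \<BB> \<Omega>"
  shows "(pgraph {0..D} P \<sigma> M, \<iota>) \<in> GG D q \<BB>" "global_pairing \<Omega> (pgraph {0..D} P \<sigma> M) \<iota> = P"
proof -
  interpret pair_system "{0..D}" P \<sigma> M by (rule sys)
  let ?G = "pgraph {0..D} P \<sigma> M" and ?K = "pgraph {1..D} P \<sigma> {}"
  have I: "{0..D} - {0} = {1..D}" by auto
  have del: "gdelete0 ?G = ?K" using gdelete0_pgraph by (simp only: I)
  interpret r: pair_system "{1..D}" P \<sigma> "{}" using without_colour_0 by (simp only: I)
  have ss: "P \<noteq> {}" "\<forall>p\<in>P. \<forall>p'\<in>P. (p, p') \<in> (steps {0..D} P \<sigma>)\<^sup>*" "card M = q"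
    and cps: "\<And>Q. Q \<in> step_classes {1..D} P \<sigma> \<Longrightarrow>
      \<exists>B\<in>\<BB>. submap_copy D \<Omega> (pair_label \<iota>) B (cycle_map {1..D} Q \<sigma> {})"
    using SS unfolding SS_cycle_map[OF perm_system_axioms] by blast+
  have Qsys: "pair_system {1..D} Q \<sigma> {}" if "Q \<in> step_classes {1..D} P \<sigma>" for Q
    using r.perm_system_class[OF that] pair_set_subset[OF r.step_class_sub[OF that]]
    by (rule pair_system.intro)
  have cpb: "\<exists>B\<in>\<BB>. submap_copy D \<Omega> (pair_label \<iota>) B (cycle_map {1..D} Q \<sigma> {}) \<and>
      bubble_copy \<iota> B (pgraph {1..D} Q \<sigma> {})" if Q: "Q \<in> step_classes {1..D} P \<sigma>" for Q
    using cps[OF Q] bubble_copyI[OF _ Qsys[OF Q]] lab r.step_class_sub[OF Q] by (meson subsetD)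
  \<comment> \<open>The vertices of \<open>p\<close> are joined inside the graph of the class of
    \<open>p\<close>, whose connectedness comes from the model, and that graph has only edges of the
    graph on \<open>P\<close>.\<close>
  have linked: "(fst p, snd p) \<in> (gadj ?K)\<^sup>*" if p: "p \<in> P" for p
  proof -
    let ?Q = "(steps {1..D} P \<sigma>)\<^sup>* `` {p}"
    note Q = r.step_class_of[OF p]
    interpret q: pair_system "{1..D}" ?Q \<sigma> "{}" by (rule Qsys[OF Q])
    obtain B where B: "B \<in> \<BB>" "bubble_copy \<iota> B (pgraph {1..D} ?Q \<sigma> {})" using cpb[OF Q] by blast
    then have "graph_iso (snd \<circ> \<iota>) (pgraph {1..D} ?Q \<sigma> {}) B" by (simp add: bubble_copy_def)
    from graph_iso_inv[OF this q.coloured_pgraph]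
    have "gconnected (pgraph {1..D} ?Q \<sigma> {})"
      by (rule gconnected_iso) (use bubbles[OF B(1)] in \<open>simp add: bubble_def\<close>)
    moreover have "p \<in> ?Q" by simp
    ultimately have "(fst p, snd p) \<in> (gadj (pgraph {1..D} ?Q \<sigma> {}))\<^sup>*"
      unfolding gconnected_def pgraph_simps by blast
    moreover have "gedges (pgraph {1..D} ?Q \<sigma> {}) \<subseteq> gedges ?K"
      using r.step_class_sub[OF Q] unfolding gedges_pgraph by blast
    then have "gadj (pgraph {1..D} ?Q \<sigma> {}) \<subseteq> gadj ?K" unfolding gadj_def by blast
    ultimately show ?thesis using rtrancl_mono by blast
  qed
  interpret r: linked_pair_system "{1..D}" P \<sigma> "{}"
    by unfold_locales (rule linked)
  have "gedges ?K \<subseteq> gedges ?G" unfolding del[symmetric] gedges_gdelete0_eq by blast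
  then have "gadj ?K \<subseteq> gadj ?G" unfolding gadj_def by blast
  then interpret linked_pair_system "{0..D}" P \<sigma> M
    by unfold_locales (use linked rtrancl_mono in blast)
  have bub: "bubbles ?G = (\<lambda>Q. pgraph {1..D} Q \<sigma> {}) ` step_classes {1..D} P \<sigma>"
    unfolding bubbles_def del by (rule r.gcomponents_pgraph)
  have 0: "0 \<in> {0..D}" by simp
  have he: "\<forall>v\<in>gverts ?G. \<forall>c\<in>{1..D}. has_edge ?G c v"
    by (intro ballI has_edge_pgraph) auto
  have con: "gconnected ?G" using ss gconnected_pgraph by blast
  have bc: "\<forall>C\<in>bubbles ?G. \<exists>B\<in>\<BB>. bubble_copy \<iota> B C" unfolding bub using cpb by blast
  show "(?G, \<iota>) \<in> GG D q \<BB>"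
    using coloured_pgraph con he card_unmatched[OF 0] ss(3) bc unfolding GG_def by blast
  show "global_pairing \<Omega> ?G \<iota> = P"
  proof (intro equalityI subsetI)
    fix \<omega> assume w: "\<omega> \<in> global_pairing \<Omega> ?G \<iota>"
    obtain C where C: "C \<in> bubbles ?G" "fst \<omega> \<in> blacks C" "snd \<omega> \<in> gwhites C"
      and om: "(snd (\<iota> (fst \<omega>)), snd (\<iota> (snd \<omega>))) \<in> \<Omega> (fst (\<iota> (fst \<omega>)))"
      using w unfolding global_pairing_def by auto
    obtain Q where Q: "Q \<in> step_classes {1..D} P \<sigma>" "C = pgraph {1..D} Q \<sigma> {}"
      using C(1) unfolding bub by blast
    obtain B where B: "B \<in> \<BB>" "submap_copy D \<Omega> (pair_label \<iota>) B (cycle_map {1..D} Q \<sigma> {})"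
        "bubble_copy \<iota> B (pgraph {1..D} Q \<sigma> {})"
      using cpb[OF Q(1)] by blast
    interpret b: pair_system "{1..D}" "\<Omega> B" "pair_perm B (\<Omega> B)" "{}" by (rule model_pgraph[OF B(1)])
    \<comment> \<open>The labels of \<open>\<omega>\<close> form a pair of the model that shares its
      black vertex with the image of \<open>p\<close> and its white vertex with the image of
      \<open>r\<close>. Pairs of the model are disjoint, so both images equal it and
      \<open>p = r\<close>.\<close>
    obtain p r where p: "p \<in> Q" "fst \<omega> = fst p" "r \<in> Q" "snd \<omega> = snd r" using C Q(2) by auto
    let ?f = "map_prod (snd \<circ> \<iota>) (snd \<circ> \<iota>)"
    have f: "bij_betw ?f Q (\<Omega> B)" "\<forall>p\<in>Q. fst (\<iota> (fst p)) = B"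
      using B(2) unfolding submap_copy_cycle_map[OF r.perm_system_class[OF Q(1)]] snd_pair_label
      by simp_all
    have fp: "?f p \<in> \<Omega> B" "?f r \<in> \<Omega> B" using f(1) p bij_betwE by blast+
    have o: "(snd (\<iota> (fst p)), snd (\<iota> (snd r))) \<in> \<Omega> B" using om p f(2) by simp
    have "?f p = (snd (\<iota> (fst p)), snd (\<iota> (snd r)))" by (rule b.fst_eq[OF fp(1) o]) simp
    moreover have "?f r = (snd (\<iota> (fst p)), snd (\<iota> (snd r)))" by (rule b.snd_eq[OF fp(2) o]) simp
    ultimately have "p = r" using f(1) p by (metis bij_betw_imp_inj_on inj_onD)
    then have "\<omega> = p" using p by (simp add: prod_eq_iff)
    then show "\<omega> \<in> P" using p(1) r.step_class_sub[OF Q(1)] by blast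
  next
    fix p assume p: "p \<in> P"
    let ?Q = "(steps {1..D} P \<sigma>)\<^sup>* `` {p}"
    note Q = r.step_class_of[OF p]
    obtain B where B: "B \<in> \<BB>" "submap_copy D \<Omega> (pair_label \<iota>) B (cycle_map {1..D} ?Q \<sigma> {})"
      using cpb[OF Q] by blast
    have "p \<in> ?Q" by simp
    then have "(snd \<circ> pair_label \<iota>) p \<in> \<Omega> B" "fst (\<iota> (fst p)) = B"
      using B(2) unfolding submap_copy_cycle_map[OF r.perm_system_class[OF Q]] fst_pair_label
      using bij_betwE by blast+
    then have "(snd (\<iota> (fst p)), snd (\<iota> (snd p))) \<in> \<Omega> (fst (\<iota> (fst p)))"
      by (simp add: pair_label_def case_prod_beta)
    moreover have "fst p \<in> blacks ?G" "snd p \<in> gwhites ?G" using p by simp_all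
    ultimately show "p \<in> global_pairing \<Omega> ?G \<iota>"
      unfolding global_pairing_eq del mem_Collect_eq case_prod_beta using r.linked[OF p] by blast
  qed
qed

section \<open>Graphs with identified bubbles as pair systems\<close>

text \<open>On the bubble of \<open>v\<close> the labels give an isomorphism onto a model. The
  unique pair of the model at the label of \<open>v\<close> lifts to a pair at \<open>v\<close>, and
  it is the only one because a pair of \<open>P\<close> never leaves its bubble.\<close>

lemma GG_pairing:
  assumes G: "(G, \<iota>) \<in> GG D q \<BB>"
  defines "P \<equiv> global_pairing \<Omega> G \<iota>"
  shows "pairing G P"
    and "\<And>u v. u \<in> gverts G \<Longrightarrow> v \<in> gverts G \<Longrightarrow> (u, v) \<in> (gadj (gdelete0 G))\<^sup>* \<Longrightarrow> fst (\<iota> u) = fst (\<iota> v)"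
proof -
  let ?R = "(gadj (gdelete0 G))\<^sup>*"
  let ?s = "snd \<circ> \<iota>"
  have cop: "\<exists>B\<in>\<BB>. (\<forall>u\<in>gverts G. (v, u) \<in> ?R \<longrightarrow> fst (\<iota> u) = B) \<and>
      graph_iso ?s (ginduced (gdelete0 G) (?R `` {v})) B" if v: "v \<in> gverts G" for v
  proof -
    let ?C = "ginduced (gdelete0 G) (?R `` {v})"
    have "?R `` {v} \<in> gverts G // ?R" using v by (rule quotientI)
    then have "?C \<in> bubbles G" by (simp add: bubbles_def gcomponents_def)
    then obtain B where "B \<in> \<BB>" "bubble_copy \<iota> B ?C" using G unfolding GG_def by blast
    moreover have "u \<in> gverts ?C" if "u \<in> gverts G" "(v, u) \<in> ?R" for u
      using that by (auto simp: gverts_def)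
    ultimately show ?thesis unfolding bubble_copy_def by blast
  qed
  show same: "fst (\<iota> u) = fst (\<iota> v)" if uv: "u \<in> gverts G" "v \<in> gverts G" "(u, v) \<in> ?R" for u v
    using cop[OF uv(1)] uv by auto
  have P_mem: "p \<in> P \<longleftrightarrow> fst p \<in> blacks G \<and> snd p \<in> gwhites G \<and> (fst p, snd p) \<in> ?R \<and>
      map_prod ?s ?s p \<in> \<Omega> (fst (\<iota> (fst p)))" for p
    unfolding P_def global_pairing_eq by (simp add: case_prod_beta map_prod_def)
  have "\<exists>!p. p \<in> P \<and> v \<in> {fst p, snd p}" if v: "v \<in> gverts G" for v
  proof -
    let ?C = "ginduced (gdelete0 G) (?R `` {v})"
    obtain B where B: "B \<in> \<BB>" "\<forall>u\<in>gverts G. (v, u) \<in> ?R \<longrightarrow> fst (\<iota> u) = B" "graph_iso ?s ?C B"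
      using cop[OF v] by blast
    have C: "blacks ?C = blacks G \<inter> ?R `` {v}" "gwhites ?C = gwhites G \<inter> ?R `` {v}"
      "gverts ?C = gverts G \<inter> ?R `` {v}"
      by (auto simp: gverts_def)
    have bw: "blacks B = ?s ` (blacks G \<inter> ?R `` {v})" "gwhites B = ?s ` (gwhites G \<inter> ?R `` {v})"
      and inj: "inj_on ?s (gverts G \<inter> ?R `` {v})"
      using B(3) unfolding graph_iso_def C by blast+
    have "?s v \<in> gverts B" using v graph_iso_gverts[OF B(3)] C by blast
    then have ex1: "\<exists>!\<omega>. \<omega> \<in> \<Omega> B \<and> ?s v \<in> {fst \<omega>, snd \<omega>}" and sub: "\<Omega> B \<subseteq> blacks B \<times> gwhites B"
      using pairings[OF B(1)] unfolding pairing_def by blast+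
    then obtain \<omega> where w: "\<omega> \<in> \<Omega> B" "?s v \<in> {fst \<omega>, snd \<omega>}" by blast
    have "fst \<omega> \<in> blacks B" "snd \<omega> \<in> gwhites B" using subsetD[OF sub w(1)] by (simp_all add: mem_Times_iff)
    then obtain b x where b: "b \<in> blacks G" "(v, b) \<in> ?R" "fst \<omega> = ?s b"
      and x: "x \<in> gwhites G" "(v, x) \<in> ?R" "snd \<omega> = ?s x"
      unfolding bw by blast
    have vv: "v \<in> gverts G \<inter> ?R `` {v}" "b \<in> gverts G \<inter> ?R `` {v}" "x \<in> gverts G \<inter> ?R `` {v}"
      using v b x by (auto simp: gverts_def)
    have mp: "map_prod ?s ?s (b, x) = \<omega>" using b x by (simp add: prod_eq_iff)
    have "(b, x) \<in> ?R" using gadj_rtrancl_sym[OF b(2)] x(2) by (rule rtrancl_trans)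
    moreover have "fst (\<iota> b) = B" using B(2) vv by blast
    ultimately have bP: "(b, x) \<in> P" unfolding P_mem using b x mp w by simp
    have "v = b \<or> v = x"
      using w(2) b(3) x(3) inj_on_eq_iff[OF inj vv(1,2)] inj_on_eq_iff[OF inj vv(1,3)] by auto
    then have "(b, x) \<in> P \<and> v \<in> {fst (b, x), snd (b, x)}" using bP by simp
    moreover have "p = (b, x)" if "p \<in> P \<and> v \<in> {fst p, snd p}" for p
    proof -
      have p: "fst p \<in> blacks G" "snd p \<in> gwhites G" "(fst p, snd p) \<in> ?R"
        "map_prod ?s ?s p \<in> \<Omega> (fst (\<iota> (fst p)))" "v = fst p \<or> v = snd p"
        using that P_mem by auto
      have "(v, fst p) \<in> ?R" "(v, snd p) \<in> ?R"
        using p(3,5) gadj_rtrancl_sym[OF p(3)] by auto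
      then have pv: "fst p \<in> gverts G \<inter> ?R `` {v}" "snd p \<in> gverts G \<inter> ?R `` {v}"
        using p by (auto simp: gverts_def)
      then have "fst (\<iota> (fst p)) = B" using B(2) by blast
      then have "map_prod ?s ?s p \<in> \<Omega> B" using p(4) by simp
      moreover have "?s v \<in> {fst (map_prod ?s ?s p), snd (map_prod ?s ?s p)}" using p(5) by auto
      ultimately have "map_prod ?s ?s p = \<omega>" using ex1 w by blast
      then have "?s (fst p) = ?s b" "?s (snd p) = ?s x" using b(3) x(3) by auto
      then show ?thesis
        using inj_on_eq_iff[OF inj pv(1) vv(2)] inj_on_eq_iff[OF inj pv(2) vv(3)]
        by (simp add: prod_eq_iff)
    qed
    ultimately show ?thesis by blast
  qed
  moreover have "P \<subseteq> blacks G \<times> gwhites G" using P_mem by (auto simp: mem_Times_iff)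
  ultimately show "pairing G P" unfolding pairing_def by blast
qed

lemma GG_structure:
  assumes G: "(G, \<iota>) \<in> GG D q \<BB>"
  defines "P \<equiv> global_pairing \<Omega> G \<iota>"
  defines "\<sigma> \<equiv> pair_perm (complete_graph G P) P"
  defines "M \<equiv> edge_corner P ` marked_edges G P"
  shows "Psi0 D \<Omega> (G, \<iota>) = (cycle_map {0..D} P \<sigma> M, pair_label \<iota>)"
    and "pair_system {0..D} P \<sigma> M"
    and "G = pgraph {0..D} P \<sigma> M"
    and "\<And>p. p \<in> P \<Longrightarrow> fst (\<iota> (snd p)) = fst (\<iota> (fst p))"
    and "bubbles G = (\<lambda>Q. pgraph {1..D} Q \<sigma> {}) ` step_classes {1..D} P \<sigma>"
    and "\<And>Q B. Q \<in> step_classes {1..D} P \<sigma> \<Longrightarrow> B \<in> \<BB> \<Longrightarrow>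
      bubble_copy \<iota> B (pgraph {1..D} Q \<sigma> {}) \<longleftrightarrow>
      submap_copy D \<Omega> (pair_label \<iota>) B (cycle_map {1..D} Q \<sigma> {})"
    and "Psi0 D \<Omega> (G, \<iota>) \<in> SS D q \<BB> \<Omega>"
proof -
  have P: "pairing G P" unfolding P_def by (rule GG_pairing(1)[OF G])
  have col: "coloured_graph {0..D} G" and con: "gconnected G"
    and reg: "\<And>v c. v \<in> gverts G \<Longrightarrow> c \<in> {1..D} \<Longrightarrow> has_edge G c v"
    and cw: "card {w \<in> gwhites G. \<not> has_edge G 0 w} = q"
    and bc: "\<And>C. C \<in> bubbles G \<Longrightarrow> \<exists>B\<in>\<BB>. bubble_copy \<iota> B C"
    using G unfolding GG_def by blast+
  \<comment> \<open>Some presentation of \<open>G\<close> exists. Since \<open>Psi0\<close> recovers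
    permutations and marks from any presentation, its own \<open>\<sigma>\<close> and
    \<open>M\<close> agree with \<open>\<tau>\<close> and \<open>N\<close> on \<open>P\<close> and
    present \<open>G\<close> too.\<close>
  obtain \<tau> N where t: "pair_system {0..D} P \<tau> N" "G = pgraph {0..D} P \<tau> N"
    using graph_eq_pgraph[OF col P reg] by blast
  interpret t: pair_system "{0..D}" P \<tau> N by (rule t(1))
  have "edge_corner P ` marked_edges (pgraph {0..D} P \<tau> N) P = N"
    by (rule t.edge_corner_marked_edges) simp
  then have MN: "M = N" unfolding M_def t(2)[symmetric] .
  have st: "\<sigma> c p = \<tau> c p" if "c \<in> {0..D}" "p \<in> P" for c p
    using Psi0_map_pgraph(2)[OF t(1) that] unfolding \<sigma>_def t(2)[symmetric] .
  have "perm_system {0..D} P \<sigma> M" unfolding MN by (rule t.cong_sigma) (rule st)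
  then show sys: "pair_system {0..D} P \<sigma> M" using t.pair_set_axioms by (rule pair_system.intro)
  show Gp: "G = pgraph {0..D} P \<sigma> M"
    unfolding MN using t(2) pgraph_cong[of "{0..D}" P \<sigma> \<tau> N, OF st] by simp
  show Psi0: "Psi0 D \<Omega> (G, \<iota>) = (cycle_map {0..D} P \<sigma> M, pair_label \<iota>)"
    unfolding Psi0_eq P_def[symmetric] by (simp add: Psi0_map_def \<sigma>_def M_def)
  interpret s: pair_system "{0..D}" P \<sigma> M by (rule sys)
  have I: "{0..D} - {0} = {1..D}" by auto
  have del: "gdelete0 G = pgraph {1..D} P \<sigma> {}" unfolding Gp using s.gdelete0_pgraph by (simp only: I)
  have adj: "(fst p, snd p) \<in> (gadj (gdelete0 G))\<^sup>*" and inG: "fst p \<in> gverts G" "snd p \<in> gverts G"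
    and om: "map_prod (snd \<circ> \<iota>) (snd \<circ> \<iota>) p \<in> \<Omega> (fst (\<iota> (fst p)))" if "p \<in> P" for p
    using that unfolding P_def global_pairing_eq by (auto simp: gverts_def)
  show lab: "fst (\<iota> (snd p)) = fst (\<iota> (fst p))" if "p \<in> P" for p
    using GG_pairing(2)[OF G inG[OF that] adj[OF that]] by simp
  interpret r: pair_system "{1..D}" P \<sigma> "{}" using s.without_colour_0 by (simp only: I)
  interpret r: linked_pair_system "{1..D}" P \<sigma> "{}"
    by unfold_locales (use adj in \<open>simp add: del\<close>)
  have "gadj (gdelete0 G) \<subseteq> gadj G" unfolding gadj_def gedges_gdelete0_eq by blast
  then have "(gadj (gdelete0 G))\<^sup>* \<subseteq> (gadj G)\<^sup>*" by (rule rtrancl_mono)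
  then interpret s: linked_pair_system "{0..D}" P \<sigma> M
    by unfold_locales (use adj in \<open>auto simp flip: Gp\<close>)
  show bub: "bubbles G = (\<lambda>Q. pgraph {1..D} Q \<sigma> {}) ` step_classes {1..D} P \<sigma>"
    unfolding bubbles_def del by (rule r.gcomponents_pgraph)
  have Qsys: "pair_system {1..D} Q \<sigma> {}" if "Q \<in> step_classes {1..D} P \<sigma>" for Q
    using r.perm_system_class[OF that] t.pair_set_subset[OF r.step_class_sub[OF that]]
    by (rule pair_system.intro)
  show copies: "bubble_copy \<iota> B (pgraph {1..D} Q \<sigma> {}) \<longleftrightarrow>
      submap_copy D \<Omega> (pair_label \<iota>) B (cycle_map {1..D} Q \<sigma> {})"
    if Q: "Q \<in> step_classes {1..D} P \<sigma>" and B: "B \<in> \<BB>" for Q B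
  proof
    note QP = subsetD[OF r.step_class_sub[OF Q]]
    interpret b: pair_system "{1..D}" "\<Omega> B" "pair_perm B (\<Omega> B)" "{}" by (rule model_pgraph[OF B])
    let ?s = "snd \<circ> \<iota>"
    show "bubble_copy \<iota> B (pgraph {1..D} Q \<sigma> {})"
      if "submap_copy D \<Omega> (pair_label \<iota>) B (cycle_map {1..D} Q \<sigma> {})"
      by (rule bubble_copyI[OF B Qsys[OF Q] _ that]) (rule lab[OF QP])
    assume bcp: "bubble_copy \<iota> B (pgraph {1..D} Q \<sigma> {})"
    have fB: "map_prod ?s ?s p \<in> \<Omega> B" if "p \<in> Q" for p
    proof -
      have "fst p \<in> pverts Q" using that by blast
      then have "fst (\<iota> (fst p)) = B" using bcp unfolding bubble_copy_def pgraph_simps by blast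
      then show ?thesis using om[OF QP[OF that]] by simp
    qed
    \<comment> \<open>Pairs of \<open>Q\<close> go to pairs of the model, and their black vertices
      cover those of \<open>B\<close>. A pair of \<open>\<Omega> B\<close> is determined by its
      black vertex, so none is missed.\<close>
    have "map_prod ?s ?s ` Q = \<Omega> B"
    proof (intro equalityI subsetI)
      fix \<omega> assume w: "\<omega> \<in> \<Omega> B"
      have "blacks B = fst ` \<Omega> B" by (subst model_pgraph(2)[OF B]) simp
      moreover have "blacks B = ?s ` fst ` Q"
        using bcp unfolding bubble_copy_def graph_iso_def pgraph_simps by blast
      ultimately have "fst \<omega> \<in> ?s ` fst ` Q" using w by blast
      then obtain p where p: "p \<in> Q" "fst \<omega> = ?s (fst p)" by blast
      have "\<omega> = map_prod ?s ?s p" by (rule b.fst_eq[OF w fB[OF p(1)]]) (use p in simp)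
      then show "\<omega> \<in> map_prod ?s ?s ` Q" using p(1) by (rule image_eqI)
    qed (elim imageE; simp only: fB)
    then show "submap_copy D \<Omega> (pair_label \<iota>) B (cycle_map {1..D} Q \<sigma> {})"
      by (rule submap_copyI[OF B Qsys[OF Q] bcp])
  qed
  have card: "card M = q" using s.card_unmatched(1) cw unfolding Gp[symmetric] by simp
  have "\<exists>B\<in>\<BB>. submap_copy D \<Omega> (pair_label \<iota>) B (cycle_map {1..D} Q \<sigma> {})"
    if Q: "Q \<in> step_classes {1..D} P \<sigma>" for Q
    using bc[of "pgraph {1..D} Q \<sigma> {}"] copies[OF Q] Q unfolding bub by blast
  moreover have "P \<noteq> {} \<and> (\<forall>p\<in>P. \<forall>p'\<in>P. (p, p') \<in> (steps {0..D} P \<sigma>)\<^sup>*)"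
    using con s.gconnected_pgraph unfolding Gp[symmetric] by blast
  ultimately show "Psi0 D \<Omega> (G, \<iota>) \<in> SS D q \<BB> \<Omega>"
    unfolding Psi0 SS_cycle_map[OF s.perm_system_axioms] using card by blast
qed

end

subsection \<open>Copies with natural numbers as carriers\<close>

lemma smap_copy:
  assumes "inj_on f (whites \<Gamma>)" "inj_on h (sedges \<Gamma>)" "inj_on g (cverts \<Gamma>)"
  obtains \<Delta> where "smap_iso f h g \<Gamma> \<Delta>"
proof -
  let ?h = "inv_into (sedges \<Gamma>) h" and ?g = "inv_into (cverts \<Gamma>) g"
  define \<Delta> where "\<Delta> = \<lparr>whites = f ` whites \<Gamma>, cverts = g ` cverts \<Gamma>, sedges = h ` sedges \<Gamma>,
    vcol = vcol \<Gamma> \<circ> ?g, ecol = ecol \<Gamma> \<circ> ?h, wend = f \<circ> wend \<Gamma> \<circ> ?h, cend = g \<circ> cend \<Gamma> \<circ> ?h,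
    nxt = h \<circ> nxt \<Gamma> \<circ> ?h, marked = h ` marked \<Gamma>\<rparr>"
  have "smap_iso f h g \<Gamma> \<Delta>"
    by (rule smap_isoI) (simp_all add: \<Delta>_def assms)
  then show thesis by (rule that)
qed

text \<open>The value of \<open>Psi0\<close> lives on pairs and sets of pairs; a copy over the
  naturals shows that the class it defines there is inhabited, hence a genuine isomorphism
  class.\<close>

lemma SS_nat_copy:
  assumes x: "(\<Gamma>, \<kappa>) \<in> SS D q \<BB> \<Omega>"
  obtains y :: "(nat, nat, nat) smap \<times> (nat \<Rightarrow> 'b bgraph \<times> 'b \<times> 'b)"
  where "ident_smap_iso (\<Gamma>, \<kappa>) y"
proof -
  have "finite (whites \<Gamma>)" "finite (sedges \<Gamma>)" "finite (cverts \<Gamma>)"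
    using x by (auto simp: SS_def stacked_map_def)
  then obtain f h g :: "_ \<Rightarrow> nat" where inj: "inj_on f (whites \<Gamma>)" "inj_on h (sedges \<Gamma>)" "inj_on g (cverts \<Gamma>)"
    using finite_imp_inj_to_nat_seg by metis
  then obtain \<Delta> :: "(nat, nat, nat) smap" where iso: "smap_iso f h g \<Gamma> \<Delta>" by (rule smap_copy)
  have "\<forall>w\<in>whites \<Gamma>. (\<kappa> \<circ> inv_into (whites \<Gamma>) f) (f w) = \<kappa> w" using inj(1) by simp
  then have "ident_smap_iso (\<Gamma>, \<kappa>) (\<Delta>, \<kappa> \<circ> inv_into (whites \<Gamma>) f)"
    using iso unfolding ident_smap_iso_def prod.case by blast
  then show thesis by (rule that)
qed

subsection \<open>The bijection on isomorphism classes\<close>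

type_synonym 'b nat_graph = "nat bgraph \<times> (nat \<Rightarrow> 'b bgraph \<times> 'b)"

type_synonym 'b nat_map = "(nat, nat, nat) smap \<times> (nat \<Rightarrow> 'b bgraph \<times> 'b \<times> 'b)"

lemma pair_label_map:
  assumes "\<iota>' (s (fst p)) = \<iota> (fst p)" "\<iota>' (s (snd p)) = \<iota> (snd p)"
  shows "pair_label \<iota>' (map_prod s s p) = pair_label \<iota> p"
  using assms by (simp add: pair_label_def case_prod_beta)

context bubble_models
begin

text \<open>Paths, marked edges and \<open>THE\<close> need not be followed through the isomorphism.
  The permutations and marks of \<open>G\<close> are moved to the pairs of \<open>G'\<close>; the
  graph they define is the image of \<open>G\<close>, that is \<open>G'\<close>, and
  \<open>Psi0_pgraph\<close> evaluates \<open>Psi0\<close> on it.\<close>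

lemma Psi0_cong:
  assumes x: "(G, \<iota>) \<in> GG D q \<BB>" and y: "(G', \<iota>') \<in> GG D q \<BB>"
    and iso: "ident_graph_iso (G, \<iota>) (G', \<iota>')"
  shows "ident_smap_iso (Psi0 D \<Omega> (G, \<iota>)) (Psi0 D \<Omega> (G', \<iota>'))"
proof -
  obtain s where s: "graph_iso s G G'" and lab: "\<forall>v\<in>gverts G. \<iota>' (s v) = \<iota> v"
    using iso unfolding ident_graph_iso_def by blast
  define P where "P = global_pairing \<Omega> G \<iota>"
  define P' where "P' = global_pairing \<Omega> G' \<iota>'"
  define \<sigma> where "\<sigma> = pair_perm (complete_graph G P) P"
  define M where "M = edge_corner P ` marked_edges G P"
  note X = GG_structure[OF x, folded P_def, folded \<sigma>_def M_def]
  interpret x: pair_system "{0..D}" P \<sigma> M by (rule X(2))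
  note Y = GG_structure[OF y, folded P'_def]
  interpret y: pair_system "{0..D}" P' "pair_perm (complete_graph G' P') P'" "edge_corner P' ` marked_edges G' P'"
    by (rule Y(2))
  let ?f = "map_prod s s"
  have PG: "fst p \<in> gverts G" "snd p \<in> gverts G" if "p \<in> P" for p
    using that by (subst X(3), simp)+
  have fP: "?f p \<in> P'" if p: "p \<in> P" for p
  proof -
    have a: "fst p \<in> blacks G" "snd p \<in> gwhites G" "(fst p, snd p) \<in> (gadj (gdelete0 G))\<^sup>*"
      "(snd (\<iota> (fst p)), snd (\<iota> (snd p))) \<in> \<Omega> (fst (\<iota> (fst p)))"
      using p unfolding P_def global_pairing_eq by auto
    have "s (fst p) \<in> blacks G'" "s (snd p) \<in> gwhites G'"
      using a(1,2) s unfolding graph_iso_def by blast+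
    moreover have "(s (fst p), s (snd p)) \<in> (gadj (gdelete0 G'))\<^sup>*"
      by (rule graph_iso_gadj_rtrancl[OF a(3) graph_iso_gdelete0[OF s]])
    moreover have "\<iota>' (s (fst p)) = \<iota> (fst p)" "\<iota>' (s (snd p)) = \<iota> (snd p)"
      using lab PG[OF p] by blast+
    ultimately have "(s (fst p), s (snd p)) \<in> P'"
      unfolding P'_def global_pairing_eq using a(4) by simp
    then show ?thesis by (simp add: map_prod_def case_prod_beta)
  qed
  have "inj_on s (gverts G)" using s by (simp add: graph_iso_def)
  then have "inj_on ?f P"
    using PG by (intro inj_onI prod_eqI) (metis fst_map_prod snd_map_prod inj_onD)+
  moreover have "?f ` P = P'"
  proof (intro equalityI subsetI)
    fix p' assume p': "p' \<in> P'"
    have "fst p' \<in> blacks G'" using p' by (subst Y(3)) simp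
    moreover have "blacks G' = s ` blacks G" using s by (simp add: graph_iso_def)
    moreover have "blacks G = fst ` P" by (subst X(3)) simp
    ultimately obtain p where p: "p \<in> P" "fst p' = s (fst p)"
      by (metis (no_types, lifting) imageE)
    then have "p' = ?f p" using y.fst_eq[OF p' fP[OF p(1)]] by simp
    then show "p' \<in> ?f ` P" using p(1) by blast
  qed (elim imageE; simp only: fP)
  ultimately have bij: "bij_betw ?f P P'" by (simp add: bij_betw_def)
  define \<tau> where "\<tau> c = ?f \<circ> \<sigma> c \<circ> inv_into P ?f" for c
  define N where "N = apsnd ?f ` M"
  have "perm_system {0..D} P' \<tau> N"
    using x.transport[OF bij] unfolding \<tau>_def N_def .
  then have sys: "pair_system {0..D} P' \<tau> N" using y.pair_set_axioms by (rule pair_system.intro)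
  have comm: "?f (\<sigma> c p) = \<tau> c (?f p)" if "p \<in> P" for c p
    using x.transport_comm[OF bij that] by (simp add: \<tau>_def)
  have "graph_iso s (pgraph {0..D} P \<sigma> M) (pgraph {0..D} P' \<tau> N)"
    by (rule graph_iso_pgraphI[OF x.pair_set_axioms y.pair_set_axioms bij _ x.marks_sub N_def])
      (rule comm)
  then have "graph_iso s G (pgraph {0..D} P' \<tau> N)" unfolding X(3)[symmetric] .
  then have G': "G' = pgraph {0..D} P' \<tau> N" using s graph_iso_unique by blast
  have "ident_smap_iso (cycle_map {0..D} P' \<tau> N, pair_label \<iota>') (Psi0 D \<Omega> (G', \<iota>'))"
    unfolding G' by (rule Psi0_pgraph[OF sys]) (subst G'[symmetric], rule P'_def[symmetric])
  moreover have "ident_smap_iso (cycle_map {0..D} P \<sigma> M, pair_label \<iota>)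
      (cycle_map {0..D} P' \<tau> N, pair_label \<iota>')"
  proof -
    have "smap_iso ?f (apsnd ?f) (apsnd (image ?f)) (cycle_map {0..D} P \<sigma> M) (cycle_map {0..D} P' \<tau> N)"
      by (rule x.smap_iso_cycle_mapI[OF bij _ N_def]) (rule comm)
    moreover have "\<forall>p\<in>whites (cycle_map {0..D} P \<sigma> M). pair_label \<iota>' (?f p) = pair_label \<iota> p"
      using lab PG by (simp add: cycle_map_def pair_label_map del: map_prod_simp)
    ultimately show ?thesis unfolding ident_smap_iso_def prod.case by blast
  qed
  ultimately show ?thesis unfolding X(1) using ident_smap_iso_trans by blast
qed

text \<open>The given isomorphism is a bijection of pairs commuting with the permutations and
  matching the marks. Split into a vertex map, it sends edges to edges since the edges are images of
  the unmarked corners.\<close>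

lemma Psi0_inj:
  assumes x: "(G, \<iota>) \<in> GG D q \<BB>" and y: "(G', \<iota>') \<in> GG D q \<BB>"
    and iso: "ident_smap_iso (Psi0 D \<Omega> (G, \<iota>)) (Psi0 D \<Omega> (G', \<iota>'))"
  shows "ident_graph_iso (G, \<iota>) (G', \<iota>')"
proof -
  define P where "P = global_pairing \<Omega> G \<iota>"
  define P' where "P' = global_pairing \<Omega> G' \<iota>'"
  define \<sigma> where "\<sigma> = pair_perm (complete_graph G P) P"
  define M where "M = edge_corner P ` marked_edges G P"
  define \<tau> where "\<tau> = pair_perm (complete_graph G' P') P'"
  define N where "N = edge_corner P' ` marked_edges G' P'"
  note X = GG_structure[OF x, folded P_def, folded \<sigma>_def M_def]
  note Y = GG_structure[OF y, folded P'_def, folded \<tau>_def N_def]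
  interpret x: pair_system "{0..D}" P \<sigma> M by (rule X(2))
  interpret y: pair_system "{0..D}" P' \<tau> N by (rule Y(2))
  obtain f h g where f: "smap_iso f h g (cycle_map {0..D} P \<sigma> M) (cycle_map {0..D} P' \<tau> N)"
    and lab: "\<forall>p\<in>whites (cycle_map {0..D} P \<sigma> M). pair_label \<iota>' (f p) = pair_label \<iota> p"
    using iso unfolding X(1) Y(1) ident_smap_iso_def prod.case by blast
  note d = x.smap_iso_cycle_mapD[OF f]
  obtain s where s: "\<And>p. p \<in> P \<Longrightarrow> map_prod s s p = f p" using x.vertex_map_exists by blast
  have bij: "bij_betw (map_prod s s) P P'"
    using d(1) by (rule bij_betw_cong[THEN iffD2, rotated]) (rule s)
  have N: "N = apsnd (map_prod s s) ` M"
    unfolding d(3) by (rule image_cong[OF refl]) (use x.marks_sub s in \<open>auto simp del: map_prod_simp\<close>)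
  have "graph_iso s (pgraph {0..D} P \<sigma> M) (pgraph {0..D} P' \<tau> N)"
    by (rule graph_iso_pgraphI[OF x.pair_set_axioms y.pair_set_axioms bij _ x.marks_sub N])
      (simp only: s x.closed d(2))
  then have "graph_iso s G G'" unfolding X(3)[symmetric] Y(3)[symmetric] .
  moreover have "\<iota>' (s v) = \<iota> v" if v: "v \<in> gverts G" for v
  proof -
    have "v \<in> pverts P" using v by (subst (asm) X(3)) simp
    then obtain p where p: "p \<in> P" "v = fst p \<or> v = snd p" by blast
    have "map_prod s s p \<in> P'" using bij p(1) by (rule bij_betwE[THEN bspec])
    \<comment> \<open>The label of a pair does not record the model of its white vertex, which is
      recovered from the black one on both sides.\<close>
    then have l': "fst (\<iota>' (s (snd p))) = fst (\<iota>' (s (fst p)))" using Y(4) by fastforce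
    have "pair_label \<iota>' (map_prod s s p) = pair_label \<iota> p"
      using lab p(1) s[OF p(1)] by (simp add: cycle_map_def)
    then have "fst (\<iota>' (s (fst p))) = fst (\<iota> (fst p))" "snd (\<iota>' (s (fst p))) = snd (\<iota> (fst p))"
      "snd (\<iota>' (s (snd p))) = snd (\<iota> (snd p))"
      by (simp_all add: pair_label_def case_prod_beta)
    then show ?thesis using p(2) l' X(4)[OF p(1)] by (metis prod_eqI)
  qed
  ultimately show ?thesis unfolding ident_graph_iso_def prod.case by blast
qed

lemma Psi0_surj:
  fixes \<Gamma> :: "(nat, 'e, 'c) smap"
  assumes y: "(\<Gamma>, \<kappa>) \<in> SS D q \<BB> \<Omega>"
  obtains G :: "nat bgraph" and \<iota> where "(G, \<iota>) \<in> GG D q \<BB>"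
    "ident_smap_iso (Psi0 D \<Omega> (G, \<iota>)) (\<Gamma>, \<kappa>)"
proof -
  have st: "stacked_map {0..D} \<Gamma>" using y by (simp add: SS_def)
  define W where "W = whites \<Gamma>"
  obtain r K h g where r: "perm_system {0..D} W r K"
      "smap_iso id h g \<Gamma> (cycle_map {0..D} W r K)"
    unfolding W_def by (rule stacked_map_normal_form[OF st finite_atLeastAtMost])
  interpret r: perm_system "{0..D}" W r K by (rule r(1))
  \<comment> \<open>The white vertex \<open>w\<close> of the map is split into a black vertex
    \<open>2 * w\<close> and a white vertex \<open>2 * w + 1\<close>; halving and parity recover
    \<open>w\<close> and the side, as in \<open>\<iota>\<close> below.\<close>
  define f where "f w = (2 * w, 2 * w + 1)" for w :: nat
  define P where "P = f ` W"
  define \<sigma> where "\<sigma> c = f \<circ> r c \<circ> inv_into W f" for c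
  define M where "M = apsnd f ` K"
  define \<iota> where "\<iota> v = (fst (\<kappa> (v div 2)), (if even v then fst else snd) (snd (\<kappa> (v div 2))))" for v :: nat
  have bij: "bij_betw f W P" by (auto simp: bij_betw_def P_def f_def inj_on_def)
  have lab: "pair_label \<iota> (f w) = \<kappa> w" for w
    by (simp add: pair_label_def \<iota>_def f_def)
  have "pair_set P" by unfold_locales (auto simp: P_def f_def, presburger+)
  moreover have "perm_system {0..D} P \<sigma> M" unfolding \<sigma>_def M_def by (rule r.transport[OF bij])
  ultimately have sys: "pair_system {0..D} P \<sigma> M" by (intro pair_system.intro)
  have "smap_iso f (apsnd f) (apsnd (image f)) (cycle_map {0..D} W r K) (cycle_map {0..D} P \<sigma> M)"
    by (rule r.smap_iso_cycle_mapI[OF bij _ M_def]) (unfold \<sigma>_def, rule r.transport_comm[OF bij])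
  from smap_iso_comp[OF r(2) this]
  have iso: "ident_smap_iso (\<Gamma>, \<kappa>) (cycle_map {0..D} P \<sigma> M, pair_label \<iota>)"
    unfolding ident_smap_iso_def prod.case using lab by (metis comp_id)
  have S: "(cycle_map {0..D} P \<sigma> M, pair_label \<iota>) \<in> SS D q \<BB> \<Omega>" by (rule SS_iso[OF y iso])
  have l: "fst (\<iota> (snd p)) = fst (\<iota> (fst p))" if "p \<in> P" for p
    using that by (auto simp: P_def f_def \<iota>_def)
  note G = GG_of_SS[OF sys l S]
  have "ident_smap_iso (\<Gamma>, \<kappa>) (Psi0 D \<Omega> (pgraph {0..D} P \<sigma> M, \<iota>))"
    using iso Psi0_pgraph[OF sys G(2)] by (rule ident_smap_iso_trans)
  then have "ident_smap_iso (Psi0 D \<Omega> (pgraph {0..D} P \<sigma> M, \<iota>)) (\<Gamma>, \<kappa>)"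
    using ident_smap_iso_sym[OF _ SS_wf[OF y]] by (metis surj_pair)
  then show thesis using that G(1) by blast
qed

lemma Psi0_in_SS: "x \<in> GG D q \<BB> \<Longrightarrow> Psi0 D \<Omega> x \<in> SS D q \<BB> \<Omega>"
  using GG_structure(7) by (cases x) blast

lemma Psi0_iso_iff:
  "x \<in> GG D q \<BB> \<Longrightarrow> x' \<in> GG D q \<BB> \<Longrightarrow>
    ident_smap_iso (Psi0 D \<Omega> x) (Psi0 D \<Omega> x') \<longleftrightarrow> ident_graph_iso x x'"
  using Psi0_cong Psi0_inj by (cases x, cases x') blast

lemma SS_sym: "x \<in> SS D q \<BB> \<Omega> \<Longrightarrow> ident_smap_iso x y \<Longrightarrow> ident_smap_iso y x"
  using ident_smap_iso_sym SS_wf by (cases x, cases y) blast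

lemma SS_closed: "x \<in> SS D q \<BB> \<Omega> \<Longrightarrow> ident_smap_iso x y \<Longrightarrow> y \<in> SS D q \<BB> \<Omega>"
  using SS_iso by (cases x, cases y) blast

lemma Psi0_class_eq:
  assumes x: "x \<in> GG D q \<BB>"
  shows "Psi0_class D \<Omega> (GG_iso_rel D q \<BB> `` {x}) = {y. ident_smap_iso (Psi0 D \<Omega> x) y}"
proof (intro equalityI subsetI)
  fix y assume "y \<in> Psi0_class D \<Omega> (GG_iso_rel D q \<BB> `` {x})"
  then obtain x' where xx': "(x, x') \<in> GG_iso_rel D q \<BB>" and x'y: "ident_smap_iso (Psi0 D \<Omega> x') y"
    unfolding Psi0_class_def by blast
  from xx' have x': "x' \<in> GG D q \<BB>" "ident_graph_iso x x'" by (simp_all add: GG_iso_rel_def)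
  then have "ident_smap_iso (Psi0 D \<Omega> x) (Psi0 D \<Omega> x')" using Psi0_iso_iff x by blast
  then show "y \<in> {y. ident_smap_iso (Psi0 D \<Omega> x) y}"
    using x'y ident_smap_iso_trans by blast
next
  fix y assume "y \<in> {y. ident_smap_iso (Psi0 D \<Omega> x) y}"
  moreover have "ident_graph_iso x x"
    using Psi0_iso_iff[OF x x] ident_smap_iso_refl by blast
  then have "(x, x) \<in> GG_iso_rel D q \<BB>" using x unfolding GG_iso_rel_def by blast
  ultimately show "y \<in> Psi0_class D \<Omega> (GG_iso_rel D q \<BB> `` {x})"
    by (auto simp: Psi0_class_def)
qed

text \<open>The carriers of \<open>x\<close> and \<open>y\<close> may differ: typically
  \<open>x\<close> is a value of \<open>Psi0\<close> and \<open>y\<close> a map over the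
  naturals.\<close>

lemma SS_class_eq:
  assumes x: "x \<in> SS D q \<BB> \<Omega>" and xy: "ident_smap_iso x y"
  shows "SS_iso_rel D q \<BB> \<Omega> `` {y} = {z. ident_smap_iso x z}"
proof -
  have "ident_smap_iso y z \<longleftrightarrow> ident_smap_iso x z" for z
    using ident_smap_iso_trans[OF xy] ident_smap_iso_trans[OF SS_sym[OF x xy]] by blast
  moreover have "y \<in> SS D q \<BB> \<Omega>" by (rule SS_closed[OF x xy])
  ultimately show ?thesis
    using SS_closed[OF x] unfolding SS_iso_rel_def by blast
qed

lemma bij_betw_Psi0_class:
  "bij_betw (Psi0_class D \<Omega> :: 'b nat_graph set \<Rightarrow> 'b nat_map set)
    (GG D q \<BB> // GG_iso_rel D q \<BB>) (SS D q \<BB> \<Omega> // SS_iso_rel D q \<BB> \<Omega>)"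
proof (rule bij_betwI')
  let ?\<Psi> = "Psi0_class D \<Omega> :: 'b nat_graph set \<Rightarrow> 'b nat_map set"
  have nat: "\<exists>y :: 'b nat_map. ident_smap_iso (Psi0 D \<Omega> x) y"
    if "x \<in> GG D q \<BB>" for x :: "'b nat_graph"
    using Psi0_in_SS[OF that] SS_nat_copy by (metis surj_pair)
  fix X :: "'b nat_graph set"
  assume "X \<in> GG D q \<BB> // GG_iso_rel D q \<BB>"
  then obtain x :: "'b nat_graph"
    where x: "x \<in> GG D q \<BB>" "X = GG_iso_rel D q \<BB> `` {x}" by (rule quotientE)
  obtain y :: "'b nat_map"
    where y: "ident_smap_iso (Psi0 D \<Omega> x) y" using nat[OF x(1)] by blast
  have X: "?\<Psi> X = {z. ident_smap_iso (Psi0 D \<Omega> x) z}" unfolding x(2) by (rule Psi0_class_eq[OF x(1)])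
  show "?\<Psi> X \<in> SS D q \<BB> \<Omega> // SS_iso_rel D q \<BB> \<Omega>"
    unfolding X SS_class_eq[OF Psi0_in_SS[OF x(1)] y, symmetric]
    by (rule quotientI[OF SS_closed[OF Psi0_in_SS[OF x(1)] y]])
  fix X' :: "'b nat_graph set"
  assume "X' \<in> GG D q \<BB> // GG_iso_rel D q \<BB>"
  then obtain x' :: "'b nat_graph"
    where x': "x' \<in> GG D q \<BB>" "X' = GG_iso_rel D q \<BB> `` {x'}" by (rule quotientE)
  have X': "?\<Psi> X' = {z. ident_smap_iso (Psi0 D \<Omega> x') z}" unfolding x'(2) by (rule Psi0_class_eq[OF x'(1)])
  show "?\<Psi> X = ?\<Psi> X' \<longleftrightarrow> X = X'"
  proof
    assume "?\<Psi> X = ?\<Psi> X'"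
    then have "ident_smap_iso (Psi0 D \<Omega> x') y" using y unfolding X X' by blast
    then have xx': "ident_smap_iso (Psi0 D \<Omega> x) (Psi0 D \<Omega> x')"
      using y SS_sym[OF Psi0_in_SS[OF x'(1)]] ident_smap_iso_trans by blast
    then have "ident_smap_iso (Psi0 D \<Omega> x') (Psi0 D \<Omega> x)" by (rule SS_sym[OF Psi0_in_SS[OF x(1)]])
    \<comment> \<open>Isomorphic images turn the classes of \<open>x\<close> and \<open>x'\<close>
      into the same condition on \<open>z\<close>, because \<open>Psi0\<close> both preserves and
      reflects isomorphism.\<close>
    then have "ident_graph_iso x z \<longleftrightarrow> ident_graph_iso x' z" if "z \<in> GG D q \<BB>" for z
      using xx' ident_smap_iso_trans Psi0_iso_iff[OF x(1) that] Psi0_iso_iff[OF x'(1) that] by metis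
    then show "X = X'" using x x' by (auto simp: GG_iso_rel_def)
  qed simp
next
  fix Y :: "'b nat_map set"
  assume "Y \<in> SS D q \<BB> \<Omega> // SS_iso_rel D q \<BB> \<Omega>"
  then obtain y where y: "y \<in> SS D q \<BB> \<Omega>" "Y = SS_iso_rel D q \<BB> \<Omega> `` {y}" by (rule quotientE)
  obtain \<Gamma> \<kappa> where yy: "y = (\<Gamma>, \<kappa>)" by (cases y)
  obtain G :: "nat bgraph" and \<iota> where G: "(G, \<iota>) \<in> GG D q \<BB>" "ident_smap_iso (Psi0 D \<Omega> (G, \<iota>)) y"
    using Psi0_surj y(1) unfolding yy by blast
  have "Y = Psi0_class D \<Omega> (GG_iso_rel D q \<BB> `` {(G, \<iota>)})"
    unfolding y(2) Psi0_class_eq[OF G(1)] by (rule SS_class_eq[OF Psi0_in_SS[OF G(1)] G(2)])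
  moreover have "GG_iso_rel D q \<BB> `` {(G, \<iota>)} \<in> GG D q \<BB> // GG_iso_rel D q \<BB>"
    using G(1) by (rule quotientI)
  ultimately show "\<exists>X\<in>(GG D q \<BB> :: 'b nat_graph set) // GG_iso_rel D q \<BB>.
      Y = Psi0_class D \<Omega> X"
    by blast
qed

end

subsection \<open>Bubbles and submaps\<close>

lemma submap_of_bubble_pgraph:
  assumes sys: "pair_system {0..D} P \<sigma> M" and Psi: "Psi0_map D G P = cycle_map {0..D} P \<sigma> M"
    and Q: "Q \<in> step_classes {1..D} P \<sigma>"
  shows "submap_of_bubble D G P (pgraph {1..D} Q \<sigma> {}) = cycle_map {1..D} Q \<sigma> {}"
proof -
  interpret pair_system "{0..D}" P \<sigma> M by (rule sys)
  interpret r: perm_system "{1..D}" P \<sigma> "{}" by (rule restrict_colours) auto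
  note QP = r.step_class_sub[OF Q]
  have "{0..D} \<inter> - {0} = {1..D}" "{e \<in> M. fst e \<in> - {0}} = {}" using marks_colour by auto
  then have k: "keep_colours (- {0}) (Psi0_map D G P) = cycle_map {1..D} P \<sigma> {}"
    by (simp only: Psi keep_colours_cycle_map)
  have q: "{p \<in> P. fst p \<in> pverts Q \<and> snd p \<in> pverts Q} = Q"
    using fst_in[OF QP] snd_in[OF QP] fst_not_in[OF QP] snd_not_in[OF QP] QP by blast
  have "{e \<in> {1..D} \<times> P. snd e \<in> Q} = {1..D} \<times> Q" using QP by auto
  then have cl: "Inl ` Q \<union> Inr ` cend (cycle_map {1..D} P \<sigma> {}) `
      {e \<in> sedges (cycle_map {1..D} P \<sigma> {}). wend (cycle_map {1..D} P \<sigma> {}) e \<in> Q} = class_verts {1..D} \<sigma> Q"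
    by (simp add: class_verts_def cycle_map_def)
  then show ?thesis
    unfolding submap_of_bubble_def Let_def k pgraph_simps q cl
    using r.sinduced_class_verts[OF Q] by simp
qed

lemma bij_betw_restrict:
  assumes "bij_betw f A B" "\<And>x. x \<in> A \<Longrightarrow> R (f x) \<longleftrightarrow> S x"
  shows "bij_betw f {x \<in> A. S x} {y \<in> B. R y}"
  using assms by (auto simp: bij_betw_def inj_on_def)

context bubble_models
begin

lemma submap_of_bubble_bij:
  assumes G: "(G, \<iota>) \<in> GG D q \<BB>" and \<Gamma>: "(\<Gamma>, \<kappa>) = Psi0 D \<Omega> (G, \<iota>)" and P: "P = global_pairing \<Omega> G \<iota>"
  shows "bij_betw (submap_of_bubble D G P) (bubbles G) (bubble_submaps \<Gamma>)"
    and "B \<in> \<BB> \<Longrightarrow> bij_betw (submap_of_bubble D G P) {C \<in> bubbles G. bubble_copy \<iota> B C}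
      {S \<in> bubble_submaps \<Gamma>. submap_copy D \<Omega> \<kappa> B S}"
    and "B \<in> \<BB> \<Longrightarrow> (\<And>B'. B' \<in> \<BB> \<Longrightarrow> \<exists>f. graph_iso f B' B \<Longrightarrow> B' = B) \<Longrightarrow>
      bij_betw (submap_of_bubble D G P) {C \<in> bubbles G. \<exists>f. graph_iso f C B}
        {S \<in> bubble_submaps \<Gamma>. \<exists>f h g. smap_iso f h g S (Psi D B (\<Omega> B))}"
proof -
  define \<sigma> where "\<sigma> = pair_perm (complete_graph G P) P"
  define M where "M = edge_corner P ` marked_edges G P"
  note X = GG_structure[OF G, folded P, folded \<sigma>_def M_def]
  have GK: "\<Gamma> = cycle_map {0..D} P \<sigma> M" "\<kappa> = pair_label \<iota>" using \<Gamma> X(1) by simp_all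
  have Psi: "Psi0_map D G P = cycle_map {0..D} P \<sigma> M" using X(1) by (simp add: Psi0_eq P)
  interpret pair_system "{0..D}" P \<sigma> M by (rule X(2))
  interpret r: perm_system "{1..D}" P \<sigma> "{}" by (rule restrict_colours) auto
  let ?C = "\<lambda>Q. pgraph {1..D} Q \<sigma> {}" and ?S = "\<lambda>Q. cycle_map {1..D} Q \<sigma> {}"
  let ?\<Q> = "step_classes {1..D} P \<sigma>"
  have sub: "bubble_submaps \<Gamma> = ?S ` ?\<Q>"
    unfolding GK by (rule bubble_submaps_cycle_map) (rule perm_system_axioms)
  have im: "submap_of_bubble D G P (?C Q) = ?S Q" if "Q \<in> ?\<Q>" for Q
    by (rule submap_of_bubble_pgraph[OF X(2) Psi that])
  have "whites (?S Q) = Q" for Q by (simp add: cycle_map_def)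
  then have injS: "?S Q = ?S Q' \<Longrightarrow> Q = Q'" for Q Q' by metis
  have Qsys: "pair_system {1..D} Q \<sigma> {}" if "Q \<in> ?\<Q>" for Q
    using r.perm_system_class[OF that] pair_set_subset[OF r.step_class_sub[OF that]]
    by (rule pair_system.intro)
  show bij: "bij_betw (submap_of_bubble D G P) (bubbles G) (bubble_submaps \<Gamma>)"
    unfolding X(5) sub bij_betw_def
  proof
    show "inj_on (submap_of_bubble D G P) (?C ` ?\<Q>)"
    proof (rule inj_onI)
      fix C C' assume "C \<in> ?C ` ?\<Q>" "C' \<in> ?C ` ?\<Q>"
        and eq: "submap_of_bubble D G P C = submap_of_bubble D G P C'"
      then obtain Q Q' where q: "Q \<in> ?\<Q>" "C = ?C Q" "Q' \<in> ?\<Q>" "C' = ?C Q'" by blast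
      have "Q = Q'" using eq unfolding q(2,4) im[OF q(1)] im[OF q(3)] by (rule injS)
      then show "C = C'" by (simp only: q(2,4))
    qed
    show "submap_of_bubble D G P ` ?C ` ?\<Q> = ?S ` ?\<Q>"
      unfolding image_image by (rule image_cong[OF refl im])
  qed
  show "bij_betw (submap_of_bubble D G P) {C \<in> bubbles G. bubble_copy \<iota> B C}
      {S \<in> bubble_submaps \<Gamma>. submap_copy D \<Omega> \<kappa> B S}" if B: "B \<in> \<BB>"
    by (rule bij_betw_restrict[OF bij]) (use X(5,6) im B GK in auto)
  show "bij_betw (submap_of_bubble D G P) {C \<in> bubbles G. \<exists>f. graph_iso f C B}
        {S \<in> bubble_submaps \<Gamma>. \<exists>f h g. smap_iso f h g S (Psi D B (\<Omega> B))}"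
    if B: "B \<in> \<BB>" and uniq: "\<And>B'. B' \<in> \<BB> \<Longrightarrow> \<exists>f. graph_iso f B' B \<Longrightarrow> B' = B"
  proof (rule bij_betw_restrict[OF bij])
    fix C assume C: "C \<in> bubbles G"
    obtain Q where Q: "Q \<in> ?\<Q>" "C = ?C Q" using C unfolding X(5) by blast
    interpret q: pair_system "{1..D}" Q \<sigma> "{}" by (rule Qsys[OF Q(1)])
    show "(\<exists>f h g. smap_iso f h g (submap_of_bubble D G P C) (Psi D B (\<Omega> B))) \<longleftrightarrow> (\<exists>f. graph_iso f C B)"
      unfolding Q(2) im[OF Q(1)]
    proof
      assume "\<exists>f h g. smap_iso f h g (?S Q) (Psi D B (\<Omega> B))"
      then show "\<exists>f. graph_iso f (?C Q) B" using graph_iso_of_smap_iso[OF B Qsys[OF Q(1)]] by blast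
    next
      \<comment> \<open>The isomorphism \<open>f\<close> may ignore the pairing, so it cannot be
        used directly. It shows that the recorded model \<open>B'\<close> is isomorphic to
        \<open>B\<close>, hence equal to \<open>B\<close>, and the recorded identification does
        respect the pairing.\<close>
      assume "\<exists>f. graph_iso f (?C Q) B"
      then obtain f where f: "graph_iso f (?C Q) B" by blast
      obtain B' where B': "B' \<in> \<BB>" "bubble_copy \<iota> B' (?C Q)" using G C unfolding GG_def Q(2) by blast
      then have "graph_iso (snd \<circ> \<iota>) (?C Q) B'" by (simp add: bubble_copy_def)
      then have "\<exists>g. graph_iso g B' B"
        using graph_iso_comp[OF graph_iso_inv[OF _ q.coloured_pgraph] f] by blast
      then have "B' = B" by (rule uniq[OF B'(1)])
      then have "submap_copy D \<Omega> (pair_label \<iota>) B (?S Q)" using X(6)[OF Q(1) B] B'(2) by blast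
      then show "\<exists>f h g. smap_iso f h g (?S Q) (Psi D B (\<Omega> B))" unfolding submap_copy_def by blast
    qed
  qed
qed

end

subsection \<open>Bicoloured cycles and faces\<close>

context pair_system
begin

text \<open>The edge of the corner \<open>(i, y)\<close> runs from the black vertex of
  \<open>y\<close> to the white vertex of \<open>\<sigma> i y\<close>, where the edge of the corner
  \<open>(0, \<sigma> i y)\<close> takes over. So one set of corners describes a face and a
  bicoloured cycle of the completed graph.\<close>

definition corner_cycle :: "nat \<Rightarrow> 'v \<times> 'v \<Rightarrow> (nat \<times> 'v \<times> 'v) set" where
  "corner_cycle i p = (\<Union>y\<in>orbit (\<sigma> 0 \<circ> \<sigma> i) p. {(i, y), (0, \<sigma> i y)})"

lemma bij_comp:
  assumes "0 \<in> I" "i \<in> I"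
  shows "bij_betw (\<sigma> 0 \<circ> \<sigma> i) P P"
  using bij[OF assms(2)] bij[OF assms(1)] by (rule bij_betw_trans)

lemma corner_cycle_sub:
  assumes I: "0 \<in> I" "i \<in> I" and p: "p \<in> P"
  shows "corner_cycle i p \<subseteq> {0, i} \<times> P"
proof -
  have "orbit (\<sigma> 0 \<circ> \<sigma> i) p \<subseteq> P"
    by (rule orbit_subset_of_closed[OF _ p]) (simp add: closed I)
  then show ?thesis using closed[OF I(2)] unfolding corner_cycle_def by blast
qed

text \<open>The face permutation alternates the two colours, and on corners of colour
  \<open>i\<close> its square is \<open>\<sigma> 0 \<circ> \<sigma> i\<close>. Recording the
  intermediate corners of colour 0 gives \<open>corner_cycle\<close>.\<close>

lemma faces_cycle_map:
  assumes I: "0 \<in> I" "i \<in> I" and i: "i \<noteq> 0"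
  shows "faces (bicoloured_submap i cmap) = corner_cycle i ` P"
    and "marked (bicoloured_submap i cmap) = M"
proof -
  let ?\<Delta> = "cycle_map {0, i} P \<sigma> M"
  have "I \<inter> {0, i} = {0, i}" "{e \<in> M. fst e \<in> {0, i}} = M"
    using I marks_colour by auto
  then have \<Delta>: "bicoloured_submap i cmap = ?\<Delta>"
    by (simp only: bicoloured_submap_def keep_colours_cycle_map)
  then show "marked (bicoloured_submap i cmap) = M" by (simp add: cycle_map_def)
  define \<phi> where "\<phi> = other_edge ?\<Delta> \<circ> nxt ?\<Delta>"
  have other: "other_edge ?\<Delta> (c, p) = (if c = 0 then i else 0, p)" if "c \<in> {0, i}" "p \<in> P" for c p
    unfolding other_edge_def
    by (rule the_equality) (use that i in \<open>auto simp: cycle_map_def split: if_splits\<close>)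
  have phi: "\<phi> (c, p) = (if c = 0 then i else 0, \<sigma> c p)" if "c \<in> {0, i}" "p \<in> P" for c p
  proof -
    have nxt: "nxt ?\<Delta> (c, p) = (c, \<sigma> c p)" by (simp add: cycle_map_def)
    have "\<sigma> c p \<in> P" using that I closed by blast
    then show ?thesis unfolding \<phi>_def comp_def nxt by (rule other[OF that(1)])
  qed
  let ?A = "{0, i} \<times> P"
  have phiA: "\<phi> x \<in> ?A" if "x \<in> ?A" for x
    using that phi closed I by (cases x) auto
  have "inj_on \<phi> ?A"
  proof (rule inj_onI)
    fix x y assume xy: "x \<in> ?A" "y \<in> ?A" "\<phi> x = \<phi> y"
    obtain c p where x: "x = (c, p)" "c \<in> {0, i}" "p \<in> P" using xy(1) by blast
    obtain d r where y: "y = (d, r)" "d \<in> {0, i}" "r \<in> P" using xy(2) by blast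
    have e: "(if c = 0 then i else 0) = (if d = 0 then i else 0)" "\<sigma> c p = \<sigma> d r"
      using xy(3) unfolding x(1) y(1) phi[OF x(2,3)] phi[OF y(2,3)] by simp_all
    have cd: "c = d" using e(1) x(2) y(2) i by (auto split: if_splits)
    have "c \<in> I" using x(2) I by blast
    then have "p = r" using sigma_eq_iff[of c p r] x(3) y(3) e(2) cd by simp
    then show "x = y" by (simp only: x(1) y(1) cd)
  qed
  moreover have finA: "finite ?A" using finite_P by simp
  moreover have "\<phi> ` ?A \<subseteq> ?A" using phiA by (rule image_subsetI)
  ultimately have bij\<phi>: "bij_betw \<phi> ?A ?A" unfolding bij_betw_def by (metis endo_inj_surj)
  let ?r = "\<sigma> 0 \<circ> \<sigma> i"
  have face: "orbit \<phi> (i, p) = corner_cycle i p" if p: "p \<in> P" for p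
  proof (intro equalityI subsetI)
    have oP: "y \<in> P" if "y \<in> orbit ?r p" for y
      using orbit_subset_of_closed[of P ?r p] closed I p that by auto
    fix x assume "x \<in> orbit \<phi> (i, p)"
    then show "x \<in> corner_cycle i p"
    proof induction
      case base
      have "p \<in> orbit ?r p" by (rule in_orbit_of_bij[OF finite_P bij_comp[OF I] p])
      then show ?case using phi[of i p] p i by (auto simp: corner_cycle_def)
    next
      case (step x)
      then obtain y where y: "y \<in> orbit ?r p" "x = (i, y) \<or> x = (0, \<sigma> i y)"
        by (auto simp: corner_cycle_def)
      have yP: "y \<in> P" "\<sigma> i y \<in> P" using oP[OF y(1)] closed I by auto
      from y(2) show ?case
      proof
        assume "x = (i, y)"
        then have "\<phi> x = (0, \<sigma> i y)" using phi[of i y] yP i by simp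
        then show ?thesis using y(1) unfolding corner_cycle_def by blast
      next
        assume "x = (0, \<sigma> i y)"
        then have "\<phi> x = (i, ?r y)" using phi[of 0 "\<sigma> i y"] yP by simp
        moreover have "?r y \<in> orbit ?r p" using y(1) by (rule orbit.step)
        ultimately show ?thesis unfolding corner_cycle_def by blast
      qed
    qed
  next
    have oP: "y \<in> P" if "y \<in> orbit ?r p" for y
      using orbit_subset_of_closed[of P ?r p] closed I p that by auto
    have two: "\<phi> (i, y) = (0, \<sigma> i y)" "\<phi> (0, \<sigma> i y) = (i, ?r y)" if "y \<in> P" for y
      using phi[of i y] phi[of 0 "\<sigma> i y"] that i closed I by auto
    have iy: "(i, y) \<in> orbit \<phi> (i, p)" if "y \<in> orbit ?r p" for y
      using that
    proof induction
      case base
      show ?case using two[OF p] by (metis orbit.base orbit.step)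
    next
      case (step y)
      then show ?case using two[OF oP[OF step(1)]] by (metis orbit.step)
    qed
    fix x assume "x \<in> corner_cycle i p"
    then obtain y where y: "y \<in> orbit ?r p" "x = (i, y) \<or> x = (0, \<sigma> i y)"
      by (auto simp: corner_cycle_def)
    then show "x \<in> orbit \<phi> (i, p)" using iy[OF y(1)] two(1)[OF oP[OF y(1)]] by (metis orbit.step)
  qed
  have "faces ?\<Delta> = orbit \<phi> ` ?A" by (simp add: faces_def \<phi>_def) (simp add: cycle_map_def)
  also have "\<dots> = corner_cycle i ` P"
  proof (intro equalityI subsetI)
    fix F assume "F \<in> orbit \<phi> ` ?A"
    then obtain c p where c: "c \<in> {0, i}" "p \<in> P" "F = orbit \<phi> (c, p)" by blast
    show "F \<in> corner_cycle i ` P"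
    proof (cases "c = 0")
      \<comment> \<open>A face based at a corner of colour 0 is rebased at the next corner, which
        has colour \<open>i\<close>.\<close>
      case True
      then have "\<phi> (c, p) = (i, \<sigma> 0 p)" using phi[of 0 p] c by simp
      moreover have "(c, p) \<in> orbit \<phi> (c, p)"
        by (rule in_orbit_of_bij[OF finA bij\<phi>]) (use c in blast)
      then have "orbit \<phi> (\<phi> (c, p)) = F" using self_in_orbit_step c(3) by metis
      ultimately have "F = corner_cycle i (\<sigma> 0 p)" using face closed[OF I(1) c(2)] by simp
      then show ?thesis using closed[OF I(1) c(2)] by blast
    next
      case False
      then show ?thesis using c face by auto
    qed
  next
    fix F assume "F \<in> corner_cycle i ` P"
    then obtain p where "p \<in> P" "F = orbit \<phi> (i, p)" using face by blast
    then show "F \<in> orbit \<phi> ` ?A" by blast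
  qed
  finally show "faces (bicoloured_submap i cmap) = corner_cycle i ` P" by (simp add: \<Delta>)
qed

section \<open>Bicoloured cycles as sets of corners\<close>

text \<open>The black vertices of a cycle name pairs \<open>r k\<close>, and its two edges after
  \<open>b k\<close> force \<open>r (k + 1)\<close> to be the image of \<open>r k\<close> under
  \<open>\<sigma> 0 \<circ> \<sigma> i\<close>, indices taken modulo \<open>n\<close>. So a cycle is
  the same as an orbit.\<close>

lemma bicoloured_cycles_complete:
  assumes I: "0 \<in> I" "i \<in> I" and i: "i \<noteq> 0"
  shows "bicoloured_cycles (pgraph I P \<sigma> {}) i = image (corner_edge \<sigma>) ` corner_cycle i ` P"
proof (intro equalityI subsetI)
  interpret u: pair_system I P \<sigma> "{}" by (rule without_marks)
  let ?K = "pgraph I P \<sigma> {}" and ?r = "\<sigma> 0 \<circ> \<sigma> i"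
  fix Z assume "Z \<in> bicoloured_cycles ?K i"
  then obtain n b w where n: "n > 0" and Z: "Z = (\<Union>k<n. {(i, b k, w k), (0, b (Suc k mod n), w k)})"
    and ZK: "Z \<subseteq> gedges ?K"
    unfolding bicoloured_cycles_def by blast
  have "\<exists>p\<in>P. b k = fst p \<and> w k = snd (\<sigma> i p)" if "k < n" for k
  proof -
    have "(i, b k, w k) \<in> gedges ?K" using ZK Z that by blast
    then show ?thesis unfolding u.mem_gedges[OF i] by blast
  qed
  then obtain r where p: "\<And>k. k < n \<Longrightarrow> r k \<in> P \<and> b k = fst (r k) \<and> w k = snd (\<sigma> i (r k))" by metis
  have succ: "r (Suc k mod n) = ?r (r k)" if k: "k < n" for k
  proof -
    have "(0, b (Suc k mod n), w k) \<in> gedges ?K" using ZK Z k by blast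
    then obtain p' where p': "p' \<in> P" "b (Suc k mod n) = fst (\<sigma> 0 p')" "w k = snd p'"
      unfolding u.mem_gedges0 by blast
    have sk: "\<sigma> i (r k) \<in> P" using p[OF k] closed I by blast
    have "p' = \<sigma> i (r k)" using p[OF k] p' snd_eq[OF p'(1) sk] by simp
    moreover have n': "Suc k mod n < n" using n by simp
    ultimately have "fst (r (Suc k mod n)) = fst (?r (r k))" using p[OF n'] p' by simp
    then show ?thesis using fst_eq p[OF n'] closed[OF I(1) sk] by simp
  qed
  have pow: "r k = (?r ^^ k) (r 0)" if "k < n" for k
    using that
  proof (induction k)
    case (Suc k)
    then show ?case using succ[of k] by simp
  qed simp
  have "(?r ^^ n) (r 0) = r 0"
  proof -
    obtain m where m: "n = Suc m" using n by (cases n) auto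
    have "(?r ^^ n) (r 0) = ?r (r m)" using pow[of m] by (simp add: m)
    also have "\<dots> = r 0" using succ[of m] by (simp add: m)
    finally show ?thesis .
  qed
  then have "orbit ?r (r 0) = {(?r ^^ m) (r 0) | m. m < n}" using n by (rule orbit_altdef_bounded)
  also have "\<dots> = (\<lambda>m. (?r ^^ m) (r 0)) ` {..<n}" by blast
  also have "\<dots> = r ` {..<n}" by (rule image_cong[OF refl], rule pow[symmetric], simp)
  finally have orb: "orbit ?r (r 0) = r ` {..<n}" .
  have ce: "corner_edge \<sigma> ` {(i, r k), (0, \<sigma> i (r k))} = {(i, b k, w k), (0, b (Suc k mod n), w k)}"
    if k: "k < n" for k
  proof -
    have n': "Suc k mod n < n" using n by simp
    have "b (Suc k mod n) = fst (\<sigma> 0 (\<sigma> i (r k)))" using p[OF n'] succ[OF k] by simp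
    then show ?thesis using p[OF k] i by (simp add: corner_edge_def)
  qed
  have "corner_edge \<sigma> ` corner_cycle i (r 0) = (\<Union>k<n. corner_edge \<sigma> ` {(i, r k), (0, \<sigma> i (r k))})"
    unfolding corner_cycle_def orb by (simp only: image_UN UN_simps image_image)
  also have "\<dots> = Z" unfolding Z by (rule SUP_cong[OF refl]) (simp only: ce lessThan_iff)
  finally show "Z \<in> image (corner_edge \<sigma>) ` corner_cycle i ` P" using p[OF n] by blast
next
  interpret u: pair_system I P \<sigma> "{}" by (rule without_marks)
  let ?K = "pgraph I P \<sigma> {}" and ?r = "\<sigma> 0 \<circ> \<sigma> i"
  fix Z assume "Z \<in> image (corner_edge \<sigma>) ` corner_cycle i ` P"
  then obtain p where p: "p \<in> P" and Z: "Z = corner_edge \<sigma> ` corner_cycle i p" by blast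
  have self: "p \<in> orbit ?r p" by (rule in_orbit_of_bij[OF finite_P bij_comp[OF I] p])
  \<comment> \<open>The least positive period of \<open>p\<close>, so the pairs visited before
    \<open>n\<close> are distinct and the walk closes at \<open>n\<close>.\<close>
  define n where "n = funpow_dist1 ?r p p"
  define r where "r k = (?r ^^ k) p" for k
  have orb: "orbit ?r p = r ` {..<n}"
    using orbit_conv_funpow_dist1[OF self] by (simp add: r_def n_def lessThan_atLeast0)
  have inj: "inj_on r {..<n}"
    unfolding n_def lessThan_atLeast0
    using inj_on_funpow_dist1[OF self] unfolding r_def[symmetric] .
  have rn: "r n = r 0" using funpow_dist1_prop[OF self] by (simp add: r_def n_def)
  have n: "n > 0" by (simp add: n_def)
  have rP: "r k \<in> P" for k
    using p closed I by (induction k) (simp_all add: r_def)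
  have succ: "r (Suc k mod n) = \<sigma> 0 (\<sigma> i (r k))" if "k < n" for k
  proof (cases "Suc k = n")
    case True
    then show ?thesis using rn by (simp add: r_def flip: True)
  next
    case False
    then show ?thesis using that by (simp add: r_def)
  qed
  define b where "b k = fst (r k)" for k
  define w where "w k = snd (\<sigma> i (r k))" for k
  have ce: "corner_edge \<sigma> ` {(i, r k), (0, \<sigma> i (r k))} = {(i, b k, w k), (0, b (Suc k mod n), w k)}"
    if "k < n" for k
    using succ[OF that] i by (simp add: corner_edge_def b_def w_def)
  have "Z = (\<Union>k<n. corner_edge \<sigma> ` {(i, r k), (0, \<sigma> i (r k))})"
    unfolding Z corner_cycle_def orb by (simp only: image_UN UN_simps image_image)
  also have "\<dots> = (\<Union>k<n. {(i, b k, w k), (0, b (Suc k mod n), w k)})"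
    by (rule SUP_cong[OF refl]) (simp only: ce lessThan_iff)
  finally have "Z = (\<Union>k<n. {(i, b k, w k), (0, b (Suc k mod n), w k)})" .
  moreover have "inj_on b {..<n}"
    by (rule inj_onI) (metis b_def rP fst_eq inj inj_onD)
  moreover have "inj_on w {..<n}"
  proof (rule inj_onI)
    fix k l assume kl: "k \<in> {..<n}" "l \<in> {..<n}" "w k = w l"
    have "\<sigma> i (r k) = \<sigma> i (r l)"
      using snd_eq[OF closed[OF I(2) rP] closed[OF I(2) rP]] kl(3) by (simp add: w_def)
    then have "r k = r l" using sigma_eq_iff[OF I(2) rP rP] by simp
    then show "k = l" using inj kl by (auto dest: inj_onD)
  qed
  moreover have "Z \<subseteq> gedges ?K"
    unfolding Z gedges_pgraph using corner_cycle_sub[OF I p] I by (intro image_mono) auto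
  ultimately show "Z \<in> bicoloured_cycles ?K i"
    unfolding bicoloured_cycles_def using n by blast
qed

text \<open>Cycles of the graph are the cycles of its completion that use no marked edge. As
  \<open>corner_edge\<close> is injective on corners, this means that the corresponding face
  contains no marked corner.\<close>

lemma bicoloured_cycles_pgraph:
  assumes I: "0 \<in> I" "i \<in> I" and i: "i \<noteq> 0"
  shows "bicoloured_cycles graph i =
    image (corner_edge \<sigma>) ` {F \<in> corner_cycle i ` P. F \<inter> M = {}}"
proof -
  have sub: "gedges graph \<subseteq> gedges (pgraph I P \<sigma> {})"
    unfolding gedges_pgraph by blast
  have FI: "F \<subseteq> I \<times> P" if "F \<in> corner_cycle i ` P" for F
    using that corner_cycle_sub[OF I] I by blast
  have avoid: "corner_edge \<sigma> ` F \<subseteq> gedges graph \<longleftrightarrow> F \<inter> M = {}"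
    if "F \<in> corner_cycle i ` P" for F
    unfolding gedges_pgraph
  proof
    assume sub: "corner_edge \<sigma> ` F \<subseteq> corner_edge \<sigma> ` (I \<times> P - M)"
    have "x \<notin> M" if x: "x \<in> F" for x
    proof -
      obtain y where "y \<in> I \<times> P - M" "corner_edge \<sigma> x = corner_edge \<sigma> y" using sub x by blast
      moreover have "x \<in> I \<times> P" using FI[OF \<open>F \<in> corner_cycle i ` P\<close>] x by blast
      ultimately have "x = y" "y \<notin> M" using inj_onD[OF inj_on_corner_edge] by blast+
      then show ?thesis by simp
    qed
    then show "F \<inter> M = {}" by blast
  next
    assume "F \<inter> M = {}"
    then have "F \<subseteq> I \<times> P - M" using FI[OF that] by blast
    then show "corner_edge \<sigma> ` F \<subseteq> corner_edge \<sigma> ` (I \<times> P - M)" by (rule image_mono)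
  qed
  have "bicoloured_cycles graph i =
      {Z \<in> bicoloured_cycles (pgraph I P \<sigma> {}) i. Z \<subseteq> gedges graph}"
    unfolding bicoloured_cycles_def using sub by blast
  also have "\<dots> = image (corner_edge \<sigma>) `
      {F \<in> corner_cycle i ` P. corner_edge \<sigma> ` F \<subseteq> gedges graph}"
    unfolding bicoloured_cycles_complete[OF assms] by (rule Compr_image_eq)
  also have "{F \<in> corner_cycle i ` P. corner_edge \<sigma> ` F \<subseteq> gedges graph} =
      {F \<in> corner_cycle i ` P. F \<inter> M = {}}"
    by (rule Collect_cong, rule conj_cong[OF refl avoid])
  finally show ?thesis .
qed

lemma bij_betw_edge_corner_image:
  assumes "\<And>F. F \<in> \<F> \<Longrightarrow> F \<subseteq> I \<times> P"
  shows "bij_betw (image (edge_corner P)) (image (corner_edge \<sigma>) ` \<F>) \<F>"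
  by (rule bij_betw_byWitness[where f' = "image (corner_edge \<sigma>)"])
    (use edge_corner_image assms in auto)

end

theorem theorem2p3p3:
  fixes D q :: nat
    and \<BB> :: "'b bgraph set"
    and \<Omega> :: "'b bgraph \<Rightarrow> ('b \<times> 'b) set"
  assumes bubbles: "\<And>B. B \<in> \<BB> \<Longrightarrow> bubble D B"
    and pairings: "\<And>B. B \<in> \<BB> \<Longrightarrow> pairing B (\<Omega> B)"
  shows "bij_betw
           (Psi0_class D \<Omega> ::
              (nat bgraph \<times> (nat \<Rightarrow> 'b bgraph \<times> 'b)) set \<Rightarrow>
              ((nat, nat, nat) smap \<times> (nat \<Rightarrow> 'b bgraph \<times> 'b \<times> 'b)) set)
           (GG D q \<BB> // GG_iso_rel D q \<BB>)
           (SS D q \<BB> \<Omega> // SS_iso_rel D q \<BB> \<Omega>)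
       \<and> (\<forall>(G :: nat bgraph) \<iota> \<Gamma> \<kappa> P.
            (G, \<iota>) \<in> GG D q \<BB> \<longrightarrow> (\<Gamma>, \<kappa>) = Psi0 D \<Omega> (G, \<iota>) \<longrightarrow> P = global_pairing \<Omega> G \<iota> \<longrightarrow>
              bij_betw (submap_of_bubble D G P) (bubbles G) (bubble_submaps \<Gamma>)
            \<and> (\<forall>B\<in>\<BB>.
                  bij_betw (submap_of_bubble D G P)
                    {C \<in> bubbles G. bubble_copy \<iota> B C}
                    {S \<in> bubble_submaps \<Gamma>. submap_copy D \<Omega> \<kappa> B S}
                \<and> ((\<forall>B'\<in>\<BB>. (\<exists>f. graph_iso f B' B) \<longrightarrow> B' = B) \<longrightarrow>
                    bij_betw (submap_of_bubble D G P)
                      {C \<in> bubbles G. \<exists>f. graph_iso f C B}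
                      {S \<in> bubble_submaps \<Gamma>. \<exists>f h g. smap_iso f h g S (Psi D B (\<Omega> B))}))
            \<and> (\<forall>i\<in>{1..D}.
                  bij_betw ((`) (edge_corner P))
                    (bicoloured_cycles (complete_graph G P) i)
                    (faces (bicoloured_submap i \<Gamma>))
                \<and> bij_betw ((`) (edge_corner P))
                    (bicoloured_cycles G i)
                    {F \<in> faces (bicoloured_submap i \<Gamma>).
                       F \<inter> marked (bicoloured_submap i \<Gamma>) = {}}))"
proof -
  interpret bubble_models D \<BB> \<Omega>
    using bubbles pairings by unfold_locales
  have cycles: "bij_betw ((`) (edge_corner P)) (bicoloured_cycles (complete_graph G P) i)
        (faces (bicoloured_submap i \<Gamma>))
      \<and> bij_betw ((`) (edge_corner P)) (bicoloured_cycles G i)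
        {F \<in> faces (bicoloured_submap i \<Gamma>). F \<inter> marked (bicoloured_submap i \<Gamma>) = {}}"
    if G: "(G, \<iota>) \<in> GG D q \<BB>" and \<Gamma>: "(\<Gamma>, \<kappa>) = Psi0 D \<Omega> (G, \<iota>)" and P: "P = global_pairing \<Omega> G \<iota>"
      and i: "i \<in> {1..D}"
    for G :: "nat bgraph" and \<iota> \<Gamma> \<kappa> P i
  proof -
    define \<sigma> where "\<sigma> = pair_perm (complete_graph G P) P"
    define M where "M = edge_corner P ` marked_edges G P"
    note X = GG_structure[OF G, folded P, folded \<sigma>_def M_def]
    have \<Gamma>: "\<Gamma> = cycle_map {0..D} P \<sigma> M" using \<Gamma> X(1) by simp
    interpret pair_system "{0..D}" P \<sigma> M by (rule X(2))
    have I: "0 \<in> {0..D}" "i \<in> {0..D}" "i \<noteq> 0" using i by auto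
    have K: "complete_graph G P = pgraph {0..D} P \<sigma> {}"
      using complete_pgraph[OF I(1)] unfolding X(3)[symmetric] .
    have sub: "F \<subseteq> {0..D} \<times> P" if "F \<in> corner_cycle i ` P" for F
      using that corner_cycle_sub[OF I(1,2)] I by blast
    have GM: "bicoloured_cycles G i = image (corner_edge \<sigma>) ` {F \<in> corner_cycle i ` P. F \<inter> M = {}}"
      using bicoloured_cycles_pgraph[OF I] unfolding X(3)[symmetric] .
    show ?thesis
      unfolding \<Gamma> faces_cycle_map[OF I] K bicoloured_cycles_complete[OF I] GM
    proof
      show "bij_betw ((`) (edge_corner P)) (image (corner_edge \<sigma>) ` corner_cycle i ` P)
          (corner_cycle i ` P)"
        by (rule bij_betw_edge_corner_image[OF sub])
      show "bij_betw ((`) (edge_corner P))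
          (image (corner_edge \<sigma>) ` {F \<in> corner_cycle i ` P. F \<inter> M = {}})
          {F \<in> corner_cycle i ` P. F \<inter> M = {}}"
        by (rule bij_betw_edge_corner_image, rule sub) simp
    qed
  qed
  show ?thesis
  proof (intro conjI allI impI ballI, goal_cases)
    case 1
    show ?case by (rule bij_betw_Psi0_class)
  next
    case 2
    then show ?case by (rule submap_of_bubble_bij(1))
  next
    case 3
    then show ?case by (rule submap_of_bubble_bij(2))
  next
    case 4
    show ?case by (rule submap_of_bubble_bij(3)[OF 4(1-4)]) (use 4(5) in blast)
  next
    case 5
    then show ?case by (rule cycles[THEN conjunct1])
  next
    case 6
    then show ?case by (rule cycles[THEN conjunct2])
  qed
qed

end
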